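(* Let $\ell$ be a prime which is unramified in the real quadratic field $F$, let $H=\mathrm{GL}_2(\mathbb{Q}_\ell)$ and let $\sigma$ be an unramified irreducible principal series representation of $G(\mathbb{Q}_\ell)$ as described in the context, with central character $\chi_\sigma$. Let $\chi,\psi$ be unramified quasicharacters of $\mathbb{Q}_\ell^\times$ such that $\chi\psi\cdot\chi_\sigma=1$ and $\chi\psi^{-1}\neq|\cdot|^{-1}$. Assume that $|\alpha_i|_{\mathbb{C}}=|\beta_i|_{\mathbb{C}}$ for $i=1,2$ if $\ell$ splits in $F$, respectively $|\alpha|_{\mathbb{C}}=|\beta|_{\mathbb{C}}$ if $\ell$ is inert in $F$, and that $|\chi(\ell)|_{\mathbb{C}}\neq|\psi(\ell)|_{\mathbb{C}}$. Then $$\dim_{\mathbb{C}}\operatorname{Hom}_H\big(I_H(\chi,\psi)\otimes\sigma,\mathbb{C}\big)\leq 1,$$ where $H$ acts on $I_H(\chi,\psi)\otimes\sigma$ diagonally (on $\sigma$ through $\iota$).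
   Context: For a non-Archimedean local field $E$ and quasicharacters $\chi,\psi$ of $E^\times$, $I_{\mathrm{GL}_2(E)}(\chi,\psi)$ denotes the space of smooth $f:\mathrm{GL}_2(E)\to\mathbb{C}$ with $f\big(\begin{smallmatrix}a&b\\0&d\end{smallmatrix}h\big)=|a/d|^{1/2}\chi(a)\psi(d)f(h)$, with $\mathrm{GL}_2(E)$ acting by right translation; write $I_H(\chi,\psi)$ for $E=\mathbb{Q}_\ell$. If $\ell$ splits in $F$, $G(\mathbb{Q}_\ell)=\mathrm{GL}_2(\mathbb{Q}_\ell)\times\mathrm{GL}_2(\mathbb{Q}_\ell)$, $\iota(h)=(h,h)$, and $\sigma=I_H(\chi_1,\psi_1)\otimes I_H(\chi_2,\psi_2)$ with $\chi_i,\psi_i$ unramified, $\chi_i\psi_i^{-1}\neq|\cdot|^{\pm1}$, $\alpha_i=\chi_i(\ell)$, $\beta_i=\psi_i(\ell)$, $\chi_\sigma=\chi_1\psi_1\chi_2\psi_2$. If $\ell$ is inert, $F_\ell$ is the unramified quadratic extension of $\mathbb{Q}_\ell$, $G(\mathbb{Q}_\ell)=\mathrm{GL}_2(F_\ell)$, $\iota$ is the inclusion $\mathrm{GL}_2(\mathbb{Q}_\ell)\subset\mathrm{GL}_2(F_\ell)$, and $\sigma=I_{\mathrm{GL}_2(F_\ell)}(\tilde\chi,\tilde\psi)$ with $\tilde\chi,\tilde\psi$ unramified quasicharacters of $F_\ell^\times$, $\tilde\chi\tilde\psi^{-1}\neq|\cdot|^{\pm1}$, $\alpha=\tilde\chi(\ell)$,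 $\beta=\tilde\psi(\ell)$, and $\chi_\sigma=(\tilde\chi\tilde\psi)|_{\mathbb{Q}_\ell^\times}$. *)

theory Defs
  imports "HOL-Analysis.Determinants" "HOL-Library.Function_Algebras"
    "HOL-Algebra.Ideal_Product" "HOL-Computational_Algebra.Computational_Algebra"
begin

section \<open>Real quadratic fields and the decomposition of rational primes\<close>

definition real_quadratic_field :: "real set \<Rightarrow> bool" where
  "real_quadratic_field F \<longleftrightarrow>
     (\<exists>d::nat. d > 1 \<and> squarefree d \<and>
        F = {of_rat a + of_rat b * sqrt (real d) | a b. True})"

definition ring_of_integers :: "real set \<Rightarrow> real ring" where
  "ring_of_integers F =
     \<lparr>carrier = {x \<in> F. algebraic_int x}, mult = (*), one = 1, zero = 0, add = (+)\<rparr>"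

abbreviation principal_ideal_of :: "real set \<Rightarrow> nat \<Rightarrow> real set" where
  "principal_ideal_of F l \<equiv> cgenideal (ring_of_integers F) (of_nat l)"

definition unramified_in :: "nat \<Rightarrow> real set \<Rightarrow> bool" where
  "unramified_in l F \<longleftrightarrow>
     (\<forall>P. primeideal P (ring_of_integers F) \<longrightarrow>
        \<not> principal_ideal_of F l \<subseteq> ideal_prod (ring_of_integers F) P P)"

definition splits_in :: "nat \<Rightarrow> real set \<Rightarrow> bool" where
  "splits_in l F \<longleftrightarrow>
     (\<exists>P Q. primeideal P (ring_of_integers F) \<and> primeideal Q (ring_of_integers F) \<and> P \<noteq> Q \<and>
        principal_ideal_of F l = ideal_prod (ring_of_integers F) P Q)"

definition inert_in :: "nat \<Rightarrow> real set \<Rightarrow> bool" where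
  "inert_in l F \<longleftrightarrow> primeideal (principal_ideal_of F l) (ring_of_integers F)"


section \<open>The local fields\<close>

locale nonarch_abs =
  fixes nv :: "'a::field \<Rightarrow> real"
  assumes nv_nonneg: "nv x \<ge> 0"
    and nv_eq_0_iff: "nv x = 0 \<longleftrightarrow> x = 0"
    and nv_mult: "nv (x * y) = nv x * nv y"
    and nv_add_le: "nv (x + y) \<le> max (nv x) (nv y)"

definition padic_abs :: "nat \<Rightarrow> rat \<Rightarrow> real" where
  "padic_abs l r =
     (if r = 0 then 0
      else real l powi (int (multiplicity (int l) (snd (quotient_of r)))
                        - int (multiplicity (int l) (fst (quotient_of r)))))"

text \<open>The field \<open>\<rat>\<^sub>\<ell>\<close> cannot be a type depending on the term \<open>\<ell>\<close>. Instead, a field with an absolute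
  value is said to be \<open>\<rat>\<^sub>\<ell>\<close> when it is a completion of \<open>\<rat>\<close> for the \<open>\<ell>\<close>-adic absolute value; this
  determines it up to a unique isometric isomorphism.\<close>

locale padic_field = nonarch_abs nv
  for l :: nat and nv :: "'a::field_char_0 \<Rightarrow> real" +
  assumes prime_l: "prime l"
    and nv_of_rat: "nv (of_rat r) = padic_abs l r"
    and dense: "e > 0 \<Longrightarrow> \<exists>r. nv (x - of_rat r) < e"
    and complete: "(\<forall>e>0. \<exists>N. \<forall>m\<ge>N. \<forall>n\<ge>N. nv (X m - X n) < e) \<Longrightarrow>
          \<exists>x. (\<lambda>n. nv (X n - x)) \<longlonglongrightarrow> 0"

text \<open>The unramified quadratic extension \<open>E\<close> of a field \<open>K\<close> with embedding \<open>j\<close>. The absolute value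
  of \<open>E\<close> is the normalised one (\<open>|x|\<^sub>E = |N(x)|\<^sub>K\<close>), hence the square in \<open>norm_j\<close>; it is
  the one occurring in the definition of \<open>I\<close> for \<open>GL\<^sub>2(E)\<close>. Unramified means ramification index 1,
  that is, equal value groups.\<close>

locale unramified_quadratic_ext = E: nonarch_abs nvE
  for nvK :: "'a::field \<Rightarrow> real" and nvE :: "'b::field \<Rightarrow> real" and j :: "'a \<Rightarrow> 'b" +
  assumes j_add: "j (x + y) = j x + j y"
    and j_mult: "j (x * y) = j x * j y"
    and j_one: "j 1 = 1"
    and degree_2: "vector_space.dim (\<lambda>c x. j c * x) (UNIV :: 'b set) = 2"
    and norm_j: "nvE (j x) = (nvK x)\<^sup>2"
    and unramified: "nvE ` (- {0}) = (\<lambda>x. nvE (j x)) ` (- {0})"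


section \<open>Quasicharacters\<close>

text \<open>Only the values on nonzero elements are relevant.\<close>

definition quasichar :: "('a::field \<Rightarrow> real) \<Rightarrow> ('a \<Rightarrow> complex) \<Rightarrow> bool" where
  "quasichar nv \<eta> \<longleftrightarrow>
     (\<forall>x. x \<noteq> 0 \<longrightarrow> \<eta> x \<noteq> 0) \<and>
     (\<forall>x y. x \<noteq> 0 \<longrightarrow> y \<noteq> 0 \<longrightarrow> \<eta> (x * y) = \<eta> x * \<eta> y) \<and>
     (\<forall>x. x \<noteq> 0 \<longrightarrow>
        (\<forall>e>0. \<exists>\<delta>>0. \<forall>y. y \<noteq> 0 \<longrightarrow> nv (y - x) < \<delta> \<longrightarrow> cmod (\<eta> y - \<eta> x) < e))"

definition unram_quasichar :: "('a::field \<Rightarrow> real) \<Rightarrow> ('a \<Rightarrow> complex) \<Rightarrow> bool" where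
  "unram_quasichar nv \<eta> \<longleftrightarrow> quasichar nv \<eta> \<and> (\<forall>x. nv x = 1 \<longrightarrow> \<eta> x = 1)"

definition eq_char :: "('a::field \<Rightarrow> complex) \<Rightarrow> ('a \<Rightarrow> complex) \<Rightarrow> bool" where
  "eq_char \<eta> \<theta> \<longleftrightarrow> (\<forall>x. x \<noteq> 0 \<longrightarrow> \<eta> x = \<theta> x)"


section \<open>Complex function spaces and their tensor products\<close>

definition cscale :: "complex \<Rightarrow> ('x \<Rightarrow> complex) \<Rightarrow> ('x \<Rightarrow> complex)" where
  "cscale c f = (\<lambda>x. c * f x)"

interpretation cfun: vector_space "cscale :: complex \<Rightarrow> ('x \<Rightarrow> complex) \<Rightarrow> ('x \<Rightarrow> complex)"
  by unfold_locales (auto simp: cscale_def fun_eq_iff algebra_simps)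

text \<open>The algebraic tensor product of spaces \<open>V\<close> and \<open>W\<close> of functions on sets \<open>X\<close> and \<open>Y\<close>: the
  canonical map from \<open>V \<otimes> W\<close> to the functions on \<open>X \<times> Y\<close>, sending \<open>f \<otimes> g\<close> to
  \<open>(x, y) \<mapsto> f(x)g(y)\<close>, is injective, and \<open>V \<otimes> W\<close> is identified with its image.\<close>

definition tensor :: "('x \<Rightarrow> complex) set \<Rightarrow> ('y \<Rightarrow> complex) set \<Rightarrow> ('x \<times> 'y \<Rightarrow> complex) set" where
  "tensor V W = cfun.span {(\<lambda>(x, y). f x * g y) | f g. f \<in> V \<and> g \<in> W}"


section \<open>Principal series\<close>

definition upper_tri :: "'a::field \<Rightarrow> 'a \<Rightarrow> 'a \<Rightarrow> 'a^2^2" where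
  "upper_tri a b d = vector [vector [a, b], vector [0, d]]"

text \<open>\<open>GL\<^sub>2(E)\<close> consists of the invertible matrices; a function on \<open>GL\<^sub>2(E)\<close> is encoded by its extension
  by \<open>0\<close> to all matrices. Smooth means invariant under right translation by an open subgroup; the
  right stabiliser of \<open>f\<close> is a subgroup, so it is open as soon as it contains a neighbourhood of
  the identity.\<close>

definition smooth_on_GL2 :: "('a::field \<Rightarrow> real) \<Rightarrow> ('a^2^2 \<Rightarrow> complex) \<Rightarrow> bool" where
  "smooth_on_GL2 nv f \<longleftrightarrow>
     (\<exists>e>0. \<forall>u. invertible u \<and> (\<forall>i k. nv (u $ i $ k - mat 1 $ i $ k) < e) \<longrightarrow>
        (\<forall>g. invertible g \<longrightarrow> f (g ** u) = f g))"

definition principal_series ::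
    "('a::field \<Rightarrow> real) \<Rightarrow> ('a \<Rightarrow> complex) \<Rightarrow> ('a \<Rightarrow> complex) \<Rightarrow> ('a^2^2 \<Rightarrow> complex) set" where
  "principal_series nv \<eta> \<theta> =
     {f. (\<forall>g. \<not> invertible g \<longrightarrow> f g = 0) \<and> smooth_on_GL2 nv f \<and>
         (\<forall>a b d h. a \<noteq> 0 \<longrightarrow> d \<noteq> 0 \<longrightarrow> invertible h \<longrightarrow>
            f (upper_tri a b d ** h) = complex_of_real (nv (a / d) powr (1/2)) * \<eta> a * \<theta> d * f h)}"


section \<open>Invariant functionals\<close>

text \<open>For a space \<open>T\<close> of functions on \<open>GL\<^sub>2(K) \<times> Y\<close>, on which \<open>h\<close> acts by
  \<open>(h t)(x, y) = t (xh, y \<cdot> h)\<close> where \<open>r h y = y \<cdot> h\<close> is a right action on \<open>Y\<close>, this is the space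
  \<open>Hom\<^sub>H(T, \<complex>)\<close>. A functional on \<open>T\<close> is encoded by its extension by \<open>0\<close>
  outside \<open>T\<close>, which makes the functionals a subspace of a function space.\<close>

definition invariant_functionals ::
    "('a::field^2^2 \<Rightarrow> 'y \<Rightarrow> 'y) \<Rightarrow> (('a^2^2) \<times> 'y \<Rightarrow> complex) set
       \<Rightarrow> ((('a^2^2) \<times> 'y \<Rightarrow> complex) \<Rightarrow> complex) set" where
  "invariant_functionals r T =
     {L. (\<forall>t. t \<notin> T \<longrightarrow> L t = 0) \<and>
         (\<forall>s\<in>T. \<forall>t\<in>T. L (s + t) = L s + L t) \<and>
         (\<forall>c. \<forall>t\<in>T. L (cscale c t) = c * L t) \<and>
         (\<forall>h. invertible h \<longrightarrow> (\<forall>t\<in>T. L (\<lambda>(x, y). t (x ** h, r h y)) = L t))}"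

text \<open>The library's \<open>dim\<close> is \<open>0\<close> on infinite-dimensional spaces, so the bound on the dimension
  asks for a finite basis.\<close>

definition cdim_le :: "('x \<Rightarrow> complex) set \<Rightarrow> nat \<Rightarrow> bool" where
  "cdim_le V n \<longleftrightarrow>
     (\<exists>B. B \<subseteq> V \<and> finite B \<and> card B \<le> n \<and> cfun.independent B \<and> cfun.span B = V)"

definition translate_split :: "'a::field^2^2 \<Rightarrow> ('a^2^2) \<times> ('a^2^2) \<Rightarrow> ('a^2^2) \<times> ('a^2^2)" where
  "translate_split h = (\<lambda>(g1, g2). (g1 ** h, g2 ** h))"

definition translate_inert :: "('a::field \<Rightarrow> 'b::field) \<Rightarrow> 'a^2^2 \<Rightarrow> 'b^2^2 \<Rightarrow> 'b^2^2" where
  "translate_inert j h g = g ** (\<chi> i k. j (h $ i $ k))"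

end

theory Submission
  imports Defs
begin

text \<open>An invariant functional on \<open>I(chi, psi) \<otimes> \<sigma>\<close> is determined by the functional \<open>lam\<close> on \<open>\<sigma>\<close> that
  pairs a vector with a function concentrated at the point of the projective line fixed by the upper
  triangular Borel subgroup; \<open>lam\<close> is equivariant for that subgroup. If \<open>|psi(l)| < |chi(l)|\<close>, the
  concentrated function is first moved by the intertwining operator
  \<open>I(psi, chi) \<rightarrow> I(chi, psi)\<close>, which is onto because \<open>chi/psi\<close> is not the inverse of the absolute
  value; this exchanges the two characters in the equivariance of \<open>lam\<close>, so that only the smaller of
  \<open>|chi(l)|\<close> and \<open>|psi(l)|\<close> ever matters.

  Next decompose \<open>\<sigma>\<close> along the orbits of the Borel subgroup on the product of two
  projective lines, respectively on the projective line over the quadratic extension. On the union of the orbits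
  away from the fixed point, the unipotent radical acts by translation on a quadratic algebra over
  the base field, and \<open>lam\<close> becomes a homogeneous distribution on the one-dimensional quotient; such
  a distribution is determined by its value on the unit ball. On the remaining orbits the exponents of the torus
  cannot match by the assumptions on absolute values. Hence one evaluation is injective on the space of
  invariant functionals.\<close>

text \<open>The exchange of the two characters is forced by the exponents. Put s = sqrt |\<pi>|, so
  that q = s^(-2), and let A be |\<alpha>_1 \<alpha>_2|, respectively |\<alpha>|. The constant
  \<open>c \<pi>\<close> in the equivariance of \<open>lam\<close> has modulus m / s with m =
  min(|chi(\<pi>)|, |psi(\<pi>)|). The central character gives |chi(\<pi>) psi(\<pi>)| A^2 = 1, so m
  A < 1. A nonzero contribution of a smaller orbit would need m A / s = q (split case, one
  coordinate at the fixed point) or s m A = 1 (all coordinates at the fixed point), and both are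
  excluded. With the maximum in place of m, the value 1/s for max A would give equality in both.
  Measures and limits are replaced by finite sums and eventual constancy: integrals over balls
  become sums over the residue representatives \<open>R m\<close>, normalised by
  \<open>real (card (R 1)) * nv \<pi> = 1\<close>, and the pairing with a shrinking test function is
  constant once the level of the vector is reached.\<close>

no_notation fps_nth (infixl "$" 75)

section \<open>Linear functionals on spaces of functions\<close>

text \<open>Sums and multiples are written pointwise, so that translates and finite sums of
  functions match directly. The values of \<open>L\<close> outside \<open>V\<close> are
  unconstrained.\<close>

definition clinear_on :: "('x \<Rightarrow> complex) set \<Rightarrow> (('x \<Rightarrow> complex) \<Rightarrow> complex) \<Rightarrow> bool" where
  "clinear_on V L \<longleftrightarrow> cfun.subspace V \<and>
     (\<forall>s\<in>V. \<forall>t\<in>V. L (\<lambda>x. s x + t x) = L s + L t) \<and> (\<forall>c. \<forall>t\<in>V. L (\<lambda>x. c * t x) = c * L t)"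

lemma subspace_add: "cfun.subspace V \<Longrightarrow> f \<in> V \<Longrightarrow> g \<in> V \<Longrightarrow> (\<lambda>x. f x + g x) \<in> V"
  using cfun.subspace_add[of V f g] by (simp add: plus_fun_def)

lemma subspace_scale: "cfun.subspace V \<Longrightarrow> f \<in> V \<Longrightarrow> (\<lambda>x. c * f x) \<in> V"
  using cfun.subspace_scale[of V f c] by (simp add: cscale_def)

lemma subspace_zero: "cfun.subspace V \<Longrightarrow> (\<lambda>x. 0) \<in> V"
  using cfun.subspace_0[of V] by (simp add: zero_fun_def)

lemma subspace_diff: "cfun.subspace V \<Longrightarrow> f \<in> V \<Longrightarrow> g \<in> V \<Longrightarrow> (\<lambda>x. f x - g x) \<in> V"
  using subspace_add[of V f "\<lambda>x. (-1) * g x"] subspace_scale[of V g "-1"] by simp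

lemma subspace_sum:
  assumes "cfun.subspace V" "finite A" "\<And>r. r \<in> A \<Longrightarrow> f r \<in> V"
  shows "(\<lambda>x. \<Sum>r\<in>A. c r * f r x) \<in> V"
  using assms(2,3)
proof (induction A rule: finite_induct)
  case empty
  then show ?case by (simp add: subspace_zero assms(1))
next
  case (insert a A)
  then show ?case
    by (simp add: subspace_add[OF assms(1) subspace_scale[OF assms(1)]])
qed

context
  fixes V :: "('x \<Rightarrow> complex) set" and L
  assumes L: "clinear_on V L"
begin

lemma clinear_onD_subspace: "cfun.subspace V"
  using L by (simp add: clinear_on_def)

lemma clinear_on_add: "s \<in> V \<Longrightarrow> t \<in> V \<Longrightarrow> L (\<lambda>x. s x + t x) = L s + L t"
  using L by (simp add: clinear_on_def)

lemma clinear_on_scale: "t \<in> V \<Longrightarrow> L (\<lambda>x. c * t x) = c * L t"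
  using L by (simp add: clinear_on_def)

lemma clinear_on_zero: "L (\<lambda>x. 0) = 0"
  using clinear_on_scale[of "\<lambda>x. 0" 0] subspace_zero[OF clinear_onD_subspace] by simp

lemma clinear_on_diff: "s \<in> V \<Longrightarrow> t \<in> V \<Longrightarrow> L (\<lambda>x. s x - t x) = L s - L t"
  using clinear_on_add[of s "\<lambda>x. (-1) * t x"] clinear_on_scale[of t "-1"]
    subspace_scale[OF clinear_onD_subspace, of t "-1"] by simp

lemma clinear_on_sum:
  assumes "finite A" "\<And>r. r \<in> A \<Longrightarrow> f r \<in> V"
  shows "L (\<lambda>x. \<Sum>r\<in>A. c r * f r x) = (\<Sum>r\<in>A. c r * L (f r))"
  using assms
proof (induction A rule: finite_induct)
  case empty
  then show ?case by (simp add: clinear_on_zero)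
next
  case (insert a A)
  have "(\<lambda>x. \<Sum>r\<in>A. c r * f r x) \<in> V"
    using insert by (intro subspace_sum clinear_onD_subspace) auto
  then show ?case
    using insert clinear_on_add[of "\<lambda>x. c a * f a x" "\<lambda>x. \<Sum>r\<in>A. c r * f r x"]
    by (simp add: clinear_on_scale subspace_scale[OF clinear_onD_subspace])
qed

lemma clinear_on_sum1:
  assumes "finite A" "\<And>r. r \<in> A \<Longrightarrow> f r \<in> V"
  shows "L (\<lambda>x. \<Sum>r\<in>A. f r x) = (\<Sum>r\<in>A. L (f r))"
  using clinear_on_sum[OF assms, where c = "\<lambda>_. 1"] by simp

lemma clinear_on_span_zero:
  assumes "B \<subseteq> V" "\<And>b. b \<in> B \<Longrightarrow> L b = 0" "f \<in> cfun.span B"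
  shows "L f = 0"
proof -
  have "f \<in> V \<and> L f = 0"
    using assms(3)
  proof (induction rule: cfun.span_induct_alt)
    case base
    show ?case
      using clinear_on_zero subspace_zero[OF clinear_onD_subspace] by (simp add: zero_fun_def)
  next
    case (step c x y)
    then show ?case
      using clinear_on_add[of "\<lambda>z. c * x z" y] clinear_on_scale[of x c] assms
        subspace_add[OF clinear_onD_subspace, of "\<lambda>z. c * x z" y]
        subspace_scale[OF clinear_onD_subspace, of x c]
      by (auto simp: cscale_def plus_fun_def)
  qed
  then show ?thesis by simp
qed

end

text \<open>Evaluation at \<open>t\<close> is injective on \<open>V\<close>, so any nonzero
  \<open>M\<close> spans: \<open>L - (L t / M t) M\<close> lies in \<open>V\<close> and vanishes at
  \<open>t\<close>.\<close>

lemma cdim_le_1I: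
  assumes V: "cfun.subspace V" and t: "\<And>L. L \<in> V \<Longrightarrow> L t = 0 \<Longrightarrow> L = (\<lambda>_. 0)"
  shows "cdim_le V 1"
proof (cases "\<exists>L\<in>V. L \<noteq> (\<lambda>_. 0)")
  case False
  have "V = {0}"
  proof (intro equalityI subsetI)
    show "L \<in> {0}" if "L \<in> V" for L
      using False that unfolding zero_fun_def by blast
    show "L \<in> V" if "L \<in> {0}" for L
      using that cfun.subspace_0[OF V] by (simp only: singleton_iff)
  qed
  then show ?thesis
    unfolding cdim_le_def by (intro exI[of _ "{}"]) (auto simp: cfun.independent_empty)
next
  case True
  then obtain M where M: "M \<in> V" "M \<noteq> (\<lambda>_. 0)" by (elim bexE)
  have Mt: "M t \<noteq> 0" using t[OF M(1)] M(2) by metis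
  have "V \<subseteq> cfun.span {M}"
  proof
    fix L assume L: "L \<in> V"
    have mem: "(\<lambda>x. L x - L t / M t * M x) \<in> V"
      using subspace_diff[OF V L subspace_scale[OF V M(1), of "L t / M t"]] by simp
    have "(\<lambda>x. L x - L t / M t * M x) = (\<lambda>_. 0)"
      by (rule t[OF mem]) (use Mt in simp)
    then have "L x - L t / M t * M x = 0" for x
      by (rule fun_cong)
    then have "L = cscale (L t / M t) M"
      unfolding cscale_def by (intro ext) (rule iffD1[OF right_minus_eq])
    moreover have "cscale (L t / M t) M \<in> cfun.span {M}"
      by (intro cfun.span_scale cfun.span_base) simp
    ultimately show "L \<in> cfun.span {M}" by metis
  qed
  moreover have "cfun.span {M} \<subseteq> V"
    using M(1) V by (intro cfun.span_minimal) simp_all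
  moreover have "cfun.independent {M}"
    using M by (simp add: cfun.dependent_single zero_fun_def)
  ultimately show ?thesis
    using M(1) unfolding cdim_le_def by (intro exI[of _ "{M}"] conjI equalityI) simp_all
qed

section \<open>Two by two matrices\<close>

definition mat2 :: "'a::zero \<Rightarrow> 'a \<Rightarrow> 'a \<Rightarrow> 'a \<Rightarrow> 'a^2^2" where
  "mat2 a b c d = vector [vector [a, b], vector [c, d]]"

lemma mat2_nth [simp]:
  "mat2 a b c d $ 1 $ 1 = a" "mat2 a b c d $ 1 $ 2 = b"
  "mat2 a b c d $ 2 $ 1 = c" "mat2 a b c d $ 2 $ 2 = d"
  by (simp_all add: mat2_def)

lemma mat2_eq_iff:
  "(A :: 'a^2^2) = B \<longleftrightarrow> A$1$1 = B$1$1 \<and> A$1$2 = B$1$2 \<and> A$2$1 = B$2$1 \<and> A$2$2 = B$2$2"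
  by (auto simp: vec_eq_iff forall_2)

lemma mult2_nth:
  "((A :: 'a::semiring_1^2^2) ** B) $ i $ k = A$i$1 * B$1$k + A$i$2 * B$2$k"
  by (simp add: matrix_matrix_mult_def sum_2)

lemma mat_1_nth [simp]:
  "(mat 1 :: 'a::{zero,one}^2^2) $ 1 $ 1 = 1" "(mat 1 :: 'a^2^2) $ 1 $ 2 = 0"
  "(mat 1 :: 'a^2^2) $ 2 $ 1 = 0" "(mat 1 :: 'a^2^2) $ 2 $ 2 = 1"
  by (simp_all add: mat_def)

lemma mat2_one: "mat2 1 0 0 1 = mat 1"
  by (simp add: mat2_eq_iff)

lemma upper_tri_mat2: "upper_tri a b d = mat2 a b 0 d"
  by (simp add: upper_tri_def mat2_def)

lemma det_mat2 [simp]: "det (mat2 a b c d :: 'a::comm_ring_1^2^2) = a * d - b * c"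
  by (simp add: det_2)

lemma invertible_mult2:
  "invertible ((A :: 'a::field^2^2) ** (B :: 'a^2^2)) \<longleftrightarrow> invertible A \<and> invertible B"
  by (simp add: invertible_det_nz det_mul)

lemma mat2_mult:
  "mat2 a b c d ** mat2 a' b' c' d' =
     (mat2 (a*a' + b*c') (a*b' + b*d') (c*a' + d*c') (c*b' + d*d') :: 'a::semiring_1^2^2)"
  by (simp add: mat2_eq_iff mult2_nth)

lemma invertible_mat2 [simp]:
  "invertible (mat2 a b c d :: 'a::field^2^2) \<longleftrightarrow> a * d \<noteq> b * c"
  by (simp add: invertible_det_nz)

lemma det_ne_0_row2:
  assumes "invertible (g :: 'a::field^2^2)"
  shows "g $ 2 $ 1 \<noteq> 0 \<or> g $ 2 $ 2 \<noteq> 0"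
  using assms by (auto simp: invertible_det_nz det_2)

section \<open>Non-Archimedean absolute values\<close>

context nonarch_abs
begin

lemma nv_0 [simp]: "nv 0 = 0"
  by (simp add: nv_eq_0_iff)

lemma nv_pos: "x \<noteq> 0 \<Longrightarrow> 0 < nv x"
  using nv_nonneg[of x] nv_eq_0_iff[of x] by linarith

lemma nv_1 [simp]: "nv 1 = 1"
  using nv_mult[of 1 1] nv_eq_0_iff[of 1] by simp

lemma nv_minus [simp]: "nv (- x) = nv x"
proof -
  have "(nv (-1))\<^sup>2 = 1" using nv_mult[of "-1" "-1"] by (simp add: power2_eq_square)
  then have "nv (-1) = 1" using nv_nonneg[of "-1"] by (simp add: power2_eq_1_iff)
  then show ?thesis using nv_mult[of "-1" x] by simp
qed

lemma nv_diff_commute: "nv (x - y) = nv (y - x)"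
  using nv_minus[of "x - y"] by simp

lemma nv_diff_le: "nv (x - y) \<le> max (nv x) (nv y)"
  using nv_add_le[of x "- y"] by simp

lemma nv_inverse: "nv (inverse x) = inverse (nv x)"
  by (cases "x = 0") (use nv_mult[of x "inverse x"] nv_pos[of x] in \<open>auto simp: field_simps\<close>)

lemma nv_divide: "nv (x / y) = nv x / nv y"
  by (simp add: divide_inverse nv_mult nv_inverse)

lemma nv_power: "nv (x ^ n) = nv x ^ n"
  by (induction n) (auto simp: nv_mult)

lemma nv_powi: "nv (x powi n) = nv x powi n"
  by (auto simp: power_int_def nv_power nv_inverse)

lemma nv_add_eq: "nv x < nv y \<Longrightarrow> nv (x + y) = nv y"
  using nv_add_le[of x y] nv_diff_le[of "x + y" x] by (simp split: if_splits)

lemma nv_add_eq': "nv y < nv x \<Longrightarrow> nv (x + y) = nv x"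
  using nv_add_eq[of y x] by (simp add: add.commute)

lemma nv_add_leI: "nv x \<le> e \<Longrightarrow> nv y \<le> e \<Longrightarrow> nv (x + y) \<le> e"
  using nv_add_le[of x y] by simp

lemma nv_add_lessI: "nv x < e \<Longrightarrow> nv y < e \<Longrightarrow> nv (x + y) < e"
  using nv_add_le[of x y] by simp

lemma nv_diff_leI: "nv x \<le> e \<Longrightarrow> nv y \<le> e \<Longrightarrow> nv (x - y) \<le> e"
  using nv_diff_le[of x y] by simp

lemma nv_near_one: "nv (x - 1) < 1 \<Longrightarrow> nv x = 1"
  using nv_add_eq[of "x - 1" 1] by simp

text \<open>For \<open>0 \<le> e < 1\<close> this is a congruence subgroup. Invertibility is listed
  separately because it does not follow from the bound when \<open>e \<ge> 1\<close>.\<close>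

definition near_one :: "real \<Rightarrow> 'a^2^2 \<Rightarrow> bool" where
  "near_one e u \<longleftrightarrow> invertible u \<and> (\<forall>i k. nv (u $ i $ k - mat 1 $ i $ k) \<le> e)"

lemma near_one_mono: "near_one e u \<Longrightarrow> e \<le> e' \<Longrightarrow> near_one e' u"
  unfolding near_one_def by (meson order_trans)

lemma near_one_det:
  assumes "near_one e u" "e < 1"
  shows "nv (det u) = 1" "nv (u $ 1 $ 1) = 1" "nv (u $ 2 $ 2) = 1"
proof -
  have u: "nv (u $ 1 $ 1 - 1) \<le> e" "nv (u $ 2 $ 2 - 1) \<le> e" "nv (u $ 1 $ 2) \<le> e" "nv (u $ 2 $ 1) \<le> e"
    using assms(1) unfolding near_one_def forall_2 by auto
  then show *: "nv (u $ 1 $ 1) = 1" "nv (u $ 2 $ 2) = 1"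
    using assms(2) by (auto intro!: nv_near_one)
  have "nv (u $ 1 $ 2 * u $ 2 $ 1) < 1"
    unfolding nv_mult using u assms(2) nv_nonneg mult_strict_mono[of "nv (u$1$2)" 1 "nv (u$2$1)" 1]
    by auto
  then have "nv (- (u $ 1 $ 2 * u $ 2 $ 1) + u $ 1 $ 1 * u $ 2 $ 2) = 1"
    by (subst nv_add_eq) (auto simp: nv_mult *)
  then show "nv (det u) = 1" by (simp add: det_2 algebra_simps)
qed

text \<open>With \<open>h'\<close> the inverse of \<open>h\<close>, one has
  \<open>h' u h - 1 = h' (u - 1) h\<close>, so conjugation enlarges the radius by at most the
  product of the two entry bounds.\<close>

lemma conj_near_one:
  assumes h: "h ** h' = mat 1" "h' ** h = mat 1"
    and M: "\<And>i k. nv (h $ i $ k) \<le> M" "\<And>i k. nv (h' $ i $ k) \<le> M'"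
    and u: "near_one e u"
  obtains u' where "near_one (M' * e * M) u'" "u ** h = h ** u'"
proof
  define D where "D = u - mat 1"
  have M0: "0 \<le> M" "0 \<le> M'" using M nv_nonneg order_trans by blast+
  have D: "nv (D $ i $ k) \<le> e" for i k using u by (simp add: near_one_def D_def)
  then have e0: "0 \<le> e" using nv_nonneg order_trans by blast
  have "invertible h" "invertible h'" using h by (auto simp: invertible_def)
  then have "invertible (h' ** u ** h)"
    using u by (simp add: invertible_mult2 near_one_def)
  moreover have "h' ** u ** h - mat 1 = h' ** D ** h"
  proof -
    have "h' ** (D + mat 1) ** h = h' ** D ** h + h' ** h"
      by (simp add: matrix_add_ldistrib mat2_eq_iff mult2_nth distrib_right)
    then show ?thesis by (simp add: D_def h)
  qed
  moreover have "nv ((h' ** D ** h) $ i $ k) \<le> M' * e * M" for i k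
    unfolding mult2_nth
    by (intro nv_add_leI) (auto simp: nv_mult intro!: mult_mono nv_add_leI M D M0 e0 nv_nonneg mult_nonneg_nonneg)
  ultimately show "near_one (M' * e * M) (h' ** u ** h)"
    unfolding near_one_def by (metis vector_minus_component)
  show "u ** h = h ** (h' ** u ** h)"
    by (simp add: matrix_mul_assoc h)
qed

lemma entries_bounded:
  obtains M where "M > 0" "\<And>i k. nv ((h :: 'a^2^2) $ i $ k) \<le> M"
proof
  let ?M = "1 + nv (h$1$1) + nv (h$1$2) + nv (h$2$1) + nv (h$2$2)"
  show "?M > 0"
    using nv_nonneg[of "h$1$1"] nv_nonneg[of "h$1$2"]
      nv_nonneg[of "h$2$1"] nv_nonneg[of "h$2$2"] by linarith
  have "\<forall>i k. nv (h $ i $ k) \<le> ?M"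
    unfolding forall_2 using nv_nonneg[of "h$1$1"] nv_nonneg[of "h$1$2"]
      nv_nonneg[of "h$2$1"] nv_nonneg[of "h$2$2"] by linarith
  then show "nv (h $ i $ k) \<le> ?M" for i k by blast
qed

lemma conj_near_one_small:
  assumes "invertible h" "0 < e"
  obtains e' where "0 < e'" "\<And>u. near_one e' u \<Longrightarrow> \<exists>u'. near_one e u' \<and> u ** h = h ** u'"
proof -
  obtain h' where h: "h ** h' = mat 1" "h' ** h = mat 1"
    using assms(1) by (auto simp: invertible_def)
  obtain M where M: "M > 0" "\<And>i k. nv (h $ i $ k) \<le> M" using entries_bounded by blast
  obtain M' where M': "M' > 0" "\<And>i k. nv (h' $ i $ k) \<le> M'" using entries_bounded by blast
  show thesis
  proof
    show "0 < e / (M * M')" using assms M M' by simp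
    show "\<exists>u'. near_one e u' \<and> u ** h = h ** u'" if u: "near_one (e / (M * M')) u" for u
    proof -
      obtain u' where "near_one (M' * (e / (M * M')) * M) u'" "u ** h = h ** u'"
        using conj_near_one[OF h M(2) M'(2) u] by blast
      moreover have "M' * (e / (M * M')) * M = e" using M(1) M'(1) by (simp add: field_simps)
      ultimately show ?thesis by auto
    qed
  qed
qed

section \<open>The maximal compact subgroup\<close>

definition max_compact :: "('a^2^2) set" where
  "max_compact = {k. (\<forall>i j. nv (k $ i $ j) \<le> 1) \<and> nv (det k) = 1}"

lemma max_compact_invertible: "k \<in> max_compact \<Longrightarrow> invertible k"
  using nv_eq_0_iff by (force simp: max_compact_def invertible_det_nz)

lemma max_compact_mult: "k \<in> max_compact \<Longrightarrow> k' \<in> max_compact \<Longrightarrow> k ** k' \<in> max_compact"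
  by (auto simp: max_compact_def det_mul nv_mult mult2_nth mult_le_one nv_nonneg intro!: nv_add_leI)

lemma mat2_max_compact:
  "nv a \<le> 1 \<Longrightarrow> nv b \<le> 1 \<Longrightarrow> nv c \<le> 1 \<Longrightarrow> nv d \<le> 1 \<Longrightarrow> nv (a * d - b * c) = 1 \<Longrightarrow>
    mat2 a b c d \<in> max_compact"
  by (simp add: max_compact_def forall_2)

lemma max_compact_inverse:
  assumes "k \<in> max_compact"
  obtains k' where "k' \<in> max_compact" "k ** k' = mat 1" "k' ** k = mat 1"
proof -
  define D where "D = det k"
  define k' where "k' = mat2 (k$2$2 / D) (- k$1$2 / D) (- k$2$1 / D) (k$1$1 / D)"
  have D: "nv D = 1" using assms by (auto simp: max_compact_def D_def)
  then have D0: "D \<noteq> 0" by auto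
  have eq: "k$1$1 * k$2$2 - k$1$2 * k$2$1 = D" by (simp add: D_def det_2)
  have inv: "k ** k' = mat 1" "k' ** k = mat 1"
    using D0 eq unfolding mat2_eq_iff mult2_nth k'_def mat2_nth mat_1_nth
    by (simp_all add: divide_simps mult.commute)
  then have "det k * det k' = 1" by (metis det_I det_mul)
  then have "nv (det k) * nv (det k') = 1" by (metis nv_mult nv_1)
  then have "nv (det k') = 1" using D by (simp add: D_def)
  then have "k' \<in> max_compact"
    using assms D unfolding k'_def max_compact_def by (simp add: forall_2 nv_divide)
  then show thesis using inv that by blast
qed

text \<open>Here both entry bounds are 1, so the radius is preserved exactly: the maximal compact
  subgroup normalises every congruence level.\<close>

lemma conj_max_compact:
  assumes "k \<in> max_compact" "near_one e u"
  obtains u' where "near_one e u'" "u ** k = k ** u'"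
proof -
  obtain k' where k': "k' \<in> max_compact" "k ** k' = mat 1" "k' ** k = mat 1"
    using max_compact_inverse[OF assms(1)] .
  have "nv (k $ i $ j) \<le> 1" "nv (k' $ i $ j) \<le> 1" for i j
    using assms(1) k'(1) by (simp_all add: max_compact_def)
  then obtain u' where "near_one (1 * e * 1) u'" "u ** k = k ** u'"
    using conj_near_one[OF k'(2,3) _ _ assms(2), of 1 1] by blast
  then show thesis using that by simp
qed

end

section \<open>Unramified principal series\<close>

lemma sum_single_nonzero:
  assumes "finite A" "a \<in> A" "\<And>x. x \<in> A \<Longrightarrow> x \<noteq> a \<Longrightarrow> F x = 0"
  shows "sum F A = F a"
  using assms by (subst sum.remove[of A a]) (auto intro!: sum.neutral)

text \<open>\<open>R m\<close> is a set of representatives of the valuation ring modulo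
  \<open>\<pi> ^ m\<close>, given as data so that sums over residue classes are sums over finite
  sets of field elements. The locale serves both the base field and its quadratic extension.\<close>

locale discrete_field = nonarch_abs nv
  for nv :: "'a::field \<Rightarrow> real" +
  fixes \<pi> :: 'a and R :: "nat \<Rightarrow> 'a set"
  assumes unif: "0 < nv \<pi>" "nv \<pi> < 1"
    and value_group: "x \<noteq> 0 \<Longrightarrow> \<exists>k::int. nv x = nv \<pi> powi k"
    and finite_R: "finite (R m)"
    and R_le: "r \<in> R m \<Longrightarrow> nv r \<le> 1"
    and R_ex1: "nv x \<le> 1 \<Longrightarrow> \<exists>!r. r \<in> R m \<and> nv (x - r) \<le> nv \<pi> ^ m"
begin

lemma nv_le_0_iff [simp]: "nv x \<le> 0 \<longleftrightarrow> x = 0"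
  using nv_nonneg[of x] nv_eq_0_iff[of x] by auto

lemma unif_nz [simp]: "\<pi> \<noteq> 0"
  using unif by auto

lemma unif_power_small: "0 < e \<Longrightarrow> \<exists>m. \<forall>n\<ge>m. nv \<pi> ^ n \<le> e"
proof -
  assume e: "0 < e"
  obtain m where m: "nv \<pi> ^ m < e" using real_arch_pow_inv[OF e unif(2)] by blast
  have "nv \<pi> ^ n \<le> e" if "n \<ge> m" for n
    using power_decreasing[OF that, of "nv \<pi>"] unif m by linarith
  then show ?thesis by blast
qed

text \<open>The ball of radius \<open>|\<rho>|\<close> around \<open>x\<close>, in the homogeneous coordinate \<open>d / c\<close>.\<close>

lemma ball_refine:
  fixes E :: complex
  assumes "\<rho> \<noteq> 0" "c \<noteq> 0"
  shows "(if nv (d - x * c) \<le> nv \<rho> * nv c then E else 0) =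
    (\<Sum>r\<in>R m. if nv (d - (x + \<rho> * r) * c) \<le> nv (\<rho> * \<pi> ^ m) * nv c then E else 0)"
proof -
  define z where "z = (d - x * c) / (\<rho> * c)"
  have d: "d - x * c = z * \<rho> * c" using assms by (simp add: z_def)
  then have "d - (x + \<rho> * r) * c = (z - r) * \<rho> * c" for r by (simp add: algebra_simps)
  then have 1: "nv (d - (x + \<rho> * r) * c) \<le> nv (\<rho> * \<pi> ^ m) * nv c \<longleftrightarrow> nv (z - r) \<le> nv \<pi> ^ m" for r
    using nv_pos[OF assms(1)] nv_pos[OF assms(2)] by (simp add: nv_mult nv_power)
  have 2: "nv (d - x * c) \<le> nv \<rho> * nv c \<longleftrightarrow> nv z \<le> 1"
    using nv_pos[OF assms(1)] nv_pos[OF assms(2)] by (simp add: d nv_mult)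
  show ?thesis
  proof (cases "nv z \<le> 1")
    case True
    obtain r where r: "r \<in> R m" "nv (z - r) \<le> nv \<pi> ^ m" and
      u: "\<And>s. s \<in> R m \<Longrightarrow> nv (z - s) \<le> nv \<pi> ^ m \<Longrightarrow> s = r"
      using R_ex1[OF True, of m] by blast
    have "(\<Sum>r\<in>R m. if nv (z - r) \<le> nv \<pi> ^ m then E else 0) = (if nv (z - r) \<le> nv \<pi> ^ m then E else 0)"
    proof (rule sum_single_nonzero[OF finite_R r(1)])
      fix x assume "x \<in> R m" "x \<noteq> r"
      then have "\<not> nv (z - x) \<le> nv \<pi> ^ m" using u[of x] by blast
      then show "(if nv (z - x) \<le> nv \<pi> ^ m then E else 0) = 0" by simp
    qed
    then show ?thesis using True r unfolding 1 2 by simp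
  next
    case False
    have "\<not> nv (z - r) \<le> nv \<pi> ^ m" if "r \<in> R m" for r
    proof
      assume "nv (z - r) \<le> nv \<pi> ^ m"
      also have "\<dots> \<le> 1" using unif by (simp add: power_le_one)
      finally have "nv (z - r + r) \<le> 1" using R_le[OF that] by (rule nv_add_leI)
      then show False using False by simp
    qed
    then show ?thesis using False unfolding 1 2 by simp
  qed
qed

end

locale unram_ps = discrete_field nv \<pi> R
  for nv :: "'a::field \<Rightarrow> real" and \<pi> R +
  fixes chi psi :: "'a \<Rightarrow> complex"
  assumes chi: "unram_quasichar nv chi" and psi: "unram_quasichar nv psi"
begin

lemma chi_nz: "x \<noteq> 0 \<Longrightarrow> chi x \<noteq> 0" and psi_nz: "x \<noteq> 0 \<Longrightarrow> psi x \<noteq> 0"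
  and chi_mult: "x \<noteq> 0 \<Longrightarrow> y \<noteq> 0 \<Longrightarrow> chi (x * y) = chi x * chi y"
  and psi_mult: "x \<noteq> 0 \<Longrightarrow> y \<noteq> 0 \<Longrightarrow> psi (x * y) = psi x * psi y"
  and chi_unit: "nv x = 1 \<Longrightarrow> chi x = 1" and psi_unit: "nv x = 1 \<Longrightarrow> psi x = 1"
  using chi psi by (auto simp: unram_quasichar_def quasichar_def)

text \<open>The factor |a/d|^(1/2) chi(a) psi(d) splits as \<open>omega (a * d) * eta d\<close>.
  Removing the twist by \<open>omega\<close> of the determinant leaves a function of the bottom row
  that is homogeneous of character \<open>eta\<close>, and \<open>eta\<close> measures the quotient
  of the two inducing characters.\<close>

definition omega :: "'a \<Rightarrow> complex" where
  "omega s = complex_of_real (nv s powr (1/2)) * chi s"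

definition eta :: "'a \<Rightarrow> complex" where
  "eta s = complex_of_real (inverse (nv s)) * psi s / chi s"

lemma omega_nz: "s \<noteq> 0 \<Longrightarrow> omega s \<noteq> 0"
  using nv_pos[of s] by (simp add: omega_def chi_nz)

lemma eta_nz: "s \<noteq> 0 \<Longrightarrow> eta s \<noteq> 0"
  using nv_pos[of s] by (simp add: eta_def chi_nz psi_nz)

lemma omega_mult: "s \<noteq> 0 \<Longrightarrow> t \<noteq> 0 \<Longrightarrow> omega (s * t) = omega s * omega t"
  by (simp add: omega_def chi_mult nv_mult powr_mult nv_nonneg)

lemma eta_mult: "s \<noteq> 0 \<Longrightarrow> t \<noteq> 0 \<Longrightarrow> eta (s * t) = eta s * eta t"
  by (simp add: eta_def chi_mult psi_mult nv_mult)

lemma omega_unit: "nv s = 1 \<Longrightarrow> omega s = 1"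
  by (simp add: omega_def chi_unit)

lemma eta_unit: "nv s = 1 \<Longrightarrow> eta s = 1"
  by (simp add: eta_def chi_unit psi_unit)

lemma eta_cong:
  assumes "nv s = nv t"
  shows "eta s = eta t"
proof (cases "t = 0")
  case True
  then show ?thesis using assms nv_eq_0_iff by simp
next
  case False
  then have "s \<noteq> 0" using assms nv_eq_0_iff by metis
  then show ?thesis
    using False assms eta_mult[of "s / t" t] eta_unit[of "s / t"] nv_pos[OF False]
    by (simp add: nv_divide)
qed

lemma omega_eta:
  assumes "a \<noteq> 0" "d \<noteq> 0"
  shows "omega (a * d) * eta d = complex_of_real (nv (a / d) powr (1/2)) * chi a * psi d"
proof -
  have "nv d powr (1/2) * nv d powr (1/2) = nv d"
    using nv_pos[OF assms(2)] by (simp add: powr_half_sqrt)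
  then have "nv (a * d) powr (1/2) * inverse (nv d) = nv (a / d) powr (1/2)"
    using nv_pos[OF assms(2)] nv_nonneg[of a]
    by (simp add: nv_mult nv_divide powr_mult powr_divide field_simps)
  then have "complex_of_real (nv (a * d) powr (1/2)) * complex_of_real (inverse (nv d)) =
      complex_of_real (nv (a / d) powr (1/2))"
    by (metis of_real_mult)
  moreover have "omega (a * d) * eta d = complex_of_real (nv (a * d) powr (1/2)) *
      complex_of_real (inverse (nv d)) * chi a * psi d"
    using assms chi_nz by (simp add: omega_def eta_def chi_mult)
  ultimately show ?thesis by simp
qed

text \<open>A function in the principal series is determined by its dependence on the bottom row, which is
  homogeneous of character \<open>eta\<close>.\<close>

definition rowf :: "('a \<Rightarrow> 'a \<Rightarrow> complex) \<Rightarrow> 'a^2^2 \<Rightarrow> complex" where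
  "rowf \<Psi> g = (if invertible g then omega (det g) * \<Psi> (g $ 2 $ 1) (g $ 2 $ 2) else 0)"

abbreviation "PS \<equiv> principal_series nv chi psi"

lemma rowf_mult:
  assumes "invertible h"
  shows "rowf \<Psi> (g ** h) =
    omega (det h) * rowf (\<lambda>c d. \<Psi> (c * h$1$1 + d * h$2$1) (c * h$1$2 + d * h$2$2)) g"
  using assms
  by (simp add: rowf_def invertible_mult2 det_mul omega_mult invertible_det_nz mult2_nth)

text \<open>For \<open>e < 1\<close> the determinant of \<open>u\<close> is a unit, on which
  \<open>omega\<close> is trivial; smoothness therefore only concerns the row function.\<close>

lemma rowf_mem:
  assumes hom: "\<And>s c d. s \<noteq> 0 \<Longrightarrow> c \<noteq> 0 \<or> d \<noteq> 0 \<Longrightarrow> \<Psi> (s * c) (s * d) = eta s * \<Psi> c d"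
    and e: "0 < e" "e < 1"
    and inv: "\<And>u c d. near_one e u \<Longrightarrow> c \<noteq> 0 \<or> d \<noteq> 0 \<Longrightarrow>
        \<Psi> (c * u$1$1 + d * u$2$1) (c * u$1$2 + d * u$2$2) = \<Psi> c d"
  shows "rowf \<Psi> \<in> PS"
proof -
  have "rowf \<Psi> (g ** u) = rowf \<Psi> g" if "near_one e u" "invertible g" for u g
  proof -
    have "omega (det u) = 1" by (rule omega_unit[OF near_one_det(1)[OF that(1) e(2)]])
    then show ?thesis
      using that inv[OF that(1) det_ne_0_row2[OF that(2)]]
      by (simp add: rowf_mult near_one_def) (simp add: rowf_def)
  qed
  then have "smooth_on_GL2 nv (rowf \<Psi>)"
    unfolding smooth_on_GL2_def near_one_def using e(1) less_imp_le by (metis (no_types, lifting))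
  moreover have "rowf \<Psi> (upper_tri a b d ** h) =
      complex_of_real (nv (a / d) powr (1/2)) * chi a * psi d * rowf \<Psi> h"
    if "a \<noteq> 0" "d \<noteq> 0" "invertible h" for a b d h
  proof -
    have "invertible (upper_tri a b d)" using that by (simp add: upper_tri_mat2)
    moreover have "omega (det (upper_tri a b d ** h)) = omega (a * d) * omega (det h)"
      using that by (simp add: det_mul upper_tri_mat2 omega_mult invertible_det_nz)
    ultimately have "rowf \<Psi> (upper_tri a b d ** h) = omega (a * d) * eta d * rowf \<Psi> h"
      using that det_ne_0_row2[OF that(3)]
      by (simp add: rowf_def invertible_mult2 mult2_nth upper_tri_mat2 hom)
    then show ?thesis using omega_eta[OF that(1,2)] by simp
  qed
  moreover have "\<forall>g. \<not> invertible g \<longrightarrow> rowf \<Psi> g = 0"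
    by (simp add: rowf_def)
  ultimately show ?thesis by (simp add: principal_series_def)
qed

section \<open>The principal series as a smooth representation\<close>

lemma PS_noninvertible: "f \<in> PS \<Longrightarrow> \<not> invertible g \<Longrightarrow> f g = 0"
  by (simp add: principal_series_def)

lemma PS_smooth:
  assumes "f \<in> PS"
  obtains e where "0 < e" "\<And>u g. near_one e u \<Longrightarrow> f (g ** u) = f g"
proof -
  obtain e where e: "e > 0"
    "\<And>u g :: 'a^2^2. invertible u \<Longrightarrow> (\<And>i k. nv (u $ i $ k - mat 1 $ i $ k) < e) \<Longrightarrow>
      invertible g \<Longrightarrow> f (g ** u) = f g"
    using assms by (auto simp: principal_series_def smooth_on_GL2_def)
  \<comment> \<open>The radius is halved because \<open>near_one\<close> uses a weak inequality and
    smoothness a strict one.\<close>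
  have "f (g ** u) = f g" if u: "near_one (e/2) u" for u g
  proof (cases "invertible g")
    case True
    have "nv (u $ i $ k - mat 1 $ i $ k) \<le> e / 2" for i k
      using u by (simp add: near_one_def)
    moreover have "e / 2 < e" using e(1) by simp
    ultimately have "nv (u $ i $ k - mat 1 $ i $ k) < e" for i k
      by (rule le_less_trans)
    then show ?thesis using e(2) True u by (simp add: near_one_def)
  next
    case False
    then show ?thesis
      using PS_noninvertible[OF assms, of g] PS_noninvertible[OF assms, of "g ** u"] invertible_mult2[of g u]
      by simp
  qed
  then show thesis using that[of "e/2"] e(1) by simp
qed

lemma PS_upper:
  "f \<in> PS \<Longrightarrow> a \<noteq> 0 \<Longrightarrow> d \<noteq> 0 \<Longrightarrow> invertible h \<Longrightarrow>
    f (mat2 a b 0 d ** h) = omega (a * d) * eta d * f h"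
  by (simp add: principal_series_def omega_eta flip: upper_tri_mat2)

lemma PS_I:
  assumes "\<And>g. \<not> invertible g \<Longrightarrow> f g = 0"
    and "0 < e" "\<And>u g. near_one e u \<Longrightarrow> invertible g \<Longrightarrow> f (g ** u) = f g"
    and "\<And>a b d h. a \<noteq> 0 \<Longrightarrow> d \<noteq> 0 \<Longrightarrow> invertible h \<Longrightarrow>
      f (mat2 a b 0 d ** h) = omega (a * d) * eta d * f h"
  shows "f \<in> PS"
proof -
  have "smooth_on_GL2 nv f"
    unfolding smooth_on_GL2_def
  proof (intro exI[of _ e] conjI allI impI assms(2))
    fix u g :: "'a^2^2"
    assume "invertible u \<and> (\<forall>i k. nv (u $ i $ k - mat 1 $ i $ k) < e)" "invertible g"
    then show "f (g ** u) = f g"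
      by (intro assms(3)) (auto simp: near_one_def less_imp_le)
  qed
  then show ?thesis
    using assms(1,4) by (simp add: principal_series_def omega_eta upper_tri_mat2)
qed

lemma PS_subspace: "cfun.subspace PS"
proof -
  have "(\<lambda>x. f x + g x) \<in> PS" if fg: "f \<in> PS" "g \<in> PS" for f g
  proof -
    obtain e e' where e: "0 < e" "\<And>u h. near_one e u \<Longrightarrow> f (h ** u) = f h"
      "0 < e'" "\<And>u h. near_one e' u \<Longrightarrow> g (h ** u) = g h"
      using PS_smooth[OF fg(1)] PS_smooth[OF fg(2)] by metis
    show ?thesis
    proof (rule PS_I[of _ "min e e'"])
      show "f (h ** u) + g (h ** u) = f h + g h" if "near_one (min e e') u" for u h
        using e(2)[of u h] e(4)[of u h] near_one_mono[OF that] by simp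
    qed (use e fg in \<open>auto simp: PS_noninvertible PS_upper algebra_simps\<close>)
  qed
  moreover have "(\<lambda>x. c * f x) \<in> PS" if f: "f \<in> PS" for c f
  proof -
    obtain e where e: "0 < e" "\<And>u h. near_one e u \<Longrightarrow> f (h ** u) = f h"
      using PS_smooth[OF f] by metis
    show ?thesis
      by (rule PS_I[of _ e]) (use e f in \<open>auto simp: PS_noninvertible PS_upper\<close>)
  qed
  moreover have "(\<lambda>x. 0) \<in> PS"
    by (rule PS_I[of _ 1]) auto
  ultimately show ?thesis
    unfolding cfun.subspace_def by (simp add: plus_fun_def zero_fun_def cscale_def)
qed

lemma PS_translate:
  assumes f: "f \<in> PS" and h: "invertible h"
  shows "(\<lambda>g. f (g ** h)) \<in> PS"
proof -
  obtain e where e: "0 < e" "\<And>u h. near_one e u \<Longrightarrow> f (h ** u) = f h"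
    using PS_smooth[OF f] by metis
  obtain e' where e': "0 < e'" "\<And>u. near_one e' u \<Longrightarrow> \<exists>u'. near_one e u' \<and> u ** h = h ** u'"
    using conj_near_one_small[OF h e(1)] by metis
  show ?thesis
  proof (rule PS_I[OF _ e'(1)])
    show "f (g ** u ** h) = f (g ** h)" if "near_one e' u" for g u
      using e'(2)[OF that] e(2) by (metis matrix_mul_assoc)
    show "f (mat2 a b 0 d ** k ** h) = omega (a * d) * eta d * f (k ** h)"
      if "a \<noteq> 0" "d \<noteq> 0" "invertible k" for a b d k
      using PS_upper[OF f that(1,2), of "k ** h" b] that h by (simp add: invertible_mult2 matrix_mul_assoc)
  qed (use h in \<open>simp add: PS_noninvertible[OF f] invertible_mult2\<close>)
qed

text \<open>An upper triangular factor is split off on the left, leaving a representative with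
  bottom row (c/d, 1). \<open>PS_row_big\<close> does the same for (1, d/c). These are the two
  charts of the projective line, with coordinates c/d and d/c.\<close>

lemma PS_row_small:
  assumes f: "f \<in> PS" and g: "invertible g" "g $ 2 $ 2 \<noteq> 0"
  shows "f g = omega (det g) * eta (g $ 2 $ 2) * f (mat2 1 0 (g $ 2 $ 1 / g $ 2 $ 2) 1)"
proof -
  let ?d = "g $ 2 $ 2"
  have D: "det g \<noteq> 0" using g by (simp add: invertible_det_nz)
  have "g = mat2 (det g / ?d) (g$1$2) 0 ?d ** mat2 1 0 (g$2$1 / ?d) 1"
    using g(2) by (simp add: mat2_eq_iff mat2_mult det_2 field_simps)
  moreover have "det g / ?d * ?d = det g" using g(2) by simp
  ultimately show ?thesis
    using PS_upper[OF f, of "det g / ?d" ?d "mat2 1 0 (g$2$1 / ?d) 1" "g$1$2"] g(2) D by simp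
qed

lemma PS_row_big:
  assumes f: "f \<in> PS" and g: "invertible g" "g $ 2 $ 1 \<noteq> 0"
  shows "f g = omega (det g) * eta (g $ 2 $ 1) * f (mat2 0 (-1) 1 (g $ 2 $ 2 / g $ 2 $ 1))"
proof -
  let ?c = "g $ 2 $ 1"
  have D: "det g \<noteq> 0" using g by (simp add: invertible_det_nz)
  have "g = mat2 (det g / ?c) (g$1$1) 0 ?c ** mat2 0 (-1) 1 (g$2$2 / ?c)"
    using g(2) by (simp add: mat2_eq_iff mat2_mult det_2 field_simps)
  moreover have "det g / ?c * ?c = det g" using g(2) by simp
  ultimately show ?thesis
    using PS_upper[OF f, of "det g / ?c" ?c "mat2 0 (-1) 1 (g$2$2 / ?c)" "g$1$1"] g(2) D by simp
qed

text \<open>One formula for both test families: \<open>A = 1\<close>, \<open>B = 0\<close> gives a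
  ball around the point c = 0, and \<open>B = 1\<close> with a suitable \<open>A\<close> gives its
  image under the intertwining operator. Smoothness is then proved once.\<close>

definition two_valued :: "'a \<Rightarrow> complex \<Rightarrow> complex \<Rightarrow> 'a^2^2 \<Rightarrow> complex" where
  "two_valued \<rho> A B = rowf (\<lambda>c d. if nv c \<le> nv \<rho> * nv d then A * eta d else B * eta c)"

definition small :: "'a \<Rightarrow> 'a \<Rightarrow> 'a^2^2 \<Rightarrow> complex" where
  "small x \<rho> = rowf (\<lambda>c d. if nv (c - x * d) \<le> nv \<rho> * nv d then eta d else 0)"

definition big :: "'a \<Rightarrow> 'a \<Rightarrow> 'a^2^2 \<Rightarrow> complex" where
  "big x \<rho> = rowf (\<lambda>c d. if nv (d - x * c) \<le> nv \<rho> * nv c then eta c else 0)"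

lemma two_valued_mem:
  assumes "\<rho> \<noteq> 0"
  shows "two_valued \<rho> A B \<in> PS"
proof -
  define r where "r = nv \<rho>"
  have r: "r > 0" using nv_pos[OF assms] by (simp add: r_def)
  \<comment> \<open>The three bounds give \<open>e < 1\<close>, \<open>e < r\<close> and
    \<open>r * e < 1\<close>: an \<open>e\<close>-close matrix then changes neither |d| inside the
    region |c| \<le> r |d| nor |c| outside it.\<close>
  define e where "e = min (1/2) (min (r/2) (1/(2*r)))"
  have e: "0 < e" "e < 1" "e < r" "r * e < 1"
  proof -
    show "0 < e" "e < 1" "e < r" using r by (auto simp: e_def min_less_iff_disj)
    have "r * e \<le> r * (1/(2*r))" using r by (intro mult_left_mono) (auto simp: e_def)
    then show "r * e < 1" using r by simp
  qed
  show ?thesis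
    unfolding two_valued_def r_def[symmetric]
  proof (rule rowf_mem[OF _ e(1,2)])
    fix s c d :: 'a assume s: "s \<noteq> 0" and cd: "c \<noteq> 0 \<or> d \<noteq> 0"
    have "d \<noteq> 0" if "nv c \<le> r * nv d" using cd that nv_pos[of c] by auto
    moreover have "c \<noteq> 0" if "\<not> nv c \<le> r * nv d" using that r nv_nonneg[of d] by auto
    ultimately show "(if nv (s * c) \<le> r * nv (s * d) then A * eta (s * d) else B * eta (s * c)) =
        eta s * (if nv c \<le> r * nv d then A * eta d else B * eta c)"
      using s nv_pos[OF s] by (auto simp: nv_mult eta_mult mult.left_commute)
  next
    fix u and c d :: 'a assume u: "near_one e u" and cd: "c \<noteq> 0 \<or> d \<noteq> 0"
    have u': "nv (u$1$1) = 1" "nv (u$2$2) = 1" "nv (u$1$2) \<le> e" "nv (u$2$1) \<le> e"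
      using near_one_det[OF u e(2)] u by (auto simp: near_one_def forall_2)
    let ?c = "c * u$1$1 + d * u$2$1" and ?d = "c * u$1$2 + d * u$2$2"
    show "(if nv ?c \<le> r * nv ?d then A * eta ?d else B * eta ?c) =
        (if nv c \<le> r * nv d then A * eta d else B * eta c)"
    proof (cases "nv c \<le> r * nv d")
      case True
      then have d: "nv d > 0" using cd by (intro nv_pos) auto
      have "nv c * nv (u$1$2) \<le> r * nv d * e"
        using True u' e nv_nonneg by (intro mult_mono) (auto intro!: mult_nonneg_nonneg simp: less_imp_le r)
      also have "\<dots> < nv d" using e(4) d by (simp add: mult.commute mult.left_commute)
      finally have d': "nv ?d = nv d" by (subst nv_add_eq) (auto simp: nv_mult u')
      have "nv d * nv (u$2$1) \<le> nv d * r" using u' e(3) by (intro mult_left_mono) (auto simp: nv_nonneg)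
      then have "nv ?c \<le> r * nv d" using True by (intro nv_add_leI) (auto simp: nv_mult u' mult.commute)
      then show ?thesis using True d' eta_cong[OF d'] by simp
    next
      case False
      have "nv d * nv (u$2$1) \<le> nv d * r" using u' e(3) by (intro mult_left_mono) (auto simp: nv_nonneg)
      then have c': "nv ?c = nv c" using False by (subst nv_add_eq') (auto simp: nv_mult u' mult.commute)
      have c: "nv c > 0" using False r mult_nonneg_nonneg[of r "nv d"] nv_nonneg[of d] by linarith
      have "nv c * nv (u$1$2) \<le> nv c * e"
        using u' by (intro mult_left_mono) (auto simp: nv_nonneg)
      then have "r * (nv c * nv (u$1$2)) \<le> r * (nv c * e)" by (rule mult_left_mono) (use r in simp)
      also have "\<dots> < nv c" using e(4) c by (simp add: mult.left_commute)
      finally have "nv (c * u$1$2) < nv c / r" using r by (simp add: nv_mult field_simps)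
      moreover have "nv (d * u$2$2) < nv c / r" using False r by (simp add: nv_mult u' field_simps)
      ultimately have "nv ?d < nv c / r" by (rule nv_add_lessI)
      then have "\<not> nv ?c \<le> r * nv ?d" using c' r by (simp add: field_simps)
      then show ?thesis using False eta_cong[OF c'] by simp
    qed
  qed
qed

lemma small_0_eq: "small 0 \<rho> = two_valued \<rho> 1 0"
  by (auto simp: small_def two_valued_def rowf_def fun_eq_iff)

lemma small_translate: "small x \<rho> g = small 0 \<rho> (g ** mat2 1 0 (-x) 1)"
  by (simp add: small_def rowf_mult omega_unit) (simp add: rowf_def algebra_simps)

text \<open>The matrix exchanges the two charts and moves the centre to 0. For |x| \<le> 1 it is in
  the maximal compact subgroup, so that translates of \<open>small 0 \<rho>\<close> by this subgroup
  include balls in both charts.\<close>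

lemma big_translate: "big x \<rho> g = small 0 \<rho> (g ** mat2 (-x) 1 1 0)"
  by (simp add: big_def small_def rowf_mult omega_unit) (simp add: rowf_def algebra_simps)

lemma small_mem: "\<rho> \<noteq> 0 \<Longrightarrow> small x \<rho> \<in> PS"
  using PS_translate[OF two_valued_mem[of \<rho> 1 0], of "mat2 1 0 (-x) 1"]
  by (simp add: small_0_eq[symmetric] small_translate[symmetric])

lemma big_mem: "\<rho> \<noteq> 0 \<Longrightarrow> big x \<rho> \<in> PS"
  using PS_translate[OF two_valued_mem[of \<rho> 1 0], of "mat2 (-x) 1 1 0"]
  by (simp add: small_0_eq[symmetric] big_translate[symmetric])

lemma big_cong: "nv \<rho> = nv \<rho>' \<Longrightarrow> big x \<rho> = big x \<rho>'"
  by (simp add: big_def)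

lemma big_refine:
  assumes "\<rho> \<noteq> 0"
  shows "big x \<rho> g = (\<Sum>r\<in>R m. big (x + \<rho> * r) (\<rho> * \<pi> ^ m) g)"
proof (cases "g $ 2 $ 1 = 0")
  case True
  then show ?thesis by (auto simp: big_def rowf_def nv_eq_0_iff dest: det_ne_0_row2 intro!: sum.neutral[symmetric])
next
  case False
  then show ?thesis
    by (simp add: big_def rowf_def ball_refine[OF assms False] flip: sum_distrib_left)
qed

lemma small_refine:
  assumes "\<rho> \<noteq> 0"
  shows "small x \<rho> g = (\<Sum>r\<in>R m. small (x + \<rho> * r) (\<rho> * \<pi> ^ m) g)"
proof (cases "g $ 2 $ 2 = 0")
  case True
  then show ?thesis by (auto simp: small_def rowf_def nv_eq_0_iff dest: det_ne_0_row2 intro!: sum.neutral[symmetric])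
next
  case False
  then show ?thesis
    by (simp add: small_def rowf_def ball_refine[OF assms False] flip: sum_distrib_left)
qed

text \<open>The projective line is the disjoint union of the closed unit ball in d/c and the open
  unit ball in c/d, and a function of level \<open>m\<close> is determined on each ball of radius
  |\<pi>|^m by its value at the centre. The condition \<open>m \<ge> 1\<close> keeps the balls
  around \<open>r\<close> with |r| < 1 inside the open unit ball.\<close>

lemma PS_cells:
  assumes f: "f \<in> PS" and m: "m \<ge> 1" and inv: "\<And>u g. near_one (nv \<pi> ^ m) u \<Longrightarrow> f (g ** u) = f g"
  shows "f g = (\<Sum>r\<in>R m. f (mat2 0 (-1) 1 r) * big r (\<pi> ^ m) g) +
    (\<Sum>r\<in>{r \<in> R m. nv r < 1}. f (mat2 1 0 r 1) * small r (\<pi> ^ m) g)"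
proof (cases "invertible g")
  case False
  then show ?thesis by (simp add: PS_noninvertible[OF f] big_def small_def rowf_def)
next
  case g: True
  define c d where "c = g $ 2 $ 1" and "d = g $ 2 $ 2"
  have q: "nv \<pi> ^ m < 1" "0 < nv \<pi> ^ m" using m unif by (auto simp: power_less_one_iff)
  have fin: "finite {r \<in> R m. nv r < 1}" using finite_R by simp
  have cd: "c \<noteq> 0 \<or> d \<noteq> 0" using det_ne_0_row2[OF g] by (simp add: c_def d_def)
  have big: "big r (\<pi> ^ m) g = (if nv (d - r * c) \<le> nv \<pi> ^ m * nv c then omega (det g) * eta c else 0)" for r
    using g by (simp add: big_def rowf_def c_def d_def nv_power)
  have small: "small r (\<pi> ^ m) g = (if nv (c - r * d) \<le> nv \<pi> ^ m * nv d then omega (det g) * eta d else 0)" for r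
    using g by (simp add: small_def rowf_def c_def d_def nv_power)
  show ?thesis
  proof (cases "nv d \<le> nv c")
    case True
    then have c: "c \<noteq> 0" using cd by auto
    then have "0 < nv c" by (rule nv_pos)
    note c = c this
    have "nv (d / c) \<le> 1" using True c by (simp add: nv_divide)
    then obtain r where r: "r \<in> R m" "nv (d / c - r) \<le> nv \<pi> ^ m" and
      u: "\<And>s. s \<in> R m \<Longrightarrow> nv (d / c - s) \<le> nv \<pi> ^ m \<Longrightarrow> s = r"
      using R_ex1[of "d / c" m] by blast
    have big': "nv (d - r * c) \<le> nv \<pi> ^ m * nv c \<longleftrightarrow> nv (d / c - r) \<le> nv \<pi> ^ m" for r
    proof -
      have "d - r * c = (d / c - r) * c" using c by (simp add: field_simps)
      then show ?thesis using c by (simp add: nv_mult)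
    qed
    have S0: "small r (\<pi> ^ m) g = 0" if r: "nv r < 1" for r
    proof -
      have "\<not> nv (c - r * d) \<le> nv \<pi> ^ m * nv d"
      proof
        assume *: "nv (c - r * d) \<le> nv \<pi> ^ m * nv d"
        have "d \<noteq> 0" using * c by auto
        then have "nv d > 0" by (rule nv_pos)
        then have "nv (c - r * d) < nv d" "nv (r * d) < nv d"
          using * q r by (auto simp: nv_mult intro: le_less_trans)
        then have "nv (c - r * d + r * d) < nv d" by (rule nv_add_lessI)
        then show False using True by simp
      qed
      then show ?thesis by (simp add: small)
    qed
    have S1: "(\<Sum>r\<in>{r \<in> R m. nv r < 1}. f (mat2 1 0 r 1) * small r (\<pi> ^ m) g) = 0"
      by (rule sum.neutral) (simp add: S0)
    have "(\<Sum>r\<in>R m. f (mat2 0 (-1) 1 r) * big r (\<pi> ^ m) g) = f (mat2 0 (-1) 1 r) * big r (\<pi> ^ m) g"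
    proof (rule sum_single_nonzero[OF finite_R r(1)])
      fix x assume "x \<in> R m" "x \<noteq> r"
      then have "\<not> nv (d / c - x) \<le> nv \<pi> ^ m" using u[of x] by blast
      then show "f (mat2 0 (-1) 1 x) * big x (\<pi> ^ m) g = 0" by (simp add: big big')
    qed
    also have "big r (\<pi> ^ m) g = omega (det g) * eta c"
      using r(2) by (simp only: big big' if_True)
    finally have S2: "(\<Sum>r\<in>R m. f (mat2 0 (-1) 1 r) * big r (\<pi> ^ m) g) =
        f (mat2 0 (-1) 1 r) * (omega (det g) * eta c)" .
    \<comment> \<open>Right translation by the unipotent matrix with entry \<open>d / c - r\<close>,
      which has level \<open>m\<close>, moves the centre to the point.\<close>
    have "f (mat2 0 (-1) 1 (d / c)) = f (mat2 0 (-1) 1 r)"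
    proof -
      have "near_one (nv \<pi> ^ m) (mat2 1 (d / c - r) 0 1)"
        using r q by (simp add: near_one_def forall_2)
      from inv[OF this, of "mat2 0 (-1) 1 r"] show ?thesis by (simp add: mat2_mult)
    qed
    then show ?thesis
      using PS_row_big[OF f g] c unfolding S1 S2 by (simp add: c_def d_def)
  next
    case False
    then have d: "d \<noteq> 0" "0 < nv d" using nv_nonneg[of c] nv_pos[of d] by auto
    have cd1: "nv (c / d) < 1" using False d by (simp add: nv_divide)
    then obtain r where r: "r \<in> R m" "nv (c / d - r) \<le> nv \<pi> ^ m" and
      u: "\<And>s. s \<in> R m \<Longrightarrow> nv (c / d - s) \<le> nv \<pi> ^ m \<Longrightarrow> s = r"
      using R_ex1[of "c / d" m] by (metis less_imp_le)
    have "nv (c / d - (c / d - r)) < 1"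
      using cd1 r(2) q nv_diff_le[of "c / d" "c / d - r"] by auto
    then have r1: "nv r < 1" by simp
    have small': "nv (c - r * d) \<le> nv \<pi> ^ m * nv d \<longleftrightarrow> nv (c / d - r) \<le> nv \<pi> ^ m" for r
    proof -
      have "c - r * d = (c / d - r) * d" using d by (simp add: field_simps)
      then show ?thesis using d by (simp add: nv_mult)
    qed
    have S0: "big r (\<pi> ^ m) g = 0" if r: "r \<in> R m" for r
    proof -
      have "\<not> nv (d - r * c) \<le> nv \<pi> ^ m * nv c"
      proof
        assume *: "nv (d - r * c) \<le> nv \<pi> ^ m * nv c"
        have "nv \<pi> ^ m * nv c \<le> nv c" using q nv_nonneg[of c] by (simp add: mult_left_le_one_le)
        moreover have "nv (r * c) \<le> nv c" using R_le[OF r] nv_nonneg by (simp add: nv_mult mult_left_le_one_le)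
        ultimately have "nv (d - r * c + r * c) \<le> nv c" using * by (intro nv_add_leI) auto
        then show False using False by simp
      qed
      then show ?thesis by (simp add: big)
    qed
    have S1: "(\<Sum>r\<in>R m. f (mat2 0 (-1) 1 r) * big r (\<pi> ^ m) g) = 0"
      by (rule sum.neutral) (simp add: S0)
    have "(\<Sum>r\<in>{r \<in> R m. nv r < 1}. f (mat2 1 0 r 1) * small r (\<pi> ^ m) g) =
        f (mat2 1 0 r 1) * small r (\<pi> ^ m) g"
    proof (rule sum_single_nonzero[OF fin])
      show "r \<in> {r \<in> R m. nv r < 1}" using r r1 by simp
      fix x assume "x \<in> {r \<in> R m. nv r < 1}" "x \<noteq> r"
      then have "\<not> nv (c / d - x) \<le> nv \<pi> ^ m" using u[of x] by blast
      then show "f (mat2 1 0 x 1) * small x (\<pi> ^ m) g = 0" by (simp add: small small')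
    qed
    also have "small r (\<pi> ^ m) g = omega (det g) * eta d"
      using r(2) by (simp only: small small' if_True)
    finally have S2: "(\<Sum>r\<in>{r \<in> R m. nv r < 1}. f (mat2 1 0 r 1) * small r (\<pi> ^ m) g) =
        f (mat2 1 0 r 1) * (omega (det g) * eta d)" .
    have "f (mat2 1 0 (c / d) 1) = f (mat2 1 0 r 1)"
    proof -
      have "near_one (nv \<pi> ^ m) (mat2 1 0 (c / d - r) 1)"
        using r q by (simp add: near_one_def forall_2)
      from inv[OF this, of "mat2 1 0 r 1"] show ?thesis by (simp add: mat2_mult)
    qed
    then show ?thesis
      using PS_row_small[OF f g] d unfolding S1 S2 by (simp add: c_def d_def)
  qed
qed

lemma PS_level:
  assumes "f \<in> PS"
  obtains m where "m \<ge> m0" "m \<ge> 1" "\<And>u g. near_one (nv \<pi> ^ m) u \<Longrightarrow> f (g ** u) = f g"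
proof -
  obtain e where e: "0 < e" "\<And>u h. near_one e u \<Longrightarrow> f (h ** u) = f h"
    using PS_smooth[OF assms] by metis
  obtain m where m: "\<And>n. n \<ge> m \<Longrightarrow> nv \<pi> ^ n \<le> e" using unif_power_small[OF e(1)] by blast
  show thesis
  proof (rule that[of "m + m0 + 1"])
    show "f (h ** u) = f h" if "near_one (nv \<pi> ^ (m + m0 + 1)) u" for u h
      by (rule e(2)[OF near_one_mono[OF that m]]) simp
  qed auto
qed

text \<open>Every \<open>f\<close> has some level beyond \<open>m0\<close>, so it is a finite
  combination of arbitrarily small balls; only those have to be tested.\<close>

lemma functional_zero_cells:
  assumes L: "clinear_on PS L"
    and big: "\<And>r m. m \<ge> m0 \<Longrightarrow> nv r \<le> 1 \<Longrightarrow> L (big r (\<pi> ^ m)) = 0"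
    and small: "\<And>r m. m \<ge> m0 \<Longrightarrow> nv r < 1 \<Longrightarrow> L (small r (\<pi> ^ m)) = 0"
    and f: "f \<in> PS"
  shows "L f = 0"
proof -
  obtain m where m: "m \<ge> m0" "m \<ge> 1" "\<And>u g. near_one (nv \<pi> ^ m) u \<Longrightarrow> f (g ** u) = f g"
    using PS_level[OF f] by metis
  have fin: "finite {r \<in> R m. nv r < 1}" using finite_R by simp
  have mem: "\<And>r. big r (\<pi> ^ m) \<in> PS" "\<And>r. small r (\<pi> ^ m) \<in> PS"
    by (simp_all add: big_mem small_mem)
  let ?f1 = "\<lambda>g. \<Sum>r\<in>R m. f (mat2 0 (-1) 1 r) * big r (\<pi> ^ m) g"
  let ?f2 = "\<lambda>g. \<Sum>r\<in>{r \<in> R m. nv r < 1}. f (mat2 1 0 r 1) * small r (\<pi> ^ m) g"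
  have "f = (\<lambda>g. ?f1 g + ?f2 g)" by (intro ext) (rule PS_cells[OF f m(2,3)])
  then have "L f = L (\<lambda>g. ?f1 g + ?f2 g)" by (rule arg_cong)
  also have "\<dots> = L ?f1 + L ?f2"
  proof (rule clinear_on_add[OF L])
    show "?f1 \<in> PS" by (rule subspace_sum[OF PS_subspace finite_R]) (rule mem)
    show "?f2 \<in> PS" by (rule subspace_sum[OF PS_subspace fin]) (rule mem)
  qed
  also have "L ?f1 = (\<Sum>r\<in>R m. f (mat2 0 (-1) 1 r) * L (big r (\<pi> ^ m)))"
    by (rule clinear_on_sum[OF L finite_R]) (rule mem)
  also have "\<dots> = 0" by (rule sum.neutral) (simp add: big[OF m(1) R_le])
  also have "L ?f2 = (\<Sum>r\<in>{r \<in> R m. nv r < 1}. f (mat2 1 0 r 1) * L (small r (\<pi> ^ m)))"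
    by (rule clinear_on_sum[OF L fin]) (rule mem)
  also have "\<dots> = 0" by (rule sum.neutral) (simp add: small[OF m(1)])
  finally show ?thesis by simp
qed

text \<open>The functions vanishing at the point of the projective line that is fixed by the upper triangular
  matrices are those supported on the big cell.\<close>

lemma vanishing_at_1_span:
  assumes f: "f \<in> PS" and f1: "f (mat 1) = 0"
  shows "f \<in> cfun.span {big x \<rho> | x \<rho>. \<rho> \<noteq> 0}"
proof -
  let ?S = "cfun.span {big x \<rho> | x \<rho>. \<rho> \<noteq> 0}"
  obtain m where m: "m \<ge> 1" "\<And>u g. near_one (nv \<pi> ^ m) u \<Longrightarrow> f (g ** u) = f g"
    using PS_level[OF f] by metis
  have sub: "cfun.subspace ?S" by simp
  have q: "nv \<pi> ^ m < 1" "0 < nv \<pi> ^ m" using m unif by (auto simp: power_less_one_iff)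
  have fin: "finite {r \<in> R m. nv r < 1}" using finite_R by simp
  have big: "big x \<rho> \<in> ?S" if "\<rho> \<noteq> 0" for x \<rho>
    using that by (intro cfun.span_base) auto
  \<comment> \<open>If |r| \<le> |\<pi>|^m, the ball contains the fixed point and its coefficient
    equals f(1) = 0. Any other ball avoids the fixed point and is rewritten in the chart
    d/c.\<close>
  have small: "(\<lambda>g. f (mat2 1 0 r 1) * small r (\<pi> ^ m) g) \<in> ?S" for r
  proof (cases "nv r \<le> nv \<pi> ^ m")
    case True
    then have "near_one (nv \<pi> ^ m) (mat2 1 0 r 1)"
      using q by (simp add: near_one_def forall_2)
    from m(2)[OF this, of "mat 1"] f1 show ?thesis by (simp add: subspace_zero[OF sub])
  next
    case False
    then have r: "r \<noteq> 0" using q by auto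
    then have r': "nv r > 0" by (rule nv_pos)
    \<comment> \<open>If |x - r| < |r|, then |1/x - 1/r| = |x - r| / |r|^2: inversion carries the
      ball to one around 1/r whose radius is divided by |r|^2. On both balls |c| = |r| |d|, whence
      the factor \<open>eta (inverse r)\<close>.\<close>
    have "small r (\<pi> ^ m) g = eta (inverse r) * big (inverse r) (\<pi> ^ m / r\<^sup>2) g" for g
    proof (cases "invertible g")
      case True
      define c d where "c = g $ 2 $ 1" and "d = g $ 2 $ 2"
      have cd: "c \<noteq> 0 \<or> d \<noteq> 0" using det_ne_0_row2[OF True] by (simp add: c_def d_def)
      have "c - r * d = - r * (d - inverse r * c)" using r by (simp add: field_simps)
      then have eq: "nv (c - r * d) = nv r * nv (d - inverse r * c)"
        by (metis nv_minus nv_mult)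
      have nvs: "nv (\<pi> ^ m / r\<^sup>2) = nv \<pi> ^ m / (nv r * nv r)"
        by (simp add: nv_divide nv_power nv_mult power2_eq_square)
      show ?thesis
      proof (cases "nv c = nv r * nv d")
        case *: True
        have "c \<noteq> 0" "d \<noteq> 0" using cd * r' by (auto simp: nv_eq_0_iff)
        moreover have "eta d = eta (inverse r * c)"
          by (rule eta_cong) (use * r' in \<open>simp add: nv_mult nv_inverse\<close>)
        ultimately have "eta d = eta (inverse r) * eta c" using r by (simp add: eta_mult)
        moreover have "nv (c - r * d) \<le> nv \<pi> ^ m * nv d \<longleftrightarrow>
            nv (d - inverse r * c) \<le> nv (\<pi> ^ m / r\<^sup>2) * nv c"
          unfolding eq nvs * using r' by (simp add: field_simps)
        ultimately show ?thesis
          using True by (simp add: small_def big_def rowf_def nv_power c_def d_def)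
      next
        case *: False
        have "\<not> nv (c - r * d) \<le> nv \<pi> ^ m * nv d"
        proof
          assume a: "nv (c - r * d) \<le> nv \<pi> ^ m * nv d"
          have "d \<noteq> 0" using a cd nv_pos[of c] by auto
          then have "nv d > 0" by (rule nv_pos)
          then have "nv (c - r * d) < nv (r * d)" using a False
            by (auto simp: nv_mult intro: le_less_trans)
          then have "nv (c - r * d + r * d) = nv (r * d)" by (rule nv_add_eq)
          then show False using * by (simp add: nv_mult)
        qed
        moreover have "\<not> nv (d - inverse r * c) \<le> nv (\<pi> ^ m / r\<^sup>2) * nv c"
        proof
          assume a: "nv (d - inverse r * c) \<le> nv (\<pi> ^ m / r\<^sup>2) * nv c"
          have c0: "c \<noteq> 0" using a cd nv_pos[of d] by auto
          have "nv (\<pi> ^ m / r\<^sup>2) < inverse (nv r)"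
            using False r' unfolding nvs by (simp add: field_simps)
          then have "nv (d - inverse r * c) < inverse (nv r) * nv c"
            using a nv_pos[OF c0] by (meson le_less_trans mult_strict_right_mono)
          then have "nv (d - inverse r * c + inverse r * c) = nv (inverse r * c)"
            by (intro nv_add_eq) (simp add: nv_mult nv_inverse)
          then have "nv d = inverse (nv r) * nv c" by (simp add: nv_mult nv_inverse)
          then show False using * r' by simp
        qed
        ultimately show ?thesis
          using True by (simp add: small_def big_def rowf_def nv_power c_def d_def)
      qed
    qed (simp add: small_def big_def rowf_def)
    moreover have "(\<lambda>g. f (mat2 1 0 r 1) * eta (inverse r) * big (inverse r) (\<pi> ^ m / r\<^sup>2) g) \<in> ?S"
      by (rule subspace_scale[OF sub big]) (use r in simp)
    ultimately show ?thesis by (simp add: mult.assoc)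
  qed
  let ?f1 = "\<lambda>g. \<Sum>r\<in>R m. f (mat2 0 (-1) 1 r) * big r (\<pi> ^ m) g"
  let ?f2 = "\<lambda>g. \<Sum>r\<in>{r \<in> R m. nv r < 1}. f (mat2 1 0 r 1) * small r (\<pi> ^ m) g"
  have "f = (\<lambda>g. ?f1 g + ?f2 g)" by (intro ext) (rule PS_cells[OF f m])
  moreover have "?f1 \<in> ?S"
    by (rule subspace_sum[OF sub finite_R]) (simp add: big)
  moreover have "?f2 \<in> ?S"
    using subspace_sum[OF sub fin, where f = "\<lambda>r g. f (mat2 1 0 r 1) * small r (\<pi> ^ m) g" and c = "\<lambda>_. 1"] small
    by (simp only: mult_1)
  ultimately show ?thesis
    using subspace_add[OF sub, of ?f1 ?f2] by (simp only:)
qed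

end

section \<open>Frobenius reciprocity\<close>

text \<open>No absolute value lies strictly between |\<pi>| |y| and |y|.\<close>

lemma (in discrete_field) nv_less_iff: "nv x < nv y \<longleftrightarrow> y \<noteq> 0 \<and> nv x \<le> nv \<pi> * nv y"
proof (cases "x = 0 \<or> y = 0")
  case True
  then show ?thesis using unif nv_nonneg[of x] nv_pos[of y] by auto
next
  case False
  then obtain k where k: "nv (x / y) = nv \<pi> powi k" using value_group[of "x / y"] by auto
  have x: "nv x = nv \<pi> powi k * nv y"
    using False k nv_pos[of y] by (simp add: nv_divide field_simps)
  have y: "nv y > 0" using False by (simp add: nv_pos)
  have "nv \<pi> powi k < 1 \<longleftrightarrow> nv \<pi> powi k \<le> nv \<pi>"
  proof (cases "k \<ge> 1")
    case True
    then have "nv \<pi> powi k \<le> nv \<pi> powi 1"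
      using unif by (intro power_int_decreasing) auto
    then show ?thesis using unif by simp
  next
    case False
    then have "nv \<pi> powi 0 \<le> nv \<pi> powi k"
      using unif by (intro power_int_decreasing) auto
    then show ?thesis using unif by simp
  qed
  then show ?thesis using False y unfolding x by simp
qed

text \<open>Functions in the principal series that concentrate at the point of the projective line fixed by
  the upper triangular matrices, up to an intertwining operator. Pairing with a given vector becomes
  constant along the family, by \<open>F_avg\<close>.\<close>

locale test_family = unram_ps +
  fixes F :: "'a \<Rightarrow> 'a^2^2 \<Rightarrow> complex" and c :: "'a \<Rightarrow> complex"
  assumes card_R: "real (card (R 1)) * nv \<pi> = 1"
    and F_mem: "\<rho> \<noteq> 0 \<Longrightarrow> F \<rho> \<in> PS"
    and F_avg: "\<rho> \<noteq> 0 \<Longrightarrow>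
      F \<rho> g = (\<Sum>r\<in>R 1. complex_of_real (nv \<pi>) * F (\<rho> * \<pi>) (g ** mat2 1 0 (- (\<rho> * r)) 1))"
    and F_upper: "\<rho> \<noteq> 0 \<Longrightarrow> nv b * nv \<rho> < 1 \<Longrightarrow> F \<rho> (g ** mat2 1 b 0 1) = F \<rho> g"
    and F_diag: "\<rho> \<noteq> 0 \<Longrightarrow> a \<noteq> 0 \<Longrightarrow> F \<rho> (g ** mat2 a 0 0 1) = c a * F (\<rho> / a) g"
    and c_nz: "a \<noteq> 0 \<Longrightarrow> c a \<noteq> 0" and c_unit: "nv a = 1 \<Longrightarrow> c a = 1"
    and F_cong: "nv \<rho> = nv \<rho>' \<Longrightarrow> F \<rho> = F \<rho>'"
    and F_total: "clinear_on PS L \<Longrightarrow>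
      (\<And>m k. m \<ge> m0 \<Longrightarrow> k \<in> max_compact \<Longrightarrow> L (\<lambda>g. F (\<pi> ^ m) (g ** k)) = 0) \<Longrightarrow> f \<in> PS \<Longrightarrow> L f = 0"

text \<open>\<open>\<beta>\<close> is the restriction of an invariant functional to pure tensors,
  and \<open>S\<close> stands for \<sigma> with \<open>act\<close> the right action on its domain.
  Leaving \<open>S\<close> abstract treats split and inert primes together.\<close>

locale invariant_pairing = test_family nv \<pi> R chi psi F c
  for nv :: "'a::field \<Rightarrow> real" and \<pi> R chi psi F c +
  fixes S :: "('y \<Rightarrow> complex) set" and act :: "'a^2^2 \<Rightarrow> 'y \<Rightarrow> 'y"
    and \<beta> :: "('a^2^2 \<Rightarrow> complex) \<Rightarrow> ('y \<Rightarrow> complex) \<Rightarrow> complex"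
  assumes S_translate: "v \<in> S \<Longrightarrow> invertible h \<Longrightarrow> (\<lambda>y. v (act h y)) \<in> S"
    and act_mult: "act k (act h y) = act (h ** k) y"
    and act_one: "act (mat 1) y = y"
    and S_smooth: "v \<in> S \<Longrightarrow> \<exists>e>0. \<forall>u. near_one e u \<longrightarrow> (\<forall>y. v (act u y) = v y)"
    and \<beta>_left: "v \<in> S \<Longrightarrow> clinear_on PS (\<lambda>f. \<beta> f v)"
    and \<beta>_right: "f \<in> PS \<Longrightarrow> clinear_on S (\<beta> f)"
    and \<beta>_inv: "f \<in> PS \<Longrightarrow> v \<in> S \<Longrightarrow> invertible h \<Longrightarrow>
      \<beta> (\<lambda>g. f (g ** h)) (\<lambda>y. v (act h y)) = \<beta> f v"
begin

section \<open>The equivariant functional attached to an invariant pairing\<close>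

definition tr :: "'a^2^2 \<Rightarrow> ('y \<Rightarrow> complex) \<Rightarrow> ('y \<Rightarrow> complex)" where
  "tr h v = (\<lambda>y. v (act h y))"

definition fixed_at :: "nat \<Rightarrow> ('y \<Rightarrow> complex) \<Rightarrow> bool" where
  "fixed_at n v \<longleftrightarrow> (\<forall>u. near_one (nv \<pi> ^ n) u \<longrightarrow> tr u v = v)"

lemma tr_mem: "v \<in> S \<Longrightarrow> invertible h \<Longrightarrow> tr h v \<in> S"
  by (simp add: tr_def S_translate)

lemma tr_tr: "tr h (tr k v) = tr (h ** k) v"
  by (simp add: tr_def act_mult)

lemma \<beta>_tr: "f \<in> PS \<Longrightarrow> v \<in> S \<Longrightarrow> invertible h \<Longrightarrow> \<beta> (\<lambda>g. f (g ** h)) (tr h v) = \<beta> f v"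
  by (simp add: tr_def \<beta>_inv)

lemma F_power_mem: "F (\<pi> ^ n) \<in> PS"
  by (simp add: F_mem)

lemma fixed_at_mono: "fixed_at m v \<Longrightarrow> m \<le> n \<Longrightarrow> fixed_at n v"
  using near_one_mono power_decreasing[of m n "nv \<pi>"] unif
  by (simp add: fixed_at_def)

lemma fixed_at_ex: "v \<in> S \<Longrightarrow> \<exists>n. fixed_at n v"
proof -
  assume "v \<in> S"
  then obtain e where e: "e > 0" "\<And>u y. near_one e u \<Longrightarrow> v (act u y) = v y"
    using S_smooth by blast
  obtain m where m: "nv \<pi> ^ m \<le> e" using unif_power_small[OF e(1)] by blast
  have "fixed_at m v"
    unfolding fixed_at_def tr_def using e(2) near_one_mono[OF _ m] by (intro allI impI ext) blast
  then show ?thesis by blast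
qed

lemma fixed_at_tr:
  assumes "fixed_at n v" "k \<in> max_compact"
  shows "fixed_at n (tr k v)"
  unfolding fixed_at_def
proof (intro allI impI)
  fix u assume "near_one (nv \<pi> ^ n) u"
  then obtain u' where u': "near_one (nv \<pi> ^ n) u'" "u ** k = k ** u'"
    using conj_max_compact[OF assms(2)] by blast
  then have "tr u (tr k v) = tr k (tr u' v)" by (simp add: tr_tr)
  then show "tr u (tr k v) = tr k v"
    using assms(1) u'(1) by (simp add: fixed_at_def)
qed

text \<open>By \<open>F_avg\<close>, \<open>F (\<pi> ^ n)\<close> is a mean of translates of
  \<open>F (\<pi> ^ Suc n)\<close> by lower unipotent matrices of level \<open>n\<close>. These fix
  \<open>v\<close>, so by invariance every term of the mean pairs with \<open>v\<close> in the same
  way.\<close>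

lemma \<beta>_stable:
  assumes v: "v \<in> S" "fixed_at n v"
  shows "\<beta> (F (\<pi> ^ n)) v = \<beta> (F (\<pi> ^ Suc n)) v"
proof -
  have inv: "invertible (mat2 1 0 x 1)" for x :: 'a by simp
  have "\<beta> (\<lambda>g. F (\<pi> ^ n * \<pi>) (g ** mat2 1 0 (- (\<pi> ^ n * r)) 1)) v = \<beta> (F (\<pi> ^ n * \<pi>)) v"
    if "r \<in> R 1" for r
  proof -
    have "near_one (nv \<pi> ^ n) (mat2 1 0 (- (\<pi> ^ n * r)) 1)"
      using R_le[OF that] unif by (simp add: near_one_def forall_2 nv_mult nv_power mult_left_le)
    then have "tr (mat2 1 0 (- (\<pi> ^ n * r)) 1) v = v" using v(2) by (simp add: fixed_at_def)
    moreover have "\<beta> (\<lambda>g. F (\<pi> ^ n * \<pi>) (g ** mat2 1 0 (- (\<pi> ^ n * r)) 1)) (tr (mat2 1 0 (- (\<pi> ^ n * r)) 1) v)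
        = \<beta> (F (\<pi> ^ n * \<pi>)) v"
      by (rule \<beta>_tr[OF F_mem v(1) inv]) simp
    ultimately show ?thesis by simp
  qed
  note each = this
  have "F (\<pi> ^ n) = (\<lambda>g. \<Sum>r\<in>R 1. complex_of_real (nv \<pi>) * F (\<pi> ^ n * \<pi>) (g ** mat2 1 0 (- (\<pi> ^ n * r)) 1))"
    by (intro ext F_avg) simp
  then have "\<beta> (F (\<pi> ^ n)) v =
    \<beta> (\<lambda>g. \<Sum>r\<in>R 1. complex_of_real (nv \<pi>) * F (\<pi> ^ n * \<pi>) (g ** mat2 1 0 (- (\<pi> ^ n * r)) 1)) v"
    by (rule arg_cong[where f = "\<lambda>f. \<beta> f v"])
  also have "\<dots> = (\<Sum>r\<in>R 1. complex_of_real (nv \<pi>) *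
      \<beta> (\<lambda>g. F (\<pi> ^ n * \<pi>) (g ** mat2 1 0 (- (\<pi> ^ n * r)) 1)) v)"
    by (rule clinear_on_sum[OF \<beta>_left[OF v(1)] finite_R])
      (rule PS_translate[OF F_mem inv], simp)
  also have "\<dots> = (\<Sum>r\<in>R 1. complex_of_real (nv \<pi>) * \<beta> (F (\<pi> ^ n * \<pi>)) v)"
    by (intro sum.cong refl arg_cong2[where f = times] each)
  also have "\<dots> = complex_of_real (real (card (R 1)) * nv \<pi>) * \<beta> (F (\<pi> ^ n * \<pi>)) v"
    by simp
  finally show ?thesis unfolding card_R by (simp add: mult.commute)
qed

lemma \<beta>_stable':
  assumes v: "v \<in> S" "fixed_at n v" and m: "m \<ge> n"
  shows "\<beta> (F (\<pi> ^ m)) v = \<beta> (F (\<pi> ^ n)) v"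
  using m
proof (induction m rule: dec_induct)
  case (step m)
  then show ?case using \<beta>_stable[OF v(1) fixed_at_mono[OF v(2) step(1)]] by simp
qed simp

text \<open>The eventual value of \<open>\<beta> (F (\<pi> ^ n)) v\<close>, the pairing of
  \<open>v\<close> with a test function shrinking to the fixed point. The choice of level is
  immaterial by \<open>lam_eq\<close>.\<close>

definition lam :: "('y \<Rightarrow> complex) \<Rightarrow> complex" where
  "lam v = \<beta> (F (\<pi> ^ (SOME n. fixed_at n v))) v"

lemma lam_eq:
  assumes v: "v \<in> S" "fixed_at n v"
  shows "lam v = \<beta> (F (\<pi> ^ n)) v"
proof -
  let ?m = "SOME n. fixed_at n v"
  have m: "fixed_at ?m v" using v(2) by (rule someI)
  have "\<beta> (F (\<pi> ^ max ?m n)) v = \<beta> (F (\<pi> ^ ?m)) v" by (rule \<beta>_stable'[OF v(1) m]) simp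
  moreover have "\<beta> (F (\<pi> ^ max ?m n)) v = \<beta> (F (\<pi> ^ n)) v" by (rule \<beta>_stable'[OF v]) simp
  ultimately show ?thesis by (simp add: lam_def)
qed

lemma S_subspace: "cfun.subspace S"
  using \<beta>_right[OF F_power_mem] by (rule clinear_onD_subspace)

lemma lam_linear: "clinear_on S lam"
  unfolding clinear_on_def
proof (intro conjI ballI allI S_subspace)
  fix v w assume v: "v \<in> S" and w: "w \<in> S"
  obtain n m where "fixed_at n v" "fixed_at m w" using fixed_at_ex v w by metis
  then have fv: "fixed_at (max n m) v" and fw: "fixed_at (max n m) w"
    by (auto elim: fixed_at_mono)
  then have "fixed_at (max n m) (\<lambda>y. v y + w y)"
    by (simp add: fixed_at_def tr_def fun_eq_iff)
  then have "lam (\<lambda>y. v y + w y) = \<beta> (F (\<pi> ^ max n m)) (\<lambda>y. v y + w y)"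
    using v w by (intro lam_eq subspace_add[OF S_subspace]) auto
  then show "lam (\<lambda>y. v y + w y) = lam v + lam w"
    using clinear_on_add[OF \<beta>_right[OF F_power_mem] v w] lam_eq[OF v fv] lam_eq[OF w fw] by simp
next
  fix a v assume v: "v \<in> S"
  obtain n where n: "fixed_at n v" using fixed_at_ex v by metis
  then have "fixed_at n (\<lambda>y. a * v y)"
    by (simp add: fixed_at_def tr_def fun_eq_iff)
  then have "lam (\<lambda>y. a * v y) = \<beta> (F (\<pi> ^ n)) (\<lambda>y. a * v y)"
    using v by (intro lam_eq subspace_scale[OF S_subspace]) auto
  then show "lam (\<lambda>y. a * v y) = a * lam v"
    using clinear_on_scale[OF \<beta>_right[OF F_power_mem] v] lam_eq[OF v n] by simp
qed

lemma lam_upper: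
  assumes v: "v \<in> S"
  shows "lam (tr (mat2 1 b 0 1) v) = lam v"
proof -
  let ?u = "mat2 1 b 0 1"
  have u: "invertible ?u" by simp
  obtain n1 n2 where n: "fixed_at n1 v" "fixed_at n2 (tr ?u v)"
    using fixed_at_ex v tr_mem[OF v u] by metis
  \<comment> \<open>The bound 1/(|b| + 1) makes |b| |\<pi>^n| < 1, also for
    \<open>b = 0\<close>.\<close>
  obtain n3 where n3: "\<And>n. n \<ge> n3 \<Longrightarrow> nv \<pi> ^ n \<le> inverse (nv b + 1)"
    using unif_power_small[of "inverse (nv b + 1)"] nv_nonneg[of b] by (metis add_nonneg_pos inverse_positive_iff_positive zero_less_one)
  define n where "n = n1 + n2 + n3"
  have "nv b * nv (\<pi> ^ n) \<le> nv b * inverse (nv b + 1)"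
    using n3[of n] by (intro mult_left_mono) (auto simp: n_def nv_power nv_nonneg)
  also have "\<dots> < 1" using nv_nonneg[of b] by (simp add: field_simps)
  finally have b: "nv b * nv (\<pi> ^ n) < 1" .
  have "lam (tr ?u v) = \<beta> (F (\<pi> ^ n)) (tr ?u v)"
    using n by (intro lam_eq tr_mem v u) (auto elim: fixed_at_mono simp: n_def)
  also have "F (\<pi> ^ n) = (\<lambda>g. F (\<pi> ^ n) (g ** ?u))"
    using F_upper[OF _ b] by simp
  also have "\<beta> \<dots> (tr ?u v) = \<beta> (F (\<pi> ^ n)) v"
    by (rule \<beta>_tr[OF F_power_mem v u])
  also have "\<dots> = lam v"
    using n by (intro lam_eq[symmetric] v) (auto elim: fixed_at_mono simp: n_def)
  finally show ?thesis .
qed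

lemma lam_diag:
  assumes v: "v \<in> S" and a: "a \<noteq> 0"
  shows "c a * lam (tr (mat2 a 0 0 1) v) = lam v"
proof -
  let ?t = "mat2 a 0 0 1"
  have t: "invertible ?t" using a by simp
  obtain n1 n2 where n: "fixed_at n1 v" "fixed_at n2 (tr ?t v)"
    using fixed_at_ex v tr_mem[OF v t] by metis
  obtain k where k: "nv a = nv \<pi> powi k" using value_group[OF a] by blast
  \<comment> \<open>The summand |k| ensures that the shifted exponent \<open>n + k\<close> is still
    at least \<open>n1\<close> when \<open>k\<close> is negative.\<close>
  define n where "n = n1 + n2 + nat \<bar>k\<bar>"
  define n' where "n' = nat (int n + k)"
  have n': "int n' = int n + k" "n' \<ge> n1" by (auto simp: n_def n'_def)
  have "nv (\<pi> ^ n * a) = nv \<pi> powi int n * nv \<pi> powi k" by (simp add: nv_mult nv_power k)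
  also have "\<dots> = nv \<pi> powi int n'" unfolding n'(1) using unif by (simp add: power_int_add)
  finally have Fn': "F (\<pi> ^ n * a) = F (\<pi> ^ n')" by (intro F_cong) (simp add: nv_power)
  have "F (\<pi> ^ n * a) (g ** ?t) = c a * F (\<pi> ^ n) g" for g
    using F_diag[of "\<pi> ^ n * a" a g] a by simp
  then have eq: "(\<lambda>g. F (\<pi> ^ n * a) (g ** ?t)) = (\<lambda>g. c a * F (\<pi> ^ n) g)" by simp
  have "lam (tr ?t v) = \<beta> (F (\<pi> ^ n)) (tr ?t v)"
    using n by (intro lam_eq tr_mem v t) (auto elim: fixed_at_mono simp: n_def)
  then have "c a * lam (tr ?t v) = \<beta> (\<lambda>g. c a * F (\<pi> ^ n) g) (tr ?t v)"
    using clinear_on_scale[OF \<beta>_left[OF tr_mem[OF v t]] F_power_mem] by simp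
  also have "\<dots> = \<beta> (F (\<pi> ^ n * a)) v"
    unfolding eq[symmetric] by (rule \<beta>_tr[OF F_mem v t]) (use a in simp)
  also have "\<dots> = lam v"
    unfolding Fn' by (rule lam_eq[OF v fixed_at_mono[OF n(1) n'(2)], symmetric])
  finally show ?thesis .
qed

text \<open>The maximal compact subgroup preserves levels. Pairing a translate of
  \<open>F (\<pi> ^ m)\<close> by \<open>k\<close> with \<open>v\<close> is therefore
  \<open>lam\<close> of the translate of \<open>v\<close> by the inverse of \<open>k\<close>, for
  all large \<open>m\<close>, and \<open>F_total\<close> says that these test functions
  suffice.\<close>

lemma lam_zero:
  assumes zero: "\<And>v. v \<in> S \<Longrightarrow> lam v = 0" and v: "v \<in> S" and f: "f \<in> PS"
  shows "\<beta> f v = 0"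
proof -
  obtain n where n: "fixed_at n v" using fixed_at_ex v by metis
  show ?thesis
  proof (rule F_total[OF \<beta>_left[OF v] _ f, of n])
    fix m k assume m: "m \<ge> n" and k: "k \<in> max_compact"
    obtain k' where k': "k' \<in> max_compact" "k ** k' = mat 1" "k' ** k = mat 1"
      using max_compact_inverse[OF k] .
    let ?w = "tr k' v"
    have w: "?w \<in> S" "fixed_at m ?w"
      using tr_mem[OF v max_compact_invertible[OF k'(1)]] fixed_at_tr[OF fixed_at_mono[OF n m] k'(1)] by auto
    have "tr k ?w = v" by (simp add: tr_tr k') (simp add: tr_def act_one)
    then have "\<beta> (\<lambda>g. F (\<pi> ^ m) (g ** k)) v = \<beta> (F (\<pi> ^ m)) ?w"
      using \<beta>_tr[OF F_power_mem w(1) max_compact_invertible[OF k], of m] by simp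
    then show "\<beta> (\<lambda>g. F (\<pi> ^ m) (g ** k)) v = 0"
      using lam_eq[OF w] zero[OF w(1)] by simp
  qed
qed

end

section \<open>The two test families\<close>

context unram_ps
begin

lemma rowf_cong:
  "(\<And>c d. c \<noteq> 0 \<or> d \<noteq> 0 \<Longrightarrow> \<Psi> c d = \<Psi>' c d) \<Longrightarrow> rowf \<Psi> g = rowf \<Psi>' g"
  using det_ne_0_row2[of g] by (simp add: rowf_def)

lemma rowf_scale: "rowf (\<lambda>c d. k * \<Psi> c d) g = k * rowf \<Psi> g"
  by (simp add: rowf_def)

end

locale unram_ps_normalised = unram_ps +
  assumes card_R: "real (card (R 1)) * nv \<pi> = 1"
begin

declare One_nat_def [simp del]

abbreviation q :: complex where "q \<equiv> of_nat (card (R 1))"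

lemma card_R_gt_1: "1 < real (card (R 1))"
proof (rule ccontr)
  assume "\<not> 1 < real (card (R 1))"
  then have "real (card (R 1)) * nv \<pi> \<le> 1 * nv \<pi>" using unif by (intro mult_right_mono) auto
  then show False using card_R unif by simp
qed

lemma q_nv: "q * complex_of_real (nv \<pi>) = 1"
  using arg_cong[OF card_R, of complex_of_real] by simp

lemma q_nz: "q \<noteq> 0"
  using q_nv by (metis mult_zero_left zero_neq_one)

lemma small_0_diag:
  assumes "\<rho> \<noteq> 0" "a \<noteq> 0"
  shows "small 0 \<rho> (g ** mat2 a 0 0 1) = omega a * small 0 (\<rho> / a) g"
proof -
  have "nv (x * a) \<le> nv \<rho> * y \<longleftrightarrow> nv x \<le> nv (\<rho> / a) * y" for x y
    using nv_pos[OF assms(2)] by (simp add: nv_mult nv_divide field_simps)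
  then show ?thesis
    using assms by (simp add: small_def rowf_mult)
qed

lemma two_valued_upper:
  assumes \<rho>: "\<rho> \<noteq> 0" and b: "nv b * nv \<rho> < 1"
  shows "two_valued \<rho> A B (g ** mat2 1 b 0 1) = two_valued \<rho> A B g"
proof -
  have r: "nv \<rho> > 0" using nv_pos[OF \<rho>] .
  have "(if nv c \<le> nv \<rho> * nv (c * b + d) then A * eta (c * b + d) else B * eta c) =
      (if nv c \<le> nv \<rho> * nv d then A * eta d else B * eta c)" if cd: "c \<noteq> 0 \<or> d \<noteq> 0" for c d
  proof (cases "nv c \<le> nv \<rho> * nv d")
    case True
    then have d: "nv d > 0" using cd by (intro nv_pos) auto
    have "nv c * nv b \<le> nv \<rho> * nv d * nv b" using True by (rule mult_right_mono) (rule nv_nonneg)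
    also have "\<dots> = (nv b * nv \<rho>) * nv d" by simp
    also have "\<dots> < 1 * nv d" using b d by (intro mult_strict_right_mono) auto
    finally have "nv (c * b + d) = nv d" by (intro nv_add_eq) (simp add: nv_mult)
    then show ?thesis using True eta_cong[of "c * b + d" d] by simp
  next
    case False
    have "c \<noteq> 0"
    proof
      assume "c = 0"
      then show False using False r nv_nonneg[of d] by simp
    qed
    then have c: "nv c > 0" by (rule nv_pos)
    have "nv \<rho> * nv (c * b) < nv c"
      using mult_strict_right_mono[OF b c] by (simp add: nv_mult mult.commute mult.left_commute)
    then have "nv (c * b) < nv c / nv \<rho>" "nv d < nv c / nv \<rho>"
      using False r by (simp_all add: field_simps)
    then have "nv (c * b + d) < nv c / nv \<rho>" by (rule nv_add_lessI)
    then have "\<not> nv c \<le> nv \<rho> * nv (c * b + d)" using r by (simp add: field_simps)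
    then show ?thesis using False by simp
  qed
  note key = this
  have "two_valued \<rho> A B (g ** mat2 1 b 0 1) =
      rowf (\<lambda>c d. if nv c \<le> nv \<rho> * nv (c * b + d) then A * eta (c * b + d) else B * eta c) g"
    unfolding two_valued_def by (subst rowf_mult) (simp_all add: omega_unit cong: if_cong)
  also have "\<dots> = two_valued \<rho> A B g"
    unfolding two_valued_def by (rule rowf_cong) (rule key)
  finally show ?thesis .
qed

lemma K_mat2: "nv x \<le> 1 \<Longrightarrow> mat2 1 0 x 1 \<in> max_compact" "nv x \<le> 1 \<Longrightarrow> mat2 x 1 1 0 \<in> max_compact"
  by (rule mat2_max_compact; simp)+

text \<open>The factor 1/|\<rho>| keeps the total mass independent of \<rho>, so that decomposing a
  ball into smaller ones becomes an average.\<close>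

definition conc :: "'a \<Rightarrow> 'a^2^2 \<Rightarrow> complex" where
  "conc \<rho> = (\<lambda>g. complex_of_real (inverse (nv \<rho>)) * small 0 \<rho> g)"

lemma test_family_conc:
  "test_family nv \<pi> R chi psi conc (\<lambda>a. omega a * complex_of_real (inverse (nv a)))"
proof unfold_locales
  show "real (card (R 1)) * nv \<pi> = 1" by (rule card_R)
  show "conc \<rho> \<in> PS" if "\<rho> \<noteq> 0" for \<rho>
    unfolding conc_def by (rule subspace_scale[OF PS_subspace small_mem[OF that]])
  show "conc \<rho> g = (\<Sum>r\<in>R 1. complex_of_real (nv \<pi>) * conc (\<rho> * \<pi>) (g ** mat2 1 0 (- (\<rho> * r)) 1))"
    if "\<rho> \<noteq> 0" for \<rho> g
  proof -
    have "complex_of_real (nv \<pi>) * complex_of_real (inverse (nv (\<rho> * \<pi>))) = complex_of_real (inverse (nv \<rho>))"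
      using unif by (simp add: nv_mult field_simps)
    then have "complex_of_real (nv \<pi>) * (complex_of_real (inverse (nv (\<rho> * \<pi>))) * x) =
        complex_of_real (inverse (nv \<rho>)) * x" for x
      by (metis mult.assoc)
    then have "(\<Sum>r\<in>R 1. complex_of_real (nv \<pi>) * conc (\<rho> * \<pi>) (g ** mat2 1 0 (- (\<rho> * r)) 1)) =
        complex_of_real (inverse (nv \<rho>)) * (\<Sum>r\<in>R 1. small 0 (\<rho> * \<pi>) (g ** mat2 1 0 (- (\<rho> * r)) 1))"
      unfolding conc_def sum_distrib_left by (simp only:)
    moreover have "small 0 \<rho> g = (\<Sum>r\<in>R 1. small 0 (\<rho> * \<pi>) (g ** mat2 1 0 (- (\<rho> * r)) 1))"
      using small_refine[OF that, of 0 g 1]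
      by (simp only: power_one_right add_0 small_translate[where x = "\<rho> * r" for r])
    ultimately show ?thesis by (simp only: conc_def)
  qed
  show "conc \<rho> (g ** mat2 1 b 0 1) = conc \<rho> g" if "\<rho> \<noteq> 0" "nv b * nv \<rho> < 1" for \<rho> b g
    using that by (simp add: conc_def small_0_eq two_valued_upper)
  show "conc \<rho> (g ** mat2 a 0 0 1) = omega a * complex_of_real (inverse (nv a)) * conc (\<rho> / a) g"
    if "\<rho> \<noteq> 0" "a \<noteq> 0" for \<rho> a g
    using that nv_pos[of a] by (simp add: conc_def small_0_diag nv_divide field_simps)
  show "omega a * complex_of_real (inverse (nv a)) \<noteq> 0" if "a \<noteq> 0" for a
    using that nv_pos[OF that] by (simp add: omega_nz)
  show "omega a * complex_of_real (inverse (nv a)) = 1" if "nv a = 1" for a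
    using that by (simp add: omega_unit)
  show "conc \<rho> = conc \<rho>'" if "nv \<rho> = nv \<rho>'" for \<rho> \<rho>'
    using that by (simp add: conc_def small_def)
  show "L f = 0" if L: "clinear_on PS L" and f: "f \<in> PS" and
    0: "\<And>m k. m \<ge> m0 \<Longrightarrow> k \<in> max_compact \<Longrightarrow> L (\<lambda>g. conc (\<pi> ^ m) (g ** k)) = 0" for L f m0
  proof -
    have *: "L (\<lambda>g. small 0 (\<pi> ^ m) (g ** k)) = 0" if m: "m \<ge> m0" and k: "k \<in> max_compact" for m k
    proof -
      have "(\<lambda>g. small 0 (\<pi> ^ m) (g ** k)) \<in> PS"
        using max_compact_invertible[OF k] by (intro PS_translate small_mem) auto
      from clinear_on_scale[OF L this] have "complex_of_real (inverse (nv (\<pi> ^ m))) *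
          L (\<lambda>g. small 0 (\<pi> ^ m) (g ** k)) = L (\<lambda>g. conc (\<pi> ^ m) (g ** k))"
        unfolding conc_def by simp
      then show ?thesis using 0[OF m k] unif by (simp add: nv_power)
    qed
    show ?thesis
    proof (rule functional_zero_cells[OF L _ _ f, of m0])
      show "L (big r (\<pi> ^ m)) = 0" if "m \<ge> m0" "nv r \<le> 1" for r m
        using *[OF that(1) K_mat2(2)[of "- r"]] that(2) by (simp add: big_translate[symmetric])
      show "L (small r (\<pi> ^ m)) = 0" if "m \<ge> m0" "nv r < 1" for r m
        using *[OF that(1) K_mat2(1)[of "- r"]] that(2) by (simp add: small_translate[symmetric])
    qed
  qed
qed

end

text \<open>Up to a scalar, \<open>intw \<rho>\<close> is the image of the concentrated function for \<open>(psi, chi)\<close> under the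
  standard intertwining operator into the principal series of \<open>(chi, psi)\<close>. The hypotheses on \<open>eta \<pi>\<close>
  say that the defining integral converges and that the operator is onto.\<close>

locale unram_ps_irregular = unram_ps_normalised +
  assumes eta_unif_ne_1: "eta \<pi> \<noteq> 1" and eta_unif_less: "cmod (eta \<pi>) < real (card (R 1))"
begin

text \<open>The mean of \<open>eta\<close> over the unit ball, that is (1 - 1/q) times the geometric
  series in \<open>eta \<pi> / q\<close>. Consequently the row function of
  \<open>intw \<rho>\<close> is the mean of \<open>eta (c - x * d)\<close> over |x| \<le> |\<rho>|:
  when |c| > |\<rho> d|, the integrand is constantly \<open>eta c\<close>, which explains the second
  value 1.\<close>

definition c0 :: complex where
  "c0 = (q - 1) / (q - eta \<pi>)"

definition intw :: "'a \<Rightarrow> 'a^2^2 \<Rightarrow> complex" where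
  "intw \<rho> = two_valued \<rho> (c0 * eta \<rho>) 1"

lemma q_eta: "q - eta \<pi> \<noteq> 0"
proof
  assume "q - eta \<pi> = 0"
  then have "eta \<pi> = q" by simp
  then show False using eta_unif_less by simp
qed

text \<open>The sum is (q^2 - eta(\<pi>)) / (q (q - eta(\<pi>))), and |eta(\<pi>)| < q < q^2. It is
  the factor that decides the last step of \<open>intw_total\<close>.\<close>

lemma c0_plus: "c0 + 1 / q \<noteq> 0"
proof
  assume "c0 + 1 / q = 0"
  then have "c0 = - (1 / q)" by (simp only: eq_neg_iff_add_eq_0)
  then have "q * c0 = - 1" using q_nz by simp
  moreover have "c0 * (q - eta \<pi>) = q - 1" using q_eta by (simp add: c0_def)
  ultimately have "q * (q - 1) = - (q - eta \<pi>)" by (metis mult.assoc mult_minus1)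
  then have "eta \<pi> = q * q" by (simp add: algebra_simps)
  then have "cmod (eta \<pi>) = real (card (R 1)) * real (card (R 1))" by (simp add: norm_mult)
  also have "\<dots> \<ge> real (card (R 1)) * 1" using card_R_gt_1 by (intro mult_left_mono) auto
  finally show False using eta_unif_less by simp
qed

lemma intw_mem: "\<rho> \<noteq> 0 \<Longrightarrow> intw \<rho> \<in> PS"
  by (simp add: intw_def two_valued_mem)

text \<open>The mean over a ball is the mean of the means over its q sub-balls. If |c| \<le> |\<rho>
  d|, exactly one sub-ball contains the zero of c - x d and contributes a scaled \<open>c0\<close>;
  on the q - 1 others \<open>eta\<close> is constant.\<close>

lemma intw_avg_row:
  assumes \<rho>: "\<rho> \<noteq> 0" and cd: "c \<noteq> 0 \<or> d \<noteq> 0"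
  defines "P \<equiv> \<lambda>\<rho> c d. if nv c \<le> nv \<rho> * nv d then c0 * eta \<rho> * eta d else 1 * eta c"
  shows "q * P \<rho> c d = (\<Sum>r\<in>R 1. P (\<rho> * \<pi>) (c - \<rho> * r * d) d)"
proof (cases "nv c \<le> nv \<rho> * nv d")
  case False
  have "P (\<rho> * \<pi>) (c - \<rho> * r * d) d = eta c" if "r \<in> R 1" for r
  proof -
    have "nv \<rho> * nv r * nv d \<le> nv \<rho> * 1 * nv d"
      using R_le[OF that] nv_nonneg by (intro mult_mono mult_nonneg_nonneg) auto
    then have "nv (- (\<rho> * r * d)) < nv c" using False by (simp add: nv_mult)
    from nv_add_eq'[OF this] have 1: "nv (c - \<rho> * r * d) = nv c" by simp
    have "nv (\<rho> * \<pi>) * nv d \<le> nv \<rho> * 1 * nv d"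
      unfolding nv_mult using unif nv_nonneg by (intro mult_mono mult_nonneg_nonneg) auto
    then have "\<not> nv (c - \<rho> * r * d) \<le> nv (\<rho> * \<pi>) * nv d" using False 1 by simp
    then show ?thesis using eta_cong[OF 1] by (simp add: P_def)
  qed
  then have "(\<Sum>r\<in>R 1. P (\<rho> * \<pi>) (c - \<rho> * r * d) d) = (\<Sum>r\<in>R 1. eta c)"
    by (rule sum.cong[OF refl])
  then show ?thesis using False by (simp add: P_def)
next
  case True
  then have d: "d \<noteq> 0" using cd by auto
  define z where "z = c / (\<rho> * d)"
  have rd: "nv (\<rho> * d) > 0" using d \<rho> by (simp add: nv_pos)
  have c: "c = z * (\<rho> * d)" using d \<rho> by (simp add: z_def)
  have "nv z * nv (\<rho> * d) \<le> 1 * nv (\<rho> * d)" using True unfolding c by (simp add: nv_mult)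
  then have z: "nv z \<le> 1" using rd by (rule mult_right_le_imp_le)
  obtain r where r: "r \<in> R 1" "nv (z - r) \<le> nv \<pi> ^ 1" and
    u: "\<And>s. s \<in> R 1 \<Longrightarrow> nv (z - s) \<le> nv \<pi> ^ 1 \<Longrightarrow> s = r"
    using R_ex1[OF z, of 1] by blast
  have eq: "c - \<rho> * s * d = (z - s) * (\<rho> * d)" for s by (simp add: c algebra_simps)
  have iff: "nv (c - \<rho> * s * d) \<le> nv (\<rho> * \<pi>) * nv d \<longleftrightarrow> nv (z - s) \<le> nv \<pi>" for s
  proof -
    have "nv (\<rho> * \<pi>) * nv d = nv \<pi> * nv (\<rho> * d)" by (simp add: nv_mult)
    then show ?thesis using rd unfolding eq nv_mult[of "z - s"] by (simp only: mult_le_cancel_right) auto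
  qed
  have 1: "P (\<rho> * \<pi>) (c - \<rho> * r * d) d = c0 * (eta \<rho> * eta \<pi>) * eta d"
    using r(2) \<rho> unfolding P_def iff by (simp add: eta_mult)
  have 2: "P (\<rho> * \<pi>) (c - \<rho> * s * d) d = eta \<rho> * eta d" if s: "s \<in> R 1 - {r}" for s
  proof -
    have n: "\<not> nv (z - s) \<le> nv \<pi>" using u[of s] s by auto
    have "nv (z - s) = 1"
      using n nv_less_iff[of "z - s" 1] nv_diff_leI[OF z R_le[of s 1]] s by auto
    then have "nv (c - \<rho> * s * d) = nv (\<rho> * d)" unfolding eq by (simp add: nv_mult)
    then have "eta (c - \<rho> * s * d) = eta (\<rho> * d)" by (rule eta_cong)
    then show ?thesis using n d \<rho> unfolding P_def iff by (simp add: eta_mult)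
  qed
  have "(\<Sum>r\<in>R 1. P (\<rho> * \<pi>) (c - \<rho> * r * d) d) =
      c0 * (eta \<rho> * eta \<pi>) * eta d + (\<Sum>s\<in>R 1 - {r}. eta \<rho> * eta d)"
    unfolding sum.remove[OF finite_R r(1)] 1 by (simp add: 2)
  also have "\<dots> = (c0 * eta \<pi> + (q - 1)) * (eta \<rho> * eta d)"
    using r(1) finite_R card_R_gt_1 by (simp add: of_nat_diff algebra_simps)
  \<comment> \<open>The recursion satisfied by the geometric series behind
    \<open>c0\<close>.\<close>
  also have "c0 * eta \<pi> + (q - 1) = q * c0"
    using q_eta by (simp add: c0_def field_simps)
  finally show ?thesis using True by (simp add: P_def)
qed

lemma intw_avg:
  assumes \<rho>: "\<rho> \<noteq> 0"
  shows "intw \<rho> g = (\<Sum>r\<in>R 1. complex_of_real (nv \<pi>) * intw (\<rho> * \<pi>) (g ** mat2 1 0 (- (\<rho> * r)) 1))"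
proof (cases "invertible g")
  case True
  define P where "P = (\<lambda>\<rho> c d. if nv c \<le> nv \<rho> * nv d then c0 * eta \<rho> * eta d else 1 * eta c)"
  let ?c = "g $ 2 $ 1" and ?d = "g $ 2 $ 2"
  have intw: "intw \<rho> g = omega (det g) * P \<rho> ?c ?d" for \<rho>
    using True by (simp add: intw_def two_valued_def rowf_def P_def)
  have "intw (\<rho> * \<pi>) (g ** mat2 1 0 (- (\<rho> * r)) 1) = omega (det g) * P (\<rho> * \<pi>) (?c - \<rho> * r * ?d) ?d" for r
    unfolding intw_def two_valued_def P_def
    by (subst rowf_mult) (use True in \<open>simp_all add: rowf_def omega_unit algebra_simps\<close>)
  then have "(\<Sum>r\<in>R 1. complex_of_real (nv \<pi>) * intw (\<rho> * \<pi>) (g ** mat2 1 0 (- (\<rho> * r)) 1)) =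
      complex_of_real (nv \<pi>) * omega (det g) * (\<Sum>r\<in>R 1. P (\<rho> * \<pi>) (?c - \<rho> * r * ?d) ?d)"
    by (simp add: sum_distrib_left mult.assoc)
  also have "(\<Sum>r\<in>R 1. P (\<rho> * \<pi>) (?c - \<rho> * r * ?d) ?d) = q * P \<rho> ?c ?d"
    using intw_avg_row[OF \<rho> det_ne_0_row2[OF True]] unfolding P_def by (rule sym)
  also have "complex_of_real (nv \<pi>) * omega (det g) * (q * P \<rho> ?c ?d) =
      (q * complex_of_real (nv \<pi>)) * (omega (det g) * P \<rho> ?c ?d)"
    by (simp only: mult_ac)
  finally show ?thesis unfolding q_nv intw by simp
next
  case False
  then show ?thesis by (simp add: intw_def two_valued_def rowf_def invertible_mult2)
qed

lemma intw_diag: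
  assumes "\<rho> \<noteq> 0" "a \<noteq> 0"
  shows "intw \<rho> (g ** mat2 a 0 0 1) = omega a * eta a * intw (\<rho> / a) g"
proof -
  have iff: "nv (x * a) \<le> nv \<rho> * y \<longleftrightarrow> nv x \<le> nv (\<rho> / a) * y" for x y
    using nv_pos[OF assms(2)] by (simp add: nv_mult nv_divide field_simps)
  have e: "eta \<rho> = eta a * eta (\<rho> / a)" using eta_mult[of a "\<rho> / a"] assms by simp
  have "(if nv (c * a) \<le> nv \<rho> * nv d then c0 * eta \<rho> * eta d else 1 * eta (c * a)) =
      eta a * (if nv c \<le> nv (\<rho> / a) * nv d then c0 * eta (\<rho> / a) * eta d else 1 * eta c)" for c d
  proof (cases "c = 0")
    case True
    then show ?thesis using nv_nonneg by (simp add: e)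
  next
    case False
    then show ?thesis unfolding iff using assms by (simp add: e eta_mult)
  qed
  note key = this
  have "intw \<rho> (g ** mat2 a 0 0 1) = omega a *
      rowf (\<lambda>c d. if nv (c * a) \<le> nv \<rho> * nv d then c0 * eta \<rho> * eta d else 1 * eta (c * a)) g"
    unfolding intw_def two_valued_def by (subst rowf_mult) (simp_all add: assms cong: if_cong)
  then show ?thesis unfolding key rowf_scale intw_def two_valued_def by simp
qed

text \<open>Shrinking the radius changes the mean only where |c| \<le> |\<rho> d|, by a combination
  of two balls of total mass zero. Its coefficient vanishes exactly when eta(\<pi>) = 1; then all
  \<open>intw \<rho>\<close> coincide with a character of the determinant and the operator is not
  onto.\<close>

lemma intw_diff:
  assumes \<rho>: "\<rho> \<noteq> 0"
  shows "intw \<rho> g - intw (\<rho> * \<pi>) g =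
    eta \<rho> * (eta \<pi> - 1) / (q - eta \<pi>) * (small 0 \<rho> g - q * small 0 (\<rho> * \<pi>) g)"
proof (cases "invertible g")
  case True
  define c d where "c = g $ 2 $ 1" and "d = g $ 2 $ 2"
  have cd: "c \<noteq> 0 \<or> d \<noteq> 0" using det_ne_0_row2[OF True] by (simp add: c_def d_def)
  have i: "intw \<rho> g = omega (det g) * (if nv c \<le> nv \<rho> * nv d then c0 * eta \<rho> * eta d else eta c)" for \<rho>
    using True by (simp add: intw_def two_valued_def rowf_def c_def d_def)
  have s: "small 0 \<rho> g = omega (det g) * (if nv c \<le> nv \<rho> * nv d then eta d else 0)" for \<rho>
    using True by (simp add: small_def rowf_def c_def d_def)
  have le: "nv (\<rho> * \<pi>) * nv d \<le> nv \<rho> * nv d"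
    unfolding nv_mult using unif nv_nonneg
    by (intro mult_right_mono mult_left_le) (auto simp: nv_nonneg)
  consider "nv c \<le> nv (\<rho> * \<pi>) * nv d" | "\<not> nv c \<le> nv \<rho> * nv d"
    | "\<not> nv c \<le> nv (\<rho> * \<pi>) * nv d" "nv c \<le> nv \<rho> * nv d" by blast
  then show ?thesis
  proof cases
    case 1
    have e: "c0 * (1 - eta \<pi>) = (eta \<pi> - 1) / (q - eta \<pi>) * (1 - q)"
      using q_eta by (simp add: c0_def field_simps)
    have "intw \<rho> g - intw (\<rho> * \<pi>) g = (c0 * (1 - eta \<pi>)) * (eta \<rho> * eta d * omega (det g))"
      unfolding i using 1 le \<rho> by (simp add: eta_mult algebra_simps)
    also have "\<dots> = eta \<rho> * (eta \<pi> - 1) / (q - eta \<pi>) * (small 0 \<rho> g - q * small 0 (\<rho> * \<pi>) g)"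
      unfolding e s using 1 le by (simp add: algebra_simps)
    finally show ?thesis .
  next
    case 2
    then show ?thesis unfolding i s using le by simp
  next
    case 3
    have d: "d \<noteq> 0" using 3(2) cd by auto
    have "\<not> nv c < nv (\<rho> * d)"
      using 3(1) nv_less_iff[of c "\<rho> * d"] by (simp add: nv_mult mult_ac)
    then have "eta c = eta (\<rho> * d)" using 3(2) by (intro eta_cong) (simp add: nv_mult)
    then have c: "eta c = eta \<rho> * eta d" using d \<rho> by (simp add: eta_mult)
    have e: "c0 - 1 = (eta \<pi> - 1) / (q - eta \<pi>)"
      using q_eta by (simp add: c0_def field_simps)
    have "intw \<rho> g - intw (\<rho> * \<pi>) g = (c0 - 1) * (eta \<rho> * eta d * omega (det g))"
      unfolding i using 3 by (simp add: c algebra_simps)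
    then show ?thesis unfolding e s using 3 by (simp add: algebra_simps)
  qed
qed (simp add: intw_def two_valued_def small_def rowf_def)

lemma intw_eq_cells: "intw 1 g = c0 * small 0 1 g + big 0 \<pi> g"
proof (cases "invertible g")
  case True
  have "nv (g$2$1) \<le> nv (g$2$2) \<longleftrightarrow> \<not> nv (g$2$2) \<le> nv \<pi> * nv (g$2$1)"
    using nv_less_iff[of "g$2$2" "g$2$1"] det_ne_0_row2[OF True] by auto
  then show ?thesis
    using True by (simp add: intw_def two_valued_def small_def big_def rowf_def eta_unit)
qed (simp add: intw_def two_valued_def small_def big_def rowf_def)

text \<open>The point 1 has the same coordinate in both charts, and |c| = |d| near it. This ball
  links the masses of the two charts.\<close>

lemma big_1_eq_small_1: "big 1 \<pi> = small 1 \<pi>"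
proof
  fix g :: "'a^2^2"
  show "big 1 \<pi> g = small 1 \<pi> g"
  proof (cases "invertible g")
    case True
    define c d where "c = g $ 2 $ 1" and "d = g $ 2 $ 2"
    have cd: "nv c = nv d" if "nv (c - d) < nv c \<or> nv (c - d) < nv d"
      using that nv_add_eq[of "c - d" d] nv_add_eq[of "d - c" c] nv_diff_commute[of c d] by auto
    have "c \<noteq> 0 \<or> d \<noteq> 0" using det_ne_0_row2[OF True] by (simp add: c_def d_def)
    then have "nv (d - c) \<le> nv \<pi> * nv c \<longleftrightarrow> nv (c - d) < nv c" "nv (c - d) \<le> nv \<pi> * nv d \<longleftrightarrow> nv (c - d) < nv d"
      using nv_less_iff[of "c - d" c] nv_less_iff[of "c - d" d] nv_diff_commute[of c d] by auto
    then have "(if nv (d - c) \<le> nv \<pi> * nv c then eta c else 0) = (if nv (c - d) \<le> nv \<pi> * nv d then eta d else 0)"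
      using cd eta_cong[of c d] by auto
    moreover have "big 1 \<pi> g = omega (det g) * (if nv (d - c) \<le> nv \<pi> * nv c then eta c else 0)"
      using True by (simp add: big_def rowf_def c_def d_def)
    moreover have "small 1 \<pi> g = omega (det g) * (if nv (c - d) \<le> nv \<pi> * nv d then eta d else 0)"
      using True by (simp add: small_def rowf_def c_def d_def)
    ultimately show ?thesis by (simp only:)
  qed (simp add: big_def small_def rowf_def)
qed

lemma big_1_radius: "nv r \<le> 1 \<Longrightarrow> big r 1 = big 0 1"
proof -
  assume r: "nv r \<le> 1"
  have "nv (d - r * c) \<le> nv c \<longleftrightarrow> nv d \<le> nv c" for c d
  proof -
    have "nv (r * c) \<le> nv c" using r nv_nonneg by (simp add: nv_mult mult_left_le_one_le)
    then show ?thesis using nv_add_leI[of "d - r * c" "nv c" "r * c"] nv_diff_leI[of d "nv c" "r * c"] by auto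
  qed
  then show ?thesis by (simp add: big_def)
qed

lemma small_1_radius: "nv r \<le> 1 \<Longrightarrow> small r 1 = small 0 1"
proof -
  assume r: "nv r \<le> 1"
  have "nv (c - r * d) \<le> nv d \<longleftrightarrow> nv c \<le> nv d" for c d
  proof -
    have "nv (r * d) \<le> nv d" using r nv_nonneg by (simp add: nv_mult mult_left_le_one_le)
    then show ?thesis using nv_add_leI[of "c - r * d" "nv d" "r * d"] nv_diff_leI[of c "nv d" "r * d"] by auto
  qed
  then show ?thesis by (simp add: small_def)
qed

text \<open>Vanishing on all \<open>intw\<close> forces the mass of a ball to be divided by q
  whenever its radius is multiplied by |\<pi>|, so one constant determines all masses; the function
  \<open>intw 1\<close> then shows that this constant is 0.\<close>

lemma intw_total:
  assumes L: "clinear_on PS L" and f: "f \<in> PS"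
    and 0: "\<And>m k. m \<ge> m0 \<Longrightarrow> k \<in> max_compact \<Longrightarrow> L (\<lambda>g. intw (\<pi> ^ m) (g ** k)) = 0"
  shows "L f = 0"
proof -
  have mem: "(\<lambda>g. intw (\<pi> ^ m) (g ** k)) \<in> PS" "(\<lambda>g. small 0 (\<pi> ^ m) (g ** k)) \<in> PS"
    if "k \<in> max_compact" for m k
    using max_compact_invertible[OF that] by (auto intro!: PS_translate small_mem intw_mem)
  have step: "L (\<lambda>g. intw (\<pi> ^ m) (g ** k)) = 0"
    if IH: "\<And>k. k \<in> max_compact \<Longrightarrow> L (\<lambda>g. intw (\<pi> ^ Suc m) (g ** k)) = 0" and k: "k \<in> max_compact" for m k
  proof -
    let ?k = "\<lambda>r. k ** mat2 1 0 (- (\<pi> ^ m * r)) 1"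
    have K: "?k r \<in> max_compact" if "r \<in> R 1" for r
    proof (intro max_compact_mult[OF k] K_mat2)
      show "nv (- (\<pi> ^ m * r)) \<le> 1"
        using R_le[OF that] unif by (simp add: nv_mult nv_power mult_le_one power_le_one nv_nonneg)
    qed
    have "(\<lambda>g. intw (\<pi> ^ m) (g ** k)) =
        (\<lambda>g. \<Sum>r\<in>R 1. complex_of_real (nv \<pi>) * intw (\<pi> ^ Suc m) (g ** ?k r))"
      using intw_avg[of "\<pi> ^ m"] by (intro ext) (simp add: matrix_mul_assoc mult.commute)
    then have "L (\<lambda>g. intw (\<pi> ^ m) (g ** k)) =
        L (\<lambda>g. \<Sum>r\<in>R 1. complex_of_real (nv \<pi>) * intw (\<pi> ^ Suc m) (g ** ?k r))"
      by (rule arg_cong)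
    also have "\<dots> = (\<Sum>r\<in>R 1. complex_of_real (nv \<pi>) * L (\<lambda>g. intw (\<pi> ^ Suc m) (g ** ?k r)))"
      by (rule clinear_on_sum[OF L finite_R]) (rule mem(1)[OF K])
    also have "\<dots> = 0" by (rule sum.neutral) (use IH K in simp)
    finally show ?thesis .
  qed
  \<comment> \<open>Averaging carries the vanishing from level \<open>m + 1\<close> to level
    \<open>m\<close>. The induction is on the truncated difference \<open>m0 - m\<close>, which is 0
    for all \<open>m \<ge> m0\<close>.\<close>
  have all: "L (\<lambda>g. intw (\<pi> ^ m) (g ** k)) = 0" if k: "k \<in> max_compact" for m k
  proof -
    have "\<forall>k\<in>max_compact. L (\<lambda>g. intw (\<pi> ^ m) (g ** k)) = 0" if "m0 - m = n" for n m
      using that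
    proof (induction n arbitrary: m)
      case 0
      then show ?case using assms(3) by simp
    next
      case (Suc n)
      then have "m0 - Suc m = n" by simp
      from Suc.IH[OF this] show ?case using step by blast
    qed
    then show ?thesis using k by blast
  qed
  \<comment> \<open>This is \<open>intw_diff\<close> divided by its coefficient, which is nonzero
    since eta(\<pi>) is not 1.\<close>
  have small_step: "L (\<lambda>g. small 0 (\<pi> ^ m) (g ** k)) = q * L (\<lambda>g. small 0 (\<pi> ^ Suc m) (g ** k))"
    if k: "k \<in> max_compact" for m k
  proof -
    let ?s = "\<lambda>m g. small 0 (\<pi> ^ m) (g ** k)" and ?i = "\<lambda>m g. intw (\<pi> ^ m) (g ** k)"
    define A where "A = eta (\<pi> ^ m) * (eta \<pi> - 1) / (q - eta \<pi>)"
    have A: "A \<noteq> 0" using q_eta eta_unif_ne_1 by (simp add: A_def eta_nz)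
    have "(\<lambda>g. ?i m g - ?i (Suc m) g) = (\<lambda>g. A * (?s m g - q * ?s (Suc m) g))"
      using intw_diff[of "\<pi> ^ m"] by (intro ext) (simp add: A_def mult.commute)
    then have "L (\<lambda>g. ?i m g - ?i (Suc m) g) = L (\<lambda>g. A * (?s m g - q * ?s (Suc m) g))"
      by (rule arg_cong)
    moreover have "L (\<lambda>g. ?i m g - ?i (Suc m) g) = 0"
      using clinear_on_diff[OF L mem(1)[OF k] mem(1)[OF k]] all[OF k] by (simp del: power_Suc)
    moreover have "L (\<lambda>g. A * (s g - q * t g)) = A * (L s - q * L t)" if "s \<in> PS" "t \<in> PS" for s t
      using clinear_on_scale[OF L subspace_diff[OF PS_subspace that(1) subspace_scale[OF PS_subspace that(2)]]]
        clinear_on_diff[OF L that(1) subspace_scale[OF PS_subspace that(2)]] clinear_on_scale[OF L that(2)]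
      by simp
    from this[OF mem(2)[OF k] mem(2)[OF k]]
    have "L (\<lambda>g. A * (?s m g - q * ?s (Suc m) g)) = A * (L (?s m) - q * L (?s (Suc m)))" .
    ultimately show ?thesis using A by simp
  qed
  have small_power: "L (\<lambda>g. small 0 1 (g ** k)) = q ^ m * L (\<lambda>g. small 0 (\<pi> ^ m) (g ** k))"
    if k: "k \<in> max_compact" for m k
  proof (induction m)
    case (Suc m)
    then show ?case using small_step[OF k, of m] by (simp del: power_Suc add: power_Suc2)
  qed simp
  have big_power: "L (big 0 1) = q ^ m * L (big r (\<pi> ^ m))" if r: "nv r \<le> 1" for r m
    using small_power[OF K_mat2(2)[of "- r"], of m] r
    by (simp add: big_translate[symmetric] big_1_radius[OF r])
  have sm_power: "L (small 0 1) = q ^ m * L (small r (\<pi> ^ m))" if r: "nv r \<le> 1" for r m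
    using small_power[OF K_mat2(1)[of "- r"], of m] r
    by (simp add: small_translate[symmetric] small_1_radius[OF r])
  \<comment> \<open>Both unit balls contain the common ball of radius |\<pi>| around 1 and have q
    times its mass.\<close>
  have PQ: "L (big 0 1) = L (small 0 1)"
    using big_power[of 1 1] sm_power[of 1 1] by (simp add: big_1_eq_small_1)
  have "L (intw 1) = 0" using all[OF K_mat2(1)[of 0], of 0] by (simp add: mat2_one)
  moreover have "intw 1 = (\<lambda>g. c0 * small 0 1 g + big 0 \<pi> g)" by (intro ext intw_eq_cells)
  then have "L (intw 1) = L (\<lambda>g. c0 * small 0 1 g + big 0 \<pi> g)" by (rule arg_cong)
  moreover have "L (\<lambda>g. c0 * small 0 1 g + big 0 \<pi> g) = c0 * L (small 0 1) + L (big 0 \<pi>)"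
    using clinear_on_add[OF L subspace_scale[OF PS_subspace small_mem] big_mem] clinear_on_scale[OF L small_mem]
    by simp
  moreover have "L (big 0 \<pi>) = L (small 0 1) / q"
    using big_power[of 0 1] PQ q_nz by simp
  ultimately have "(c0 + 1 / q) * L (small 0 1) = 0" by (simp add: algebra_simps)
  then have z: "L (small 0 1) = 0" "L (big 0 1) = 0" using c0_plus PQ by auto
  show ?thesis
  proof (rule functional_zero_cells[OF L _ _ f, of 0])
    show "L (big r (\<pi> ^ m)) = 0" if "nv r \<le> 1" for r m
      using big_power[OF that, of m] z q_nz by simp
    show "L (small r (\<pi> ^ m)) = 0" if "nv r < 1" for r m
      using sm_power[of r m] that z q_nz by simp
  qed
qed

lemma test_family_intw:
  "test_family nv \<pi> R chi psi intw (\<lambda>a. omega a * eta a)"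
proof unfold_locales
  show "intw \<rho> = intw \<rho>'" if "nv \<rho> = nv \<rho>'" for \<rho> \<rho>'
    using that eta_cong[OF that] by (simp add: intw_def two_valued_def)
  show "real (card (R 1)) * nv \<pi> = 1" by (rule card_R)
  show "intw \<rho> g = (\<Sum>r\<in>R 1. complex_of_real (nv \<pi>) * intw (\<rho> * \<pi>) (g ** mat2 1 0 (- (\<rho> * r)) 1))"
    if "\<rho> \<noteq> 0" for \<rho> g by (rule intw_avg[OF that])
  show "intw \<rho> (g ** mat2 1 b 0 1) = intw \<rho> g" if "\<rho> \<noteq> 0" "nv b * nv \<rho> < 1" for \<rho> b g
    unfolding intw_def by (rule two_valued_upper[OF that])
  show "L f = 0" if "clinear_on PS L"
    "\<And>m k. m \<ge> m0 \<Longrightarrow> k \<in> max_compact \<Longrightarrow> L (\<lambda>g. intw (\<pi> ^ m) (g ** k)) = 0" "f \<in> PS" for L m0 f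
    by (rule intw_total[OF that(1,3,2)])
qed (simp_all add: intw_mem intw_diag omega_nz eta_nz omega_unit eta_unit)

end

text \<open>The constants omega(\<pi>) / |\<pi>| and omega(\<pi>) eta(\<pi>) have moduli
  |chi(\<pi>)| and |psi(\<pi>)| times the same power |\<pi>|^(-1/2), so the smaller one can be
  selected. In the second case the convergence condition |eta(\<pi>)| < q is the inequality
  |psi(\<pi>)| < |chi(\<pi>)|.\<close>

lemma (in unram_ps_normalised) test_family_exists:
  assumes "eta \<pi> \<noteq> 1" and ne: "cmod (chi \<pi>) \<noteq> cmod (psi \<pi>)"
  obtains F c where "test_family nv \<pi> R chi psi F c"
    "cmod (c \<pi>) = inverse (sqrt (nv \<pi>)) * min (cmod (chi \<pi>)) (cmod (psi \<pi>))"
proof -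
  have s: "sqrt (nv \<pi>) > 0" "sqrt (nv \<pi>) * sqrt (nv \<pi>) = nv \<pi>" using unif by simp_all
  have omega: "cmod (omega \<pi>) = sqrt (nv \<pi>) * cmod (chi \<pi>)"
    using unif by (simp add: omega_def norm_mult powr_half_sqrt)
  have inv: "sqrt (nv \<pi>) * inverse (nv \<pi>) = inverse (sqrt (nv \<pi>))"
    using s(1) by (subst s(2)[symmetric]) (simp add: field_simps)
  have inv': "cmod (complex_of_real (inverse (nv \<pi>))) = inverse (nv \<pi>)"
    using unif by (simp add: norm_inverse)
  have eta: "cmod (eta \<pi>) = inverse (nv \<pi>) * cmod (psi \<pi>) / cmod (chi \<pi>)"
    unfolding eta_def norm_mult norm_divide inv' ..
  have chi0: "cmod (chi \<pi>) > 0" using chi_nz by simp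
  show thesis
  proof (cases "cmod (chi \<pi>) < cmod (psi \<pi>)")
    case True
    have "cmod (omega \<pi> * complex_of_real (inverse (nv \<pi>))) =
        (sqrt (nv \<pi>) * inverse (nv \<pi>)) * cmod (chi \<pi>)"
      unfolding norm_mult omega inv' by simp
    then show ?thesis
      using that[OF test_family_conc] True unfolding inv by simp
  next
    case False
    then have less: "cmod (psi \<pi>) < cmod (chi \<pi>)" using ne by simp
    have "real (card (R 1)) = inverse (nv \<pi>)"
      using card_R unif by (simp add: field_simps)
    moreover have "cmod (eta \<pi>) < inverse (nv \<pi>)"
      unfolding eta using less chi0 unif by (simp add: field_simps)
    ultimately interpret unram_ps_irregular nv \<pi> R chi psi
      using assms(1) by unfold_locales simp_all
    have "cmod (omega \<pi> * eta \<pi>) = (sqrt (nv \<pi>) * inverse (nv \<pi>)) * cmod (psi \<pi>)"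
      unfolding norm_mult omega eta using chi0 by simp
    then show ?thesis
      using that[OF test_family_intw] less unfolding inv by simp
  qed
qed

section \<open>Equivariant distributions on the line\<close>

context discrete_field
begin

text \<open>A distribution \<open>E b \<rho>\<close> on the balls of the line that is homogeneous under scaling by an
  unramified character is determined by the mass of the unit ball. In contrast to Tate's description
  of such distributions, no case distinction is needed: the mass of \<open>1 + \<pi>\<^sup>m\<close> follows from additivity
  on the unit ball. The translations \<open>s m p\<close> may repeat, which lets the same statement serve for both
  quadratic algebras.\<close>

lemma homogeneous_distribution_zero:
  fixes E :: "'a \<Rightarrow> 'a \<Rightarrow> complex"
  assumes loc: "\<And>b b' \<rho> \<rho>'. nv \<rho> = nv \<rho>' \<Longrightarrow> nv (b - b') \<le> nv \<rho> \<Longrightarrow> E b \<rho> = E b' \<rho>'"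
    and scale: "\<And>t b \<rho>. t \<noteq> 0 \<Longrightarrow> \<rho> \<noteq> 0 \<Longrightarrow> E (t * b) (t * \<rho>) = \<theta> t * E b \<rho>"
    and unit: "\<And>t. nv t = 1 \<Longrightarrow> \<theta> t = 1"
    and additive: "\<And>m. E 0 1 = (\<Sum>p\<in>P m. E (s m p) (\<pi> ^ m))"
    and P: "\<And>m. finite (P m)" "\<And>m p. p \<in> P m \<Longrightarrow> nv (s m p) \<le> 1"
      "\<And>m. \<exists>p\<in>P m. nv (s m p - 1) \<le> nv \<pi> ^ m"
    and zero: "E 0 1 = 0" and \<rho>: "\<rho> \<noteq> 0"
  shows "E b \<rho> = 0"
proof -
  have centre: "E b \<rho> = 0" if "nv b \<le> nv \<rho>" "\<rho> \<noteq> 0" for b \<rho>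
  proof -
    have "E b \<rho> = E 0 \<rho>" using that by (intro loc) auto
    also have "\<dots> = \<theta> \<rho> * E 0 1" using scale[of \<rho> 1 0] that by simp
    finally show ?thesis using zero by simp
  qed
  have power: "nv b < 1 \<Longrightarrow> b \<noteq> 0 \<Longrightarrow> \<exists>j\<ge>1. nv b = nv \<pi> ^ j" for b
  proof -
    assume b: "nv b < 1" "b \<noteq> 0"
    then obtain k where k: "nv b = nv \<pi> powi k" using value_group by blast
    have "\<not> k \<le> 0"
    proof
      assume "k \<le> 0"
      then have "nv \<pi> powi 0 \<le> nv \<pi> powi k" using unif by (intro power_int_decreasing) auto
      then show False using b k by simp
    qed
    then have "nv b = nv \<pi> ^ nat k \<and> nat k \<ge> 1" using k by (simp add: power_int_def)
    then show ?thesis by blast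
  qed
  have one: "E 1 (\<pi> ^ m) = 0" for m
  proof (induction m rule: less_induct)
    case (less m)
    show ?case
    proof (cases "m = 0")
      case True
      then show ?thesis by (intro centre) auto
    next
      case False
      have m: "nv \<pi> ^ m < 1" using False unif by (simp add: power_less_one_iff)
      \<comment> \<open>A ball around a non-unit either contains 0 or is the multiple by
        \<open>x\<close> of a ball around 1 of larger radius |\<pi>|^(m - j),
        \<open>j \<ge> 1\<close>, to which the induction hypothesis applies.\<close>
      have nonunit: "E x (\<pi> ^ m) = 0" if x: "nv x < 1" for x
      proof (cases "nv x \<le> nv (\<pi> ^ m)")
        case True
        then show ?thesis by (intro centre) auto
      next
        case False
        then have x0: "x \<noteq> 0" using nv_nonneg[of "\<pi> ^ m"] by auto
        then obtain j where j: "j \<ge> 1" "nv x = nv \<pi> ^ j" using power x by blast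
        have jm: "j \<le> m"
        proof (rule ccontr)
          assume "\<not> j \<le> m"
          then have "nv \<pi> ^ j \<le> nv \<pi> ^ m" using unif by (intro power_decreasing) auto
          then show False using False j by (simp add: nv_power)
        qed
        have "nv (\<pi> ^ m) = nv \<pi> ^ (j + (m - j))" using jm by (simp add: nv_power)
        also have "\<dots> = nv (x * \<pi> ^ (m - j))" by (simp add: nv_mult nv_power j(2) power_add)
        finally have "E x (\<pi> ^ m) = E (x * 1) (x * \<pi> ^ (m - j))" by (intro loc) (simp_all add: nv_nonneg)
        also have "\<dots> = \<theta> x * E 1 (\<pi> ^ (m - j))" using x0 by (intro scale) auto
        also have "E 1 (\<pi> ^ (m - j)) = 0" using j(1) \<open>m \<noteq> 0\<close> by (intro less.IH) simp
        finally show ?thesis by simp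
      qed
      have is_unit: "E x (\<pi> ^ m) = E 1 (\<pi> ^ m)" if x: "nv x = 1" for x
      proof -
        have "E (x * 1) (x * \<pi> ^ m) = \<theta> x * E 1 (\<pi> ^ m)"
          using x by (intro scale) auto
        moreover have "E x (\<pi> ^ m) = E (x * 1) (x * \<pi> ^ m)"
          using x by (intro loc) (simp_all add: nv_mult nv_nonneg)
        ultimately show ?thesis using unit[OF x] by simp
      qed
      let ?U = "{p \<in> P m. nv (s m p) = 1}"
      have "0 = (\<Sum>p\<in>P m. E (s m p) (\<pi> ^ m))" using additive[of m] zero by simp
      also have "\<dots> = (\<Sum>p\<in>P m. if nv (s m p) = 1 then E 1 (\<pi> ^ m) else 0)"
      proof (rule sum.cong[OF refl])
        fix p assume "p \<in> P m"
        then show "E (s m p) (\<pi> ^ m) = (if nv (s m p) = 1 then E 1 (\<pi> ^ m) else 0)"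
          using P(2)[of p m] is_unit[of "s m p"] nonunit[of "s m p"] by auto
      qed
      also have "\<dots> = of_nat (card ?U) * E 1 (\<pi> ^ m)"
        by (simp add: P(1) flip: sum.inter_filter)
      finally have "of_nat (card ?U) * E 1 (\<pi> ^ m) = 0" by simp
      \<comment> \<open>Only the unit terms survive in the additivity relation, all equal; at least
        one occurs because some \<open>s m p\<close> is close to 1.\<close>
      moreover have "card ?U \<noteq> 0"
      proof -
        obtain p where p: "p \<in> P m" "nv (s m p - 1) \<le> nv \<pi> ^ m" using P(3) by blast
        have "nv (s m p) = 1" by (rule nv_near_one) (use p(2) m in linarith)
        then have "?U \<noteq> {}" using p by blast
        then show ?thesis using P(1) by simp
      qed
      ultimately show ?thesis by simp
    qed
  qed
  show ?thesis
  proof (cases "nv b \<le> nv \<rho>")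
    case True
    then show ?thesis using centre \<rho> by simp
  next
    case False
    then have b: "b \<noteq> 0" using nv_nonneg[of \<rho>] by auto
    have "nv (\<rho> / b) < 1" using False nv_pos[OF b] by (simp add: nv_divide)
    then obtain j where j: "nv (\<rho> / b) = nv \<pi> ^ j" using power \<rho> b by force
    have "E b \<rho> = E (b * 1) (b * (\<rho> / b))" using b by simp
    also have "\<dots> = \<theta> b * E 1 (\<rho> / b)" using b \<rho> by (intro scale) auto
    also have "E 1 (\<rho> / b) = E 1 (\<pi> ^ j)" by (intro loc) (simp_all add: j nv_power nv_nonneg)
    finally show ?thesis using one by simp
  qed
qed

end

section \<open>Tensor products of function spaces\<close>

lemma tensor_mem: "f \<in> V \<Longrightarrow> g \<in> W \<Longrightarrow> (\<lambda>(x, y). f x * g y) \<in> tensor V W"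
  unfolding tensor_def by (rule cfun.span_base) blast

lemma tensor_subspace: "cfun.subspace (tensor V W)"
  by (simp add: tensor_def)

lemma tensor_clinear_left:
  assumes L: "clinear_on (tensor V W) L" and V: "cfun.subspace V" and g: "g \<in> W"
  shows "clinear_on V (\<lambda>f. L (\<lambda>(x, y). f x * g y))"
  unfolding clinear_on_def
proof (intro conjI ballI allI V)
  show "L (\<lambda>(x, y). (s x + t x) * g y) = L (\<lambda>(x, y). s x * g y) + L (\<lambda>(x, y). t x * g y)"
    if "s \<in> V" "t \<in> V" for s t
    using clinear_on_add[OF L tensor_mem[OF that(1) g] tensor_mem[OF that(2) g]]
    by (simp add: case_prod_unfold distrib_right)
  show "L (\<lambda>(x, y). c * t x * g y) = c * L (\<lambda>(x, y). t x * g y)" if "t \<in> V" for c t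
    using clinear_on_scale[OF L tensor_mem[OF that g]]
    by (simp add: case_prod_unfold mult.assoc)
qed

lemma tensor_clinear_right:
  assumes L: "clinear_on (tensor V W) L" and W: "cfun.subspace W" and f: "f \<in> V"
  shows "clinear_on W (\<lambda>g. L (\<lambda>(x, y). f x * g y))"
  unfolding clinear_on_def
proof (intro conjI ballI allI W)
  show "L (\<lambda>(x, y). f x * (s y + t y)) = L (\<lambda>(x, y). f x * s y) + L (\<lambda>(x, y). f x * t y)"
    if "s \<in> W" "t \<in> W" for s t
    using clinear_on_add[OF L tensor_mem[OF f that(1)] tensor_mem[OF f that(2)]]
    by (simp add: case_prod_unfold distrib_left)
  show "L (\<lambda>(x, y). f x * (c * t y)) = c * L (\<lambda>(x, y). f x * t y)" if "t \<in> W" for c t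
    using clinear_on_scale[OF L tensor_mem[OF f that]]
    by (simp add: case_prod_unfold mult.left_commute)
qed

lemma tensor_functional_zero:
  assumes L: "clinear_on (tensor V W) L"
    and "\<And>f g. f \<in> V \<Longrightarrow> g \<in> W \<Longrightarrow> L (\<lambda>(x, y). f x * g y) = 0"
    and t: "t \<in> tensor V W"
  shows "L t = 0"
proof (rule clinear_on_span_zero[OF L])
  show "{(\<lambda>(x, y). f x * g y) |f g. f \<in> V \<and> g \<in> W} \<subseteq> tensor V W"
    using tensor_mem by blast
  show "t \<in> cfun.span {(\<lambda>(x, y). f x * g y) |f g. f \<in> V \<and> g \<in> W}"
    using t by (simp add: tensor_def)
  show "L b = 0" if "b \<in> {(\<lambda>(x, y). f x * g y) |f g. f \<in> V \<and> g \<in> W}" for b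
    using that assms(2) by blast
qed

text \<open>One scaled pure tensor is added at a time. Keeping the scalar outside means that
  \<open>V\<close> and \<open>W\<close> may be arbitrary sets of functions.\<close>

lemma tensor_induct [consumes 1, case_names base step]:
  assumes "t \<in> tensor V W" "P (\<lambda>_. 0)"
    and "\<And>c f g t. f \<in> V \<Longrightarrow> g \<in> W \<Longrightarrow> t \<in> tensor V W \<Longrightarrow> P t \<Longrightarrow> P (\<lambda>(x, y). c * (f x * g y) + t (x, y))"
  shows "P t"
proof -
  have "t \<in> tensor V W \<and> P t"
    using assms(1) unfolding tensor_def
  proof (induction rule: cfun.span_induct_alt)
    case base
    show ?case using assms(2) cfun.span_zero by (simp add: zero_fun_def)
  next
    case (step c x y)
    then obtain f g where fg: "f \<in> V" "g \<in> W" "x = (\<lambda>(x, y). f x * g y)" by blast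
    have eq: "cscale c x + y = (\<lambda>(u, w). c * (f u * g w) + y (u, w))"
      by (auto simp: fg cscale_def plus_fun_def)
    have "P (cscale c x + y)"
      unfolding eq using step fg by (intro assms(3)) (simp_all add: tensor_def)
    moreover have "cscale c x + y \<in> cfun.span {(\<lambda>(x, y). f x * g y) |f g. f \<in> V \<and> g \<in> W}"
      using cfun.span_add[OF cfun.span_scale[OF cfun.span_base[OF step(1)]]] step(2) by blast
    ultimately show ?case by blast
  qed
  then show ?thesis ..
qed

lemma tensor_translate:
  assumes "t \<in> tensor V W"
    and "\<And>f. f \<in> V \<Longrightarrow> (\<lambda>x. f (p x)) \<in> V" "\<And>g. g \<in> W \<Longrightarrow> (\<lambda>y. g (p' y)) \<in> W"
  shows "(\<lambda>(x, y). t (p x, p' y)) \<in> tensor V W"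
  using assms(1)
proof (induction rule: tensor_induct)
  case base
  show ?case using subspace_zero[OF tensor_subspace, of V W] by (simp add: case_prod_unfold)
next
  case (step c f g t)
  from subspace_add[OF tensor_subspace subspace_scale[OF tensor_subspace tensor_mem[OF assms(2)[OF step(1)] assms(3)[OF step(2)]]] step(4), of c]
  show ?case by (simp add: case_prod_unfold)
qed

section \<open>Orbit analysis\<close>

context unram_ps
begin

section \<open>Action of the upper triangular subgroup on balls\<close>

lemma small_0_at_upper: "a \<noteq> 0 \<Longrightarrow> \<rho> \<noteq> 0 \<Longrightarrow> small 0 \<rho> (mat2 a b 0 1) = omega a"
  by (simp add: small_def rowf_def eta_unit nv_nonneg)

lemma big_upper: "big x \<rho> (g ** mat2 1 b 0 1) = big (x - b) \<rho> g"
proof -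
  have "c * b + d - x * c = d - (x - b) * c" for c d :: 'a by (simp add: algebra_simps)
  note key = this
  have "big x \<rho> (g ** mat2 1 b 0 1) =
      rowf (\<lambda>c d. if nv (c * b + d - x * c) \<le> nv \<rho> * nv c then eta c else 0) g"
    unfolding big_def by (subst rowf_mult) (simp_all add: omega_unit cong: if_cong)
  then show ?thesis unfolding key big_def .
qed

lemma big_diag:
  assumes a: "a \<noteq> 0"
  shows "big x \<rho> (g ** mat2 a 0 0 1) = omega a * eta a * big (a * x) (a * \<rho>) g"
proof -
  have "(if nv (d - x * (c * a)) \<le> nv \<rho> * nv (c * a) then eta (c * a) else 0) =
      eta a * (if nv (d - a * x * c) \<le> nv (a * \<rho>) * nv c then eta c else 0)" if cd: "c \<noteq> 0 \<or> d \<noteq> 0" for c d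
  proof (cases "c = 0")
    case True
    then show ?thesis using cd by simp
  next
    case False
    then show ?thesis using a by (simp add: eta_mult nv_mult mult_ac)
  qed
  note key = this
  have "big x \<rho> (g ** mat2 a 0 0 1) = omega a *
      rowf (\<lambda>c d. if nv (d - x * (c * a)) \<le> nv \<rho> * nv (c * a) then eta (c * a) else 0) g"
    unfolding big_def using a by (subst rowf_mult) (simp_all cong: if_cong)
  also have "rowf (\<lambda>c d. if nv (d - x * (c * a)) \<le> nv \<rho> * nv (c * a) then eta (c * a) else 0) g =
      rowf (\<lambda>c d. eta a * (if nv (d - a * x * c) \<le> nv (a * \<rho>) * nv c then eta c else 0)) g"
    by (rule rowf_cong) (rule key)
  finally show ?thesis unfolding rowf_scale big_def by simp
qed

lemma big_cong2:
  assumes \<rho>: "nv \<rho> = nv \<rho>'" and x: "nv (x - x') \<le> nv \<rho>"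
  shows "big x \<rho> = big x' \<rho>'"
proof -
  have "nv (d - x * c) \<le> nv \<rho> * nv c \<longleftrightarrow> nv (d - x' * c) \<le> nv \<rho> * nv c" for c d
  proof -
    have "nv ((x - x') * c) \<le> nv \<rho> * nv c" "nv ((x' - x) * c) \<le> nv \<rho> * nv c"
      unfolding nv_mult nv_diff_commute[of x' x] using x by (intro mult_right_mono nv_nonneg; assumption)+
    then show ?thesis
      using nv_add_leI[of "d - x * c" _ "(x - x') * c"] nv_add_leI[of "d - x' * c" _ "(x' - x) * c"]
      by (auto simp: algebra_simps)
  qed
  then show ?thesis using \<rho> by (simp add: big_def)
qed

lemma small_0_1: "small 0 1 (mat 1) = 1"
  using small_0_at_upper[of 1 1 0] by (simp add: mat2_one omega_unit)

lemma PS_reduce: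
  assumes f: "f \<in> PS"
  shows "(\<lambda>g. f g - f (mat 1) * small 0 1 g) \<in> PS" "f (mat 1) - f (mat 1) * small 0 1 (mat 1) = 0"
  by (auto intro!: subspace_diff[OF PS_subspace] subspace_scale[OF PS_subspace] f small_mem simp: small_0_1)

text \<open>After subtracting \<open>f (mat 1) * small 0 1\<close>, the function vanishes at the
  fixed point and lies in the span of the balls of the big cell. A functional killing these is a
  multiple of evaluation at the identity.\<close>

lemma functional_big_zero:
  assumes L: "clinear_on PS L" and big: "\<And>x \<rho>. \<rho> \<noteq> 0 \<Longrightarrow> L (big x \<rho>) = 0" and f: "f \<in> PS"
  shows "L f = f (mat 1) * L (small 0 1)"
proof -
  have "L (\<lambda>g. f g - f (mat 1) * small 0 1 g) = 0"
  proof (rule clinear_on_span_zero[OF L])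
    show "(\<lambda>g. f g - f (mat 1) * small 0 1 g) \<in> cfun.span {big x \<rho> |x \<rho>. \<rho> \<noteq> 0}"
      by (rule vanishing_at_1_span) (use PS_reduce[OF f] in auto)
  qed (use big big_mem in auto)
  moreover have "L (\<lambda>g. f g - f (mat 1) * small 0 1 g) = L f - f (mat 1) * L (small 0 1)"
    using clinear_on_diff[OF L f subspace_scale[OF PS_subspace small_mem[of 1 0]]]
      clinear_on_scale[OF L small_mem[of 1 0]] by simp
  ultimately show ?thesis by simp
qed

end

text \<open>\<open>exponent1\<close> and \<open>exponent2\<close> belong to the orbits where the
  first, respectively the second, coordinate is the fixed point: a translation invariant mass on a
  line scales by q. \<open>exponent3\<close> belongs to the point where both coordinates are
  fixed.\<close>

locale split_orbits =
  P1: unram_ps_normalised nv \<pi> R chi1 psi1 + P2: unram_ps_normalised nv \<pi> R chi2 psi2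
  for nv :: "'a::field \<Rightarrow> real" and \<pi> R chi1 psi1 chi2 psi2 +
  fixes B :: "('a^2^2 \<Rightarrow> complex) \<Rightarrow> ('a^2^2 \<Rightarrow> complex) \<Rightarrow> complex" and c :: "'a \<Rightarrow> complex"
  assumes B_left: "g \<in> P2.PS \<Longrightarrow> clinear_on P1.PS (\<lambda>f. B f g)"
    and B_right: "f \<in> P1.PS \<Longrightarrow> clinear_on P2.PS (B f)"
    and B_upper: "f \<in> P1.PS \<Longrightarrow> g \<in> P2.PS \<Longrightarrow>
      B (\<lambda>x. f (x ** mat2 1 b 0 1)) (\<lambda>x. g (x ** mat2 1 b 0 1)) = B f g"
    and B_diag: "a \<noteq> 0 \<Longrightarrow> f \<in> P1.PS \<Longrightarrow> g \<in> P2.PS \<Longrightarrow>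
      c a * B (\<lambda>x. f (x ** mat2 a 0 0 1)) (\<lambda>x. g (x ** mat2 a 0 0 1)) = B f g"
    and c_nz: "a \<noteq> 0 \<Longrightarrow> c a \<noteq> 0" and c_unit: "nv a = 1 \<Longrightarrow> c a = 1"
    and exponent1: "c \<pi> * P1.omega \<pi> * (P2.omega \<pi> * P2.eta \<pi>) \<noteq> P1.q"
    and exponent2: "c \<pi> * (P1.omega \<pi> * P1.eta \<pi>) * P2.omega \<pi> \<noteq> P1.q"
    and exponent3: "c \<pi> * P1.omega \<pi> * P2.omega \<pi> \<noteq> 1"
    and B_0: "B (P1.big 0 1) (P2.big 0 1) = 0"
begin

text \<open>Simultaneous translation leaves only the difference of the centres, so the mass is a
  homogeneous distribution in \<open>y - x\<close>. Splitting both unit balls yields the differences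
  \<open>k - i\<close>, with repetitions.\<close>

lemma B_open_radius: "\<rho> \<noteq> 0 \<Longrightarrow> B (P1.big x \<rho>) (P2.big y \<rho>) = 0"
proof -
  assume \<rho>: "\<rho> \<noteq> 0"
  define E where "E = (\<lambda>b \<rho>. B (P1.big 0 \<rho>) (P2.big b \<rho>))"
  have shift: "B (P1.big (x - b) \<rho>) (P2.big (y - b) \<rho>) = B (P1.big x \<rho>) (P2.big y \<rho>)" if "\<rho> \<noteq> 0" for x y b \<rho>
    using B_upper[OF P1.big_mem[OF that] P2.big_mem[OF that], of x b y]
    by (simp add: P1.big_upper P2.big_upper)
  have "E (y - x) \<rho> = 0"
  proof (rule P1.homogeneous_distribution_zero[OF _ _ _ _ _ _ _ _ \<rho>,
      where \<theta> = "\<lambda>t. inverse (c t * (P1.omega t * P1.eta t) * (P2.omega t * P2.eta t))" and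
        P = "\<lambda>m. R m \<times> R m" and s = "\<lambda>m (i, k). k - i"])
    show "E b \<rho> = E b' \<rho>'" if "nv \<rho> = nv \<rho>'" "nv (b - b') \<le> nv \<rho>" for b b' \<rho> \<rho>'
      unfolding E_def P2.big_cong2[OF that] P1.big_cong[OF that(1)] ..
    show "E (t * b) (t * \<rho>) = inverse (c t * (P1.omega t * P1.eta t) * (P2.omega t * P2.eta t)) * E b \<rho>"
      if t: "t \<noteq> 0" and \<rho>: "\<rho> \<noteq> 0" for t b \<rho>
    proof -
      define k1 k2 where "k1 = P1.omega t * P1.eta t" and "k2 = P2.omega t * P2.eta t"
      have nz: "c t * k1 * k2 \<noteq> 0" using t by (simp add: k1_def k2_def c_nz P1.omega_nz P1.eta_nz P2.omega_nz P2.eta_nz)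
      have mem: "P1.big 0 (t * \<rho>) \<in> P1.PS" "P2.big (t * b) (t * \<rho>) \<in> P2.PS"
        using t \<rho> by (simp_all add: P1.big_mem P2.big_mem)
      have "E b \<rho> = c t * B (\<lambda>x. P1.big 0 \<rho> (x ** mat2 t 0 0 1)) (\<lambda>x. P2.big b \<rho> (x ** mat2 t 0 0 1))"
        unfolding E_def by (rule B_diag[OF t P1.big_mem[OF \<rho>] P2.big_mem[OF \<rho>], symmetric])
      also have "\<dots> = c t * B (\<lambda>x. k1 * P1.big 0 (t * \<rho>) x) (\<lambda>x. k2 * P2.big (t * b) (t * \<rho>) x)"
        by (simp add: P1.big_diag[OF t] P2.big_diag[OF t] k1_def k2_def)
      also have "\<dots> = c t * (k1 * (k2 * E (t * b) (t * \<rho>)))"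
        using clinear_on_scale[OF B_left[OF subspace_scale[OF P2.PS_subspace mem(2)]] mem(1)]
          clinear_on_scale[OF B_right[OF mem(1)] mem(2)] by (simp add: E_def)
      finally have "E b \<rho> = (c t * k1 * k2) * E (t * b) (t * \<rho>)" by (simp only: mult.assoc)
      then show ?thesis using nz unfolding k1_def[symmetric] k2_def[symmetric] by (simp add: field_simps)
    qed
    show "inverse (c t * (P1.omega t * P1.eta t) * (P2.omega t * P2.eta t)) = 1" if "nv t = 1" for t
      using that by (simp add: c_unit P1.omega_unit P1.eta_unit P2.omega_unit P2.eta_unit)
    show "E 0 1 = (\<Sum>p\<in>R m \<times> R m. E (case p of (i, k) \<Rightarrow> k - i) (\<pi> ^ m))" for m
    proof -
      have pm: "\<pi> ^ m \<noteq> 0" by simp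
      have "P1.big 0 1 = (\<lambda>g. \<Sum>i\<in>R m. P1.big i (\<pi> ^ m) g)"
        using P1.big_refine[of 1 0 _ m] by (intro ext) simp
      then have "E 0 1 = B (\<lambda>g. \<Sum>i\<in>R m. P1.big i (\<pi> ^ m) g) (P2.big 0 1)"
        by (simp add: E_def)
      also have "\<dots> = (\<Sum>i\<in>R m. B (P1.big i (\<pi> ^ m)) (P2.big 0 1))"
        by (rule clinear_on_sum1[OF B_left P1.finite_R]) (simp_all add: P1.big_mem P2.big_mem)
      also have "\<dots> = (\<Sum>i\<in>R m. \<Sum>k\<in>R m. B (P1.big i (\<pi> ^ m)) (P2.big k (\<pi> ^ m)))"
      proof (rule sum.cong[OF refl])
        fix i
        have "P2.big 0 1 = (\<lambda>g. \<Sum>i\<in>R m. P2.big i (\<pi> ^ m) g)"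
          using P2.big_refine[of 1 0 _ m] by (intro ext) simp
        then have "B (P1.big i (\<pi> ^ m)) (P2.big 0 1) = B (P1.big i (\<pi> ^ m)) (\<lambda>g. \<Sum>i\<in>R m. P2.big i (\<pi> ^ m) g)"
          by simp
        also have "\<dots> = (\<Sum>k\<in>R m. B (P1.big i (\<pi> ^ m)) (P2.big k (\<pi> ^ m)))"
          by (rule clinear_on_sum1[OF B_right P1.finite_R]) (simp_all add: P1.big_mem P2.big_mem)
        finally show "B (P1.big i (\<pi> ^ m)) (P2.big 0 1) = (\<Sum>k\<in>R m. B (P1.big i (\<pi> ^ m)) (P2.big k (\<pi> ^ m)))" .
      qed
      also have "\<dots> = (\<Sum>i\<in>R m. \<Sum>k\<in>R m. E (k - i) (\<pi> ^ m))"
        using shift[OF pm, of i i k for i k] by (simp add: E_def)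
      finally show ?thesis by (simp add: sum.cartesian_product case_prod_unfold)
    qed
    show "finite (R m \<times> R m)" for m by (simp add: P1.finite_R)
    show "nv (case p of (i, k) \<Rightarrow> k - i) \<le> 1" if "p \<in> R m \<times> R m" for m p
      using that P1.R_le by (auto intro!: P1.nv_diff_leI)
    show "\<exists>p\<in>R m \<times> R m. nv ((case p of (i, k) \<Rightarrow> k - i) - 1) \<le> nv \<pi> ^ m" for m
    proof -
      obtain i where i: "i \<in> R m" using P1.R_ex1[of 0 m] by auto
      have "nv (1 + i) \<le> 1" using P1.R_le[OF i] by (intro P1.nv_add_leI) auto
      then obtain k where k: "k \<in> R m" "nv (1 + i - k) \<le> nv \<pi> ^ m" using P1.R_ex1[of "1 + i" m] by auto
      have "nv (k - i - 1) \<le> nv \<pi> ^ m"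
        using k(2) P1.nv_diff_commute[of "k - i" 1] by (simp add: algebra_simps)
      then show ?thesis using i k by force
    qed
    show "E 0 1 = 0" using B_0 by (simp add: E_def)
  qed
  then show ?thesis using shift[OF \<rho>, of x x y] by (simp add: E_def)
qed

text \<open>The larger ball is cut into balls of the smaller radius.\<close>

lemma B_open:
  assumes "\<rho> \<noteq> 0" "\<rho>' \<noteq> 0"
  shows "B (P1.big x \<rho>) (P2.big y \<rho>') = 0"
proof -
  obtain a b where ab: "nv \<rho> = nv \<pi> powi a" "nv \<rho>' = nv \<pi> powi b"
    using P1.value_group assms by metis
  have comb: "nv (\<rho> * \<pi> ^ nat (b - a)) = nv \<rho>'" if "nv \<rho> = nv \<pi> powi a" "nv \<rho>' = nv \<pi> powi b" "a \<le> b"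
    for \<rho> \<rho>' :: 'a and a b
  proof -
    have "nv (\<rho> * \<pi> ^ nat (b - a)) = nv \<pi> powi a * nv \<pi> powi (b - a)"
      using that by (simp add: P1.nv_mult P1.nv_power power_int_def)
    also have "\<dots> = nv \<rho>'" using P1.unif that by (simp flip: power_int_add)
    finally show ?thesis .
  qed
  show ?thesis
  proof (cases "a \<le> b")
    case True
    define m where "m = nat (b - a)"
    have m: "nv (\<rho> * \<pi> ^ m) = nv \<rho>'" using comb[OF ab True] by (simp add: m_def)
    have "P1.big x \<rho> = (\<lambda>g. \<Sum>r\<in>R m. P1.big (x + \<rho> * r) \<rho>' g)"
      using P1.big_refine[OF assms(1), of x _ m] by (intro ext) (simp add: P1.big_cong[OF m])
    then have "B (P1.big x \<rho>) (P2.big y \<rho>') = B (\<lambda>g. \<Sum>r\<in>R m. P1.big (x + \<rho> * r) \<rho>' g) (P2.big y \<rho>')"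
      by (rule arg_cong)
    also have "\<dots> = (\<Sum>r\<in>R m. B (P1.big (x + \<rho> * r) \<rho>') (P2.big y \<rho>'))"
      by (rule clinear_on_sum1[OF B_left P1.finite_R]) (simp_all add: assms P1.big_mem P2.big_mem)
    finally show ?thesis by (simp add: B_open_radius assms)
  next
    case False
    define m where "m = nat (a - b)"
    have m: "nv (\<rho>' * \<pi> ^ m) = nv \<rho>" using comb[OF ab(2,1)] False by (simp add: m_def)
    have "P2.big y \<rho>' = (\<lambda>g. \<Sum>r\<in>R m. P2.big (y + \<rho>' * r) \<rho> g)"
      using P2.big_refine[OF assms(2), of y _ m] by (intro ext) (simp add: P2.big_cong[OF m])
    then have "B (P1.big x \<rho>) (P2.big y \<rho>') = B (P1.big x \<rho>) (\<lambda>g. \<Sum>r\<in>R m. P2.big (y + \<rho>' * r) \<rho> g)"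
      by (rule arg_cong)
    also have "\<dots> = (\<Sum>r\<in>R m. B (P1.big x \<rho>) (P2.big (y + \<rho>' * r) \<rho>))"
      by (rule clinear_on_sum1[OF B_right P1.finite_R]) (simp_all add: assms P1.big_mem P2.big_mem)
    finally show ?thesis by (simp add: B_open_radius assms)
  qed
qed

text \<open>A translation invariant mass of a ball is q times that of a sub-ball of relative radius
  |\<pi>|, while the torus prescribes the ratio \<open>k\<close>. As \<open>k\<close> is not q, both
  masses vanish.\<close>

lemma scaled_zero:
  assumes upper: "\<And>b. T b = T 0" and refine: "T 0 = (\<Sum>r\<in>R 1. S r)" and S: "\<And>r. S r = S 0"
    and eq: "k * S 0 = T 0" and k: "k \<noteq> P1.q"
  shows "T b = (0 :: complex)"
proof -
  have "(\<Sum>r\<in>R 1. S r) = (\<Sum>r\<in>R 1. S 0)" by (intro sum.cong refl S)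
  then have "T 0 = P1.q * S 0" using refine by simp
  then have "(k - P1.q) * S 0 = 0" using eq by (simp add: algebra_simps)
  then have "S 0 = 0" using k by simp
  then show ?thesis using eq upper[of b] by simp
qed

text \<open>Because \<open>B\<close> vanishes on pairs of big cells, the first argument enters only
  through its value at the identity. Upper unipotent matrices do not change this value for
  \<open>P1.small 0 1\<close>, so the mass in the second variable is translation invariant.\<close>

lemma B_closed1: "\<rho> \<noteq> 0 \<Longrightarrow> B (P1.small 0 1) (P2.big y \<rho>) = 0"
proof -
  assume \<rho>: "\<rho> \<noteq> 0"
  let ?e = "P1.small 0 1"
  have e: "?e \<in> P1.PS" by (simp add: P1.small_mem)
  have B1: "B f (P2.big y \<rho>) = f (mat 1) * B ?e (P2.big y \<rho>)" if "f \<in> P1.PS" "\<rho> \<noteq> 0" for f y \<rho>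
    by (rule P1.functional_big_zero[OF B_left[OF P2.big_mem[OF that(2)]] B_open[OF _ that(2)] that(1)])
  have upper: "B ?e (P2.big y \<rho>) = B ?e (P2.big 0 \<rho>)" if \<rho>: "\<rho> \<noteq> 0" for y \<rho>
  proof -
    have "B ?e (P2.big y \<rho>) = B (\<lambda>x. ?e (x ** mat2 1 y 0 1)) (P2.big 0 \<rho>)"
      using B_upper[OF e P2.big_mem[OF \<rho>], of y y] by (simp add: P2.big_upper)
    also have "\<dots> = ?e (mat 1 ** mat2 1 y 0 1) * B ?e (P2.big 0 \<rho>)"
      by (rule B1[OF P1.PS_translate[OF e] \<rho>]) simp
    finally show ?thesis by (simp add: P1.small_0_at_upper P1.omega_unit)
  qed
  have "B ?e (P2.big 0 \<rho>) = 0"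
  proof (rule scaled_zero[where T = "\<lambda>y. B ?e (P2.big y \<rho>)" and S = "\<lambda>r. B ?e (P2.big (\<rho> * r) (\<rho> * \<pi>))", OF _ _ _ _ exponent1])
    have "P2.big 0 \<rho> = (\<lambda>g. \<Sum>r\<in>R 1. P2.big (\<rho> * r) (\<rho> * \<pi>) g)"
      using P2.big_refine[OF \<rho>, of 0 _ 1] by (intro ext) simp
    then have "B ?e (P2.big 0 \<rho>) = B ?e (\<lambda>g. \<Sum>r\<in>R 1. P2.big (\<rho> * r) (\<rho> * \<pi>) g)" by (rule arg_cong)
    also have "\<dots> = (\<Sum>r\<in>R 1. B ?e (P2.big (\<rho> * r) (\<rho> * \<pi>)))"
      by (rule clinear_on_sum1[OF B_right P1.finite_R]) (simp_all add: e \<rho> P2.big_mem)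
    finally show "B ?e (P2.big 0 \<rho>) = (\<Sum>r\<in>R 1. B ?e (P2.big (\<rho> * r) (\<rho> * \<pi>)))" .
    show "B ?e (P2.big (\<rho> * r) (\<rho> * \<pi>)) = B ?e (P2.big (\<rho> * 0) (\<rho> * \<pi>))" for r
      using upper[of "\<rho> * \<pi>" "\<rho> * r"] \<rho> by simp
    let ?k2 = "P2.omega \<pi> * P2.eta \<pi>"
    have t: "invertible (mat2 \<pi> 0 0 1)" by simp
    have mem: "P2.big 0 (\<pi> * \<rho>) \<in> P2.PS" using \<rho> by (simp add: P2.big_mem)
    have "B ?e (P2.big 0 \<rho>) = c \<pi> * B (\<lambda>x. ?e (x ** mat2 \<pi> 0 0 1)) (\<lambda>x. P2.big 0 \<rho> (x ** mat2 \<pi> 0 0 1))"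
      by (rule B_diag[OF _ e P2.big_mem[OF \<rho>], symmetric]) simp
    also have "(\<lambda>x. P2.big 0 \<rho> (x ** mat2 \<pi> 0 0 1)) = (\<lambda>x. ?k2 * P2.big 0 (\<pi> * \<rho>) x)"
      by (simp add: P2.big_diag)
    also have "B (\<lambda>x. ?e (x ** mat2 \<pi> 0 0 1)) (\<lambda>x. ?k2 * P2.big 0 (\<pi> * \<rho>) x) =
        ?k2 * B (\<lambda>x. ?e (x ** mat2 \<pi> 0 0 1)) (P2.big 0 (\<pi> * \<rho>))"
      by (rule clinear_on_scale[OF B_right[OF P1.PS_translate[OF e t]] mem])
    also have "B (\<lambda>x. ?e (x ** mat2 \<pi> 0 0 1)) (P2.big 0 (\<pi> * \<rho>)) =
        ?e (mat 1 ** mat2 \<pi> 0 0 1) * B ?e (P2.big 0 (\<pi> * \<rho>))"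
      by (rule B1[OF P1.PS_translate[OF e t]]) (use \<rho> in simp)
    finally show "c \<pi> * P1.omega \<pi> * ?k2 * B ?e (P2.big (\<rho> * 0) (\<rho> * \<pi>)) = B ?e (P2.big 0 \<rho>)"
      by (simp add: P1.small_0_at_upper mult_ac)
  qed (use upper[OF \<rho>] in simp)
  then show ?thesis using upper[OF \<rho>] by simp
qed

end

text \<open>The setting is symmetric in the two factors, with \<open>exponent1\<close> and
  \<open>exponent2\<close> exchanged; this handles the second one-dimensional orbit.\<close>

lemma (in split_orbits) B_swap:
  "split_orbits nv \<pi> R chi2 psi2 chi1 psi1 (\<lambda>f g. B g f) c"
proof unfold_locales
  show "c \<pi> * P2.omega \<pi> * (P1.omega \<pi> * P1.eta \<pi>) \<noteq> P1.q" using exponent2 by (simp add: mult_ac)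
  show "c \<pi> * (P2.omega \<pi> * P2.eta \<pi>) * P1.omega \<pi> \<noteq> P1.q" using exponent1 by (simp add: mult_ac)
  show "c \<pi> * P2.omega \<pi> * P1.omega \<pi> \<noteq> 1" using exponent3 by (simp add: mult_ac)
qed (use B_left B_right B_upper B_diag c_nz c_unit B_0 in simp_all)

text \<open>With the larger orbits removed, \<open>B\<close> is a multiple of evaluation of both
  arguments at the identity. On it diag(\<pi>, 1) forces the factor of \<open>exponent3\<close> to
  be 1 unless the multiple is 0.\<close>

lemma (in split_orbits) B_zero:
  assumes f: "f \<in> P1.PS" and g: "g \<in> P2.PS"
  shows "B f g = 0"
proof -
  interpret swap: split_orbits nv \<pi> R chi2 psi2 chi1 psi1 "\<lambda>f g. B g f" c by (rule B_swap)
  let ?e1 = "P1.small 0 1" and ?e2 = "P2.small 0 1"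
  have e: "?e1 \<in> P1.PS" "?e2 \<in> P2.PS" by (simp_all add: P1.small_mem P2.small_mem)
  have 1: "B ?e1 g = g (mat 1) * B ?e1 ?e2" if "g \<in> P2.PS" for g
    by (rule P2.functional_big_zero[OF B_right[OF e(1)] B_closed1 that])
  have 2: "B (P1.big x \<rho>) g = 0" if "\<rho> \<noteq> 0" "g \<in> P2.PS" for x \<rho> g
    using P2.functional_big_zero[OF B_right[OF P1.big_mem[OF that(1)]] B_open[OF that(1)] that(2)]
      swap.B_closed1[OF that(1)] by simp
  have all: "B f g = f (mat 1) * (g (mat 1) * B ?e1 ?e2)" if "f \<in> P1.PS" "g \<in> P2.PS" for f g
    using P1.functional_big_zero[OF B_left[OF that(2)] 2 that(1)] that(2) 1[OF that(2)] by simp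
  have t: "invertible (mat2 \<pi> 0 0 1)" by simp
  have "B ?e1 ?e2 = c \<pi> * B (\<lambda>x. ?e1 (x ** mat2 \<pi> 0 0 1)) (\<lambda>x. ?e2 (x ** mat2 \<pi> 0 0 1))"
    by (rule B_diag[OF _ e, symmetric]) simp
  also have "B (\<lambda>x. ?e1 (x ** mat2 \<pi> 0 0 1)) (\<lambda>x. ?e2 (x ** mat2 \<pi> 0 0 1)) =
      P1.omega \<pi> * (P2.omega \<pi> * B ?e1 ?e2)"
    using all[OF P1.PS_translate[OF e(1) t] P2.PS_translate[OF e(2) t]]
    by (simp add: P1.small_0_at_upper P2.small_0_at_upper)
  finally have "(c \<pi> * P1.omega \<pi> * P2.omega \<pi> - 1) * B ?e1 ?e2 = 0"
    by (simp add: algebra_simps)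
  then have "B ?e1 ?e2 = 0" using exponent3 by simp
  then show ?thesis using all[OF f g] by simp
qed

text \<open>\<open>w\<close> is a unit orthogonal to the base field, so balls of the extension are
  products of balls in the coordinates. The square appears because \<open>nvE\<close> is the
  normalised absolute value.\<close>

locale quad_algebra =
  k: discrete_field nv \<pi> R + E: nonarch_abs nvE
  for nv :: "'a::field \<Rightarrow> real" and \<pi> R and nvE :: "'b::field \<Rightarrow> real" +
  fixes j :: "'a \<Rightarrow> 'b" and w :: 'b
  assumes j_add: "j (x + y) = j x + j y" and j_mult: "j (x * y) = j x * j y" and j_one: "j 1 = 1"
    and nvE_max: "nvE (j a + j b * w) = (max (nv a) (nv b))\<^sup>2"
    and basis: "\<exists>a b. z = j a + j b * w"
begin

lemma j_zero: "j 0 = 0"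
proof -
  have "j 0 + j 0 = j 0 + 0" using j_add[of 0 0] by simp
  then show ?thesis by (rule add_left_imp_eq)
qed

lemma j_minus: "j (- x) = - j x"
  using j_add[of x "- x"] j_zero by (simp add: eq_neg_iff_add_eq_0 add.commute)

lemma j_diff: "j (x - y) = j x - j y"
  using j_add[of x "- y"] j_minus[of y] by simp

lemma j_power: "j (x ^ n) = j x ^ n"
  by (induction n) (simp_all add: j_one j_mult)

lemma nvE_j: "nvE (j a) = (nv a)\<^sup>2"
  using nvE_max[of a 0] k.nv_nonneg[of a] by (simp add: j_zero max_def)

lemma nvE_w: "nvE (j b * w) = (nv b)\<^sup>2"
  using nvE_max[of 0 b] k.nv_nonneg[of b] by (simp add: j_zero max_def)

lemma j_nz: "a \<noteq> 0 \<Longrightarrow> j a \<noteq> 0"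
  using nvE_j[of a] k.nv_pos[of a] by auto

lemma nvE_value: "x \<noteq> 0 \<Longrightarrow> \<exists>a. a \<noteq> 0 \<and> nvE x = nvE (j a)"
proof -
  assume x: "x \<noteq> 0"
  obtain a b where x_eq: "x = j a + j b * w" using basis by blast
  then have "nvE x = nvE (j (if nv b \<le> nv a then a else b))"
    by (simp add: nvE_max nvE_j max_def)
  moreover have "(if nv b \<le> nv a then a else b) \<noteq> 0"
    using x k.nv_nonneg[of b] k.nv_nonneg[of a] by (auto simp: x_eq j_zero)
  ultimately show ?thesis by blast
qed

definition RE :: "nat \<Rightarrow> 'b set" where
  "RE m = (\<lambda>(i, k). j i + j k * w) ` (R m \<times> R m)"

lemma nvE_diff: "nvE ((j a + j b * w) - (j i + j k * w)) = (max (nv (a - i)) (nv (b - k)))\<^sup>2"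
proof -
  have "(j a + j b * w) - (j i + j k * w) = j (a - i) + j (b - k) * w"
    by (simp add: j_diff algebra_simps)
  then show ?thesis by (simp only: nvE_max)
qed

lemma square_le: "0 \<le> x \<Longrightarrow> 0 \<le> y \<Longrightarrow> x\<^sup>2 \<le> y\<^sup>2 \<longleftrightarrow> x \<le> (y::real)"
  by (simp add: power2_le_iff_abs_le)

lemma discrete_field_E: "discrete_field nvE (j \<pi>) RE"
proof unfold_locales
  show "0 < nvE (j \<pi>)" "nvE (j \<pi>) < 1"
    using k.unif by (simp_all add: nvE_j power_less_one_iff)
  show "\<exists>k::int. nvE x = nvE (j \<pi>) powi k" if x: "x \<noteq> 0" for x
  proof -
    obtain a where a: "a \<noteq> 0" "nvE x = nvE (j a)" using nvE_value[OF x] by blast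
    obtain k where k: "nv a = nv \<pi> powi k" using k.value_group[OF a(1)] by blast
    have "nvE x = nvE (j \<pi>) powi k"
      unfolding a(2) nvE_j k by (simp add: power2_eq_square power_int_mult_distrib)
    then show ?thesis by blast
  qed
  show "finite (RE m)" for m by (simp add: RE_def k.finite_R)
  show "nvE r \<le> 1" if r: "r \<in> RE m" for r m
  proof -
    obtain i k where ik: "i \<in> R m" "k \<in> R m" "r = j i + j k * w" using r by (auto simp: RE_def)
    then have "max (nv i) (nv k) \<le> 1" using k.R_le by auto
    then show ?thesis using k.nv_nonneg[of i] by (simp add: ik nvE_max power_le_one)
  qed
  show "\<exists>!r. r \<in> RE m \<and> nvE (x - r) \<le> nvE (j \<pi>) ^ m" if x: "nvE x \<le> 1" for x m
  proof -
    obtain a b where x_eq: "x = j a + j b * w" using basis by blast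
    have "(max (nv a) (nv b))\<^sup>2 \<le> 1\<^sup>2" using x by (simp add: x_eq nvE_max)
    then have "max (nv a) (nv b) \<le> 1" using k.nv_nonneg[of a] by (subst (asm) square_le) auto
    then have ab: "nv a \<le> 1" "nv b \<le> 1" by auto
    have iff: "nvE (x - (j i + j k * w)) \<le> nvE (j \<pi>) ^ m \<longleftrightarrow>
        nv (a - i) \<le> nv \<pi> ^ m \<and> nv (b - k) \<le> nv \<pi> ^ m" for i k
    proof -
      have "nvE (j \<pi>) ^ m = (nv \<pi> ^ m)\<^sup>2" by (simp add: nvE_j mult.commute flip: power_mult)
      then show ?thesis
        unfolding x_eq nvE_diff using k.nv_nonneg[of "a - i"] k.unif
        by (subst \<open>nvE (j \<pi>) ^ m = (nv \<pi> ^ m)\<^sup>2\<close>, subst square_le) (auto simp: max_def)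
    qed
    obtain i where i: "i \<in> R m" "nv (a - i) \<le> nv \<pi> ^ m"
      "\<And>i'. i' \<in> R m \<Longrightarrow> nv (a - i') \<le> nv \<pi> ^ m \<Longrightarrow> i' = i" using k.R_ex1[OF ab(1), of m] by blast
    obtain k where k: "k \<in> R m" "nv (b - k) \<le> nv \<pi> ^ m"
      "\<And>k'. k' \<in> R m \<Longrightarrow> nv (b - k') \<le> nv \<pi> ^ m \<Longrightarrow> k' = k" using k.R_ex1[OF ab(2), of m] by blast
    show ?thesis
    proof (rule ex1I[of _ "j i + j k * w"])
      show "j i + j k * w \<in> RE m \<and> nvE (x - (j i + j k * w)) \<le> nvE (j \<pi>) ^ m"
        using i(1,2) k(1,2) unfolding iff RE_def by force
      fix r assume r: "r \<in> RE m \<and> nvE (x - r) \<le> nvE (j \<pi>) ^ m"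
      then obtain i' k' where r_eq: "i' \<in> R m" "k' \<in> R m" "r = j i' + j k' * w" by (auto simp: RE_def)
      with r have "nv (a - i') \<le> nv \<pi> ^ m" "nv (b - k') \<le> nv \<pi> ^ m" using iff by auto
      then have "i' = i" "k' = k" using i(3)[OF r_eq(1)] k(3)[OF r_eq(2)] by auto
      then show "r = j i + j k * w" by (simp add: r_eq)
    qed
  qed
qed

lemma sum_RE: "(\<Sum>r\<in>RE m. F r) = (\<Sum>p\<in>R m \<times> R m. F (j (fst p) + j (snd p) * w))" for F :: "'b \<Rightarrow> complex"
proof -
  have "inj_on (\<lambda>(i, k). j i + j k * w) (R m \<times> R m)"
  proof (rule inj_onI, clarsimp)
    fix i k i' k' assume "j i + j k * w = j i' + j k' * w"
    then have "(max (nv (i - i')) (nv (k - k')))\<^sup>2 = 0"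
      using nvE_diff[of i k i' k'] by simp
    then have "max (nv (i - i')) (nv (k - k')) = 0" by simp
    then have "nv (i - i') \<le> 0" "nv (k - k') \<le> 0"
      using max.cobounded1[of "nv (i - i')" "nv (k - k')"] max.cobounded2[of "nv (k - k')" "nv (i - i')"]
      by linarith+
    then show "i = i' \<and> k = k'" by (simp add: k.nv_eq_0_iff)
  qed
  then show ?thesis unfolding RE_def by (subst sum.reindex) (auto simp: case_prod_unfold)
qed

end

text \<open>The affine line over the extension and the fixed point exhaust the projective line.
  Hence a single exponent occurs, that of the fixed point.\<close>

locale inert_orbits = quad_algebra nv \<pi> R nvE j w + E: unram_ps nvE "j \<pi>" "quad_algebra.RE R j w" chiE psiE
  for nv :: "'a::field \<Rightarrow> real" and \<pi> R and nvE :: "'b::field \<Rightarrow> real" and j w chiE psiE +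
  fixes L :: "('b^2^2 \<Rightarrow> complex) \<Rightarrow> complex" and c :: "'a \<Rightarrow> complex"
  assumes L: "clinear_on E.PS L"
    and L_upper: "f \<in> E.PS \<Longrightarrow> L (\<lambda>x. f (x ** mat2 1 (j b) 0 1)) = L f"
    and L_diag: "a \<noteq> 0 \<Longrightarrow> f \<in> E.PS \<Longrightarrow> c a * L (\<lambda>x. f (x ** mat2 (j a) 0 0 1)) = L f"
    and c_nz: "a \<noteq> 0 \<Longrightarrow> c a \<noteq> 0" and c_unit: "nv a = 1 \<Longrightarrow> c a = 1"
    and exponent: "c \<pi> * E.omega (j \<pi>) \<noteq> 1"
    and L_0: "L (E.big 0 1) = 0"
begin

text \<open>Translations by the base field remove the first coordinate of the centre, and
  \<open>D\<close> is the resulting distribution on the quotient line. Each second coordinate in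
  \<open>R m\<close> occurs once for every first coordinate, hence the translations
  \<open>snd\<close>.\<close>

lemma L_open: "\<rho> \<noteq> 0 \<Longrightarrow> L (E.big x \<rho>) = 0"
proof -
  assume "\<rho> \<noteq> 0"
  then obtain r where r: "r \<noteq> 0" "nvE \<rho> = nvE (j r)" using nvE_value by blast
  obtain a b where x: "x = j a + j b * w" using basis by blast
  define D where "D = (\<lambda>b r. L (E.big (j b * w) (j r)))"
  have shift: "L (E.big (j a + y) (j r)) = L (E.big y (j r))" if "r \<noteq> 0" for a y r
    using L_upper[OF E.big_mem[OF j_nz[OF that]], of "j a + y" a] by (simp add: E.big_upper)
  have "D b r = 0"
  proof (rule k.homogeneous_distribution_zero[OF _ _ _ _ _ _ _ _ r(1),
      where \<theta> = "\<lambda>t. inverse (c t * (E.omega (j t) * E.eta (j t)))" and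
        P = "\<lambda>m. R m \<times> R m" and s = "\<lambda>m. snd"])
    show "D b r = D b' r'" if "nv r = nv r'" "nv (b - b') \<le> nv r" for b b' r r'
    proof -
      have "nvE (j b * w - j b' * w) = (nv (b - b'))\<^sup>2"
        using nvE_w[of "b - b'"] by (simp add: j_diff left_diff_distrib)
      then have "nvE (j b * w - j b' * w) \<le> nvE (j r)"
        using that k.nv_nonneg by (simp add: nvE_j power_mono)
      then show ?thesis
        unfolding D_def by (subst E.big_cong2[of "j r" "j r'" "j b * w" "j b' * w"]) (simp_all add: nvE_j that)
    qed
    show "D (t * b) (t * r) = inverse (c t * (E.omega (j t) * E.eta (j t))) * D b r"
      if t: "t \<noteq> 0" and r: "r \<noteq> 0" for t b r
    proof -
      define k1 where "k1 = E.omega (j t) * E.eta (j t)"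
      have nz: "c t * k1 \<noteq> 0" using t by (simp add: k1_def c_nz E.omega_nz E.eta_nz j_nz)
      have mem: "E.big (j (t * b) * w) (j (t * r)) \<in> E.PS" using t r by (simp add: E.big_mem j_nz)
      have "D b r = c t * L (\<lambda>x. E.big (j b * w) (j r) (x ** mat2 (j t) 0 0 1))"
        unfolding D_def by (rule L_diag[OF t E.big_mem[OF j_nz[OF r]], symmetric])
      also have "\<dots> = c t * L (\<lambda>x. k1 * E.big (j (t * b) * w) (j (t * r)) x)"
        by (simp add: E.big_diag[OF j_nz[OF t]] k1_def j_mult mult.assoc)
      also have "\<dots> = c t * (k1 * D (t * b) (t * r))"
        using clinear_on_scale[OF L mem] by (simp add: D_def)
      finally have "D b r = (c t * k1) * D (t * b) (t * r)" by (simp only: mult.assoc)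
      then show ?thesis using nz unfolding k1_def[symmetric] by (simp add: field_simps)
    qed
    show "inverse (c t * (E.omega (j t) * E.eta (j t))) = 1" if "nv t = 1" for t
      using that by (simp add: c_unit E.omega_unit E.eta_unit nvE_j)
    show "D 0 1 = (\<Sum>p\<in>R m \<times> R m. D (snd p) (\<pi> ^ m))" for m
    proof -
      have pm: "\<pi> ^ m \<noteq> 0" by simp
      have "E.big 0 1 = (\<lambda>g. \<Sum>r\<in>RE m. E.big r (j \<pi> ^ m) g)"
        using E.big_refine[of 1 0 _ m] by (intro ext) simp
      then have "D 0 1 = L (\<lambda>g. \<Sum>r\<in>RE m. E.big r (j \<pi> ^ m) g)"
        by (simp add: D_def j_zero j_one)
      also have "\<dots> = (\<Sum>r\<in>RE m. L (E.big r (j \<pi> ^ m)))"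
        by (rule clinear_on_sum1[OF L E.finite_R]) (simp add: E.big_mem j_nz)
      also have "\<dots> = (\<Sum>p\<in>R m \<times> R m. L (E.big (j (fst p) + j (snd p) * w) (j (\<pi> ^ m))))"
        by (simp add: sum_RE j_power)
      also have "\<dots> = (\<Sum>p\<in>R m \<times> R m. D (snd p) (\<pi> ^ m))"
        unfolding D_def by (intro sum.cong refl shift pm)
      finally show ?thesis .
    qed
    show "finite (R m \<times> R m)" for m by (simp add: k.finite_R)
    show "nv (snd p) \<le> 1" if "p \<in> R m \<times> R m" for m p using that k.R_le by auto
    show "\<exists>p\<in>R m \<times> R m. nv (snd p - 1) \<le> nv \<pi> ^ m" for m
    proof -
      obtain i where i: "i \<in> R m" "nv (1 - i) \<le> nv \<pi> ^ m" using k.R_ex1[of 1 m] by auto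
      then have "(i, i) \<in> R m \<times> R m" "nv (snd (i, i) - 1) \<le> nv \<pi> ^ m"
        using k.nv_diff_commute[of i 1] by auto
      then show ?thesis by blast
    qed
    show "D 0 1 = 0" using L_0 by (simp add: D_def j_zero j_one)
  qed
  moreover have "E.big x \<rho> = E.big x (j r)" by (rule E.big_cong[OF r(2)])
  ultimately show ?thesis using shift[OF r(1), of a "j b * w"] by (simp add: x D_def)
qed

lemma L_zero:
  assumes f: "f \<in> E.PS"
  shows "L f = 0"
proof -
  let ?e = "E.small 0 1"
  have e: "?e \<in> E.PS" by (simp add: E.small_mem)
  have all: "L f = f (mat 1) * L ?e" if "f \<in> E.PS" for f
    by (rule E.functional_big_zero[OF L L_open that])
  have t: "invertible (mat2 (j \<pi>) 0 0 1)" by simp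
  have "L ?e = c \<pi> * L (\<lambda>x. ?e (x ** mat2 (j \<pi>) 0 0 1))"
    by (rule L_diag[OF _ e, symmetric]) simp
  also have "L (\<lambda>x. ?e (x ** mat2 (j \<pi>) 0 0 1)) = E.omega (j \<pi>) * L ?e"
    using all[OF E.PS_translate[OF e t]] by (simp add: E.small_0_at_upper)
  finally have "(c \<pi> * E.omega (j \<pi>) - 1) * L ?e = 0" by (simp add: algebra_simps)
  then show ?thesis using exponent all[OF f] by simp
qed

end

section \<open>Invariant functionals and equivariant functionals\<close>

lemma invariant_functionals_subspace: "cfun.subspace (invariant_functionals act T)"
  unfolding cfun.subspace_def
proof (intro conjI ballI allI)
  show "0 \<in> invariant_functionals act T"
    by (simp add: invariant_functionals_def)
  show "L + M \<in> invariant_functionals act T"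
    if "L \<in> invariant_functionals act T" "M \<in> invariant_functionals act T" for L M
    using that by (simp add: invariant_functionals_def algebra_simps)
  show "cscale k L \<in> invariant_functionals act T" if "L \<in> invariant_functionals act T" for k L
    using that by (simp add: invariant_functionals_def cscale_def algebra_simps)
qed

context test_family
begin

text \<open>Once \<open>n\<close> is at least the level of \<open>v0\<close>, the value of
  \<open>L\<close> on \<open>F (\<pi> ^ n)\<close> tensor \<open>v0\<close> is
  \<open>lam v0\<close>. If it is 0, \<open>crit\<close> kills \<open>lam\<close>, and then
  \<open>lam_zero\<close> kills \<open>L\<close>. The hypothesis \<open>crit\<close> is what the
  orbit analysis provides.\<close>

lemma invariant_functionals_cdim_le_1:
  assumes S: "cfun.subspace S"
    and tr: "\<And>v h. v \<in> S \<Longrightarrow> invertible h \<Longrightarrow> (\<lambda>y. v (act h y)) \<in> S"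
    and act: "\<And>k h y. act k (act h y) = act (h ** k) y" "\<And>y. act (mat 1) y = y"
    and smooth: "\<And>v. v \<in> S \<Longrightarrow> \<exists>e>0. \<forall>u. near_one e u \<longrightarrow> (\<forall>y. v (act u y) = v y)"
    and v0: "v0 \<in> S"
    and crit: "\<And>\<Lambda> v. clinear_on S \<Lambda> \<Longrightarrow>
      (\<And>v b. v \<in> S \<Longrightarrow> \<Lambda> (\<lambda>y. v (act (mat2 1 b 0 1) y)) = \<Lambda> v) \<Longrightarrow>
      (\<And>v a. v \<in> S \<Longrightarrow> a \<noteq> 0 \<Longrightarrow> c a * \<Lambda> (\<lambda>y. v (act (mat2 a 0 0 1) y)) = \<Lambda> v) \<Longrightarrow>
      \<Lambda> v0 = 0 \<Longrightarrow> v \<in> S \<Longrightarrow> \<Lambda> v = 0"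
  shows "cdim_le (invariant_functionals act (tensor PS S)) 1"
proof -
  obtain e where e: "e > 0" "\<And>u y. near_one e u \<Longrightarrow> v0 (act u y) = v0 y"
    using smooth[OF v0] by blast
  obtain n where n: "nv \<pi> ^ n \<le> e" using unif_power_small[OF e(1)] by blast
  show ?thesis
  proof (rule cdim_le_1I[OF invariant_functionals_subspace, where t = "\<lambda>(x, y). F (\<pi> ^ n) x * v0 y"])
    fix L assume L: "L \<in> invariant_functionals act (tensor PS S)"
      and L0: "L (\<lambda>(x, y). F (\<pi> ^ n) x * v0 y) = 0"
    have lin: "clinear_on (tensor PS S) L"
      using L by (simp add: clinear_on_def invariant_functionals_def tensor_subspace plus_fun_def cscale_def)
    define \<beta> where "\<beta> = (\<lambda>f v. L (\<lambda>(x, y). f x * v y))"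
    interpret invariant_pairing nv \<pi> R chi psi F c S act \<beta>
    proof (unfold_locales, goal_cases)
      case (5 v)
      then show ?case unfolding \<beta>_def by (rule tensor_clinear_left[OF lin PS_subspace])
    next
      case (6 f)
      then show ?case unfolding \<beta>_def by (rule tensor_clinear_right[OF lin S])
    next
      case (7 f v h)
      then have "\<forall>t\<in>tensor PS S. L (\<lambda>(x, y). t (x ** h, act h y)) = L t"
        using L by (simp add: invariant_functionals_def)
      from bspec[OF this tensor_mem[OF 7(1,2)]] show ?case by (simp add: \<beta>_def)
    qed (use tr act smooth in auto)
    have fixed: "fixed_at n v0"
      unfolding fixed_at_def tr_def using e(2) near_one_mono[OF _ n] by (intro allI impI ext) blast
    have "lam v = 0" if "v \<in> S" for v
    proof (rule crit[OF lam_linear _ _ _ that])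
      show "lam (\<lambda>y. v (act (mat2 1 b 0 1) y)) = lam v" if "v \<in> S" for v b
        using lam_upper[OF that] by (simp add: tr_def)
      show "c a * lam (\<lambda>y. v (act (mat2 a 0 0 1) y)) = lam v" if "v \<in> S" "a \<noteq> 0" for v a
        using lam_diag[OF that] by (simp add: tr_def)
      have "lam v0 = \<beta> (F (\<pi> ^ n)) v0" by (rule lam_eq[OF v0 fixed])
      also have "\<dots> = 0" unfolding \<beta>_def by (rule L0)
      finally show "lam v0 = 0" .
    qed
    then have "L (\<lambda>(x, y). f x * v y) = 0" if "f \<in> PS" "v \<in> S" for f v
      using lam_zero[OF _ that(2,1)] by (simp add: \<beta>_def)
    then have zero: "L t = 0" if "t \<in> tensor PS S" for t
      using tensor_functional_zero[OF lin _ that] by blast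
    show "L = (\<lambda>_. 0)"
    proof
      fix t show "L t = 0"
        using zero[of t] L by (cases "t \<in> tensor PS S") (auto simp: invariant_functionals_def)
    qed
  qed
qed

end

section \<open>Absolute values of the exponents\<close>

context unram_ps
begin

lemma cmod_omega: "cmod (omega x) = sqrt (nv x) * cmod (chi x)"
  using nv_nonneg[of x] by (simp add: omega_def norm_mult powr_half_sqrt)

lemma cmod_omega_eta:
  assumes "x \<noteq> 0"
  shows "cmod (omega x * eta x) = inverse (sqrt (nv x)) * cmod (psi x)"
proof -
  have x: "nv x > 0" by (rule nv_pos[OF assms])
  have "sqrt (nv x) * inverse (nv x) = inverse (sqrt (nv x))"
    using x real_sqrt_mult_self[of "nv x"]
    by (metis abs_of_pos inverse_mult_distrib mult.assoc mult.left_neutral right_inverse real_sqrt_gt_zero order_less_irrefl)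
  moreover have "cmod (complex_of_real (inverse (nv x))) = inverse (nv x)"
    using x by (simp add: norm_inverse)
  then have "cmod (omega x * eta x) = (sqrt (nv x) * inverse (nv x)) * cmod (psi x)"
    using chi_nz[OF assms] unfolding eta_def norm_mult norm_divide cmod_omega by simp
  ultimately show ?thesis by simp
qed

lemma eta_unif_powi: "eta (\<pi> powi k) = eta \<pi> powi k"
proof -
  have p: "eta (\<pi> ^ n) = eta \<pi> ^ n" for n
    by (induction n) (simp_all add: eta_mult eta_unit)
  have "eta (inverse x) = inverse (eta x)" if "x \<noteq> 0" for x
    using eta_mult[of x "inverse x"] that eta_unit[of 1] by (simp add: inverse_unique)
  then show ?thesis by (simp add: power_int_def p power_inverse)
qed

text \<open>An unramified character is determined by its value at \<pi>. The contrapositive turns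
  the condition on \<open>chi\<close> and \<open>psi\<close> into
  \<open>eta \<pi> \<noteq> 1\<close>.\<close>

lemma eta_unif_eq_1:
  assumes "eta \<pi> = 1"
  shows "eq_char (\<lambda>x. chi x / psi x) (\<lambda>x. complex_of_real (inverse (nv x)))"
  unfolding eq_char_def
proof (intro allI impI)
  fix x :: 'a assume x: "x \<noteq> 0"
  obtain k where "nv x = nv \<pi> powi k" using value_group[OF x] by blast
  then have "nv x = nv (\<pi> powi k)" by (simp add: nv_powi)
  then have "eta x = 1" using eta_cong[of x "\<pi> powi k"] by (simp add: eta_unif_powi assms)
  then have "complex_of_real (inverse (nv x)) * psi x = chi x"
    using chi_nz[OF x] by (simp add: eta_def)
  then show "chi x / psi x = complex_of_real (inverse (nv x))"
    using psi_nz[OF x] by (simp add: field_simps)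
qed

end

text \<open>The product of \<open>min a b * t\<close> and \<open>max a b * t\<close> is 1 and the
  factors differ, so the smaller one is below 1.\<close>

lemma tempered_product_less_1:
  fixes a b t :: real
  assumes "a * b * t\<^sup>2 = 1" "a \<noteq> b" "a > 0" "b > 0" "t > 0"
  shows "min a b * t < 1"
proof (rule ccontr)
  assume "\<not> min a b * t < 1"
  then have 1: "1 \<le> min a b * t" by simp
  have "max a b * t > min a b * t"
    using assms by (intro mult_strict_right_mono) auto
  then have "(min a b * t) * (max a b * t) > 1 * 1"
    using 1 by (intro mult_le_less_imp_less) auto
  moreover have "(min a b * t) * (max a b * t) = a * b * t\<^sup>2"
    by (simp add: min_def max_def power2_eq_square mult_ac)
  ultimately show False using assms(1) by simp
qed

section \<open>The field of l-adic numbers\<close>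

context padic_field
begin

abbreviation prm :: 'a where "prm \<equiv> of_nat l"

definition digits :: "nat \<Rightarrow> 'a set" where
  "digits m = of_nat ` {..<l ^ m}"

lemma l_gt_1: "1 < l"
  using prime_l by (rule prime_gt_1_nat)

lemma nv_prm: "nv prm = inverse (real l)"
proof -
  have "nv prm = padic_abs l (of_int (int l))"
    using nv_of_rat[of "of_int (int l)"] by simp
  also have "\<dots> = real l powi (- int (multiplicity (int l) (int l)))"
    using l_gt_1 by (simp add: padic_abs_def quotient_of_int of_int_eq_0_iff del: of_int_of_nat_eq)
  also have "multiplicity (int l) (int l) = 1"
    using l_gt_1 by (intro multiplicity_self) auto
  finally show ?thesis by (simp add: power_int_minus)
qed

lemma nv_of_int_le: "nv (of_int z) \<le> 1"
proof -
  have "nv (of_nat n) \<le> 1" for n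
    by (induction n) (auto intro: nv_add_leI)
  then show ?thesis by (cases z rule: int_cases2) auto
qed

text \<open>By Bezout, 1 = u l + v z; if |z| < 1, the right-hand side would have absolute value
  below 1.\<close>

lemma nv_of_int_unit:
  assumes "\<not> int l dvd z"
  shows "nv (of_int z) = 1"
proof (rule ccontr)
  assume "nv (of_int z) \<noteq> 1"
  then have z: "nv (of_int z) < 1" using nv_of_int_le[of z] by simp
  have "coprime (int l) z"
    using prime_l assms by (intro prime_imp_coprime) auto
  then obtain u v where uv: "u * int l + v * z = 1"
    using bezout_int[of "int l" z] by auto
  have "(of_int u * prm + of_int v * of_int z :: 'a) = of_int (u * int l + v * z)" by simp
  then have eq: "(of_int u * prm + of_int v * of_int z :: 'a) = 1" using uv by simp
  have "nv (of_int u * prm) \<le> 1 * nv prm" "nv (of_int v * of_int z) \<le> 1 * nv (of_int z)"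
    unfolding nv_mult by (intro mult_right_mono nv_of_int_le nv_nonneg)+
  moreover have "nv prm < 1" using l_gt_1 by (simp add: nv_prm field_simps)
  ultimately have "nv (of_int u * prm + of_int v * of_int z) < 1"
    using z by (intro nv_add_lessI) auto
  then show False unfolding eq by simp
qed

lemma nv_of_int_le_power: "nv (of_int z) \<le> nv prm ^ m \<longleftrightarrow> int l ^ m dvd z"
proof (cases "z = 0")
  case True
  then show ?thesis using nv_nonneg by simp
next
  case False
  have "\<not> is_unit (int l)" using l_gt_1 by simp
  then obtain y where y: "z = int l ^ multiplicity (int l) z * y" "\<not> int l dvd y"
    using multiplicity_decompose'[of z "int l"] False by blast
  define k where "k = multiplicity (int l) z"
  have "(of_int z :: 'a) = of_int (int l ^ k * y)"
    unfolding k_def by (rule arg_cong[OF y(1)])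
  then have nvz: "nv (of_int z) = nv prm ^ k"
    by (simp add: nv_mult nv_power nv_of_int_unit[OF y(2)])
  have "nv prm ^ k \<le> nv prm ^ m \<longleftrightarrow> m \<le> k"
    using l_gt_1 by (intro power_decreasing_iff) (simp_all add: nv_prm field_simps)
  also have "m \<le> k \<longleftrightarrow> int l ^ m dvd z"
    unfolding k_def using False l_gt_1 by (intro power_dvd_iff_le_multiplicity[symmetric]) simp_all
  finally show ?thesis unfolding nvz .
qed

text \<open>A rational a/b close to \<open>x\<close> has denominator prime to l, so \<open>b\<close>
  has an inverse \<open>u\<close> modulo l^m, and the residue of \<open>a * u\<close> is the
  required integer.\<close>

lemma near_integer:
  assumes "nv x \<le> 1"
  obtains n where "n < l ^ m" "nv (x - of_nat n) \<le> nv prm ^ m"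
proof -
  have p: "0 < nv prm" "nv prm < 1" using l_gt_1 by (simp_all add: nv_prm field_simps)
  obtain r where r: "nv (x - of_rat r) < nv prm ^ m" using dense[of "nv prm ^ m" x] p by auto
  have pm: "nv prm ^ m \<le> 1" using p by (simp add: power_le_one)
  have "nv (x - (x - of_rat r)) \<le> 1" using nv_diff_le[of x "x - of_rat r"] assms r pm by auto
  then have r1: "nv (of_rat r) \<le> 1" by simp
  obtain a b where ab: "quotient_of r = (a, b)" by (cases "quotient_of r")
  have b: "b > 0" by (rule quotient_of_denom_pos[OF ab])
  have cop: "coprime a b" by (rule quotient_of_coprime[OF ab])
  have "r = of_int a / of_int b" by (rule quotient_of_div[OF ab])
  then have req: "(of_rat r :: 'a) = of_int a / of_int b" by (simp add: of_rat_divide)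
  have lb: "\<not> int l dvd b"
  proof
    assume lb: "int l dvd b"
    have "\<not> int l dvd a"
    proof
      assume "int l dvd a"
      then have "is_unit (int l)" using lb cop by (meson coprime_common_divisor)
      then show False using l_gt_1 by simp
    qed
    then have "nv (of_int a) = 1" by (rule nv_of_int_unit)
    moreover have "nv (of_int b) \<le> nv prm ^ 1" using lb by (subst nv_of_int_le_power) simp
    moreover have "nv (of_int b) > 0" using b by (intro nv_pos) simp
    ultimately have "nv (of_rat r) > 1" using p by (simp add: req nv_divide field_simps)
    then show False using r1 by simp
  qed
  then have nvb: "nv (of_int b) = 1" by (rule nv_of_int_unit)
  have "coprime (int l) b" using prime_l lb by (intro prime_imp_coprime) auto
  then have "coprime b (int l ^ m)" by (simp add: coprime_commute)
  then obtain u v where uv: "u * b + v * int l ^ m = 1"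
    using bezout_int[of b "int l ^ m"] by auto
  define n where "n = (a * u) mod (int l ^ m)"
  have lm: "int l ^ m > 0" using l_gt_1 by simp
  have n: "0 \<le> n" "n < int l ^ m" using lm by (simp_all add: n_def)
  have "int l ^ m dvd a * u - n" unfolding n_def by (simp add: minus_mod_eq_mult_div)
  then have "int l ^ m dvd b * (a * u - n)" by (rule dvd_mult)
  moreover have "a - b * n = b * (a * u - n) + a * (v * int l ^ m)"
  proof -
    have "a = a * (u * b + v * int l ^ m)" using uv by simp
    then show ?thesis by (simp add: algebra_simps)
  qed
  ultimately have "int l ^ m dvd a - b * n" by simp
  then have "nv (of_int (a - b * n)) \<le> nv prm ^ m" by (simp only: nv_of_int_le_power)
  moreover have "of_rat r - of_int n = (of_int (a - b * n) / of_int b :: 'a)"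
    using b by (simp add: req field_simps)
  ultimately have "nv (of_rat r - of_int n) \<le> nv prm ^ m" by (simp add: nv_divide nvb)
  then have "nv ((x - of_rat r) + (of_rat r - of_int n)) \<le> nv prm ^ m"
    using r by (intro nv_add_leI) auto
  then have "nv (x - of_nat (nat n)) \<le> nv prm ^ m" using n by simp
  moreover have "nat n < l ^ m" using n by (simp add: nat_less_iff)
  ultimately show thesis using that by blast
qed

lemma discrete_field_padic: "discrete_field nv prm digits"
proof unfold_locales
  show p: "0 < nv prm" "nv prm < 1" using l_gt_1 by (simp_all add: nv_prm field_simps)
  show "\<exists>k::int. nv x = nv prm powi k" if x: "x \<noteq> 0" for x
  proof -
    obtain r where r: "nv (x - of_rat r) < nv x" using dense[of "nv x" x] nv_pos[OF x] by auto
    then have "nv (of_rat r - x) < nv x" using nv_diff_commute by metis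
    then have "nv (of_rat r - x + x) = nv x" by (rule nv_add_eq)
    then have eq: "nv x = padic_abs l r" using nv_of_rat[of r] by simp
    have "r \<noteq> 0" using eq nv_pos[OF x] by (auto simp: padic_abs_def)
    then obtain k where "nv x = real l powi k" using eq by (simp add: padic_abs_def)
    then have "nv x = nv prm powi (- k)" by (simp add: nv_prm power_int_minus power_int_inverse)
    then show ?thesis by blast
  qed
  show "finite (digits m)" for m by (simp add: digits_def)
  show "nv r \<le> 1" if "r \<in> digits m" for r m
    using that nv_of_int_le[of "int n" for n] by (auto simp: digits_def)
  show "\<exists>!r. r \<in> digits m \<and> nv (x - r) \<le> nv prm ^ m" if x: "nv x \<le> 1" for x m
  proof -
    obtain n where n: "n < l ^ m" "nv (x - of_nat n) \<le> nv prm ^ m" using near_integer[OF x] .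
    show ?thesis
    proof (rule ex1I[of _ "of_nat n"])
      show "of_nat n \<in> digits m \<and> nv (x - of_nat n) \<le> nv prm ^ m" using n by (simp add: digits_def)
      fix r assume "r \<in> digits m \<and> nv (x - r) \<le> nv prm ^ m"
      then obtain n' where n': "n' < l ^ m" "r = of_nat n'" "nv (x - of_nat n') \<le> nv prm ^ m"
        by (auto simp: digits_def)
      have "nv ((x - of_nat n) - (x - of_nat n')) \<le> nv prm ^ m" using n(2) n'(3) by (rule nv_diff_leI)
      then have "nv (of_int (int n' - int n)) \<le> nv prm ^ m" by simp
      then have "int l ^ m dvd int n' - int n" by (simp only: nv_of_int_le_power)
      moreover have "\<bar>int n' - int n\<bar> < int l ^ m"
        using n(1) n'(1) by (simp add: abs_less_iff flip: of_nat_power)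
      ultimately have "int n' - int n = 0" using dvd_imp_le_int[of "int n' - int n" "int l ^ m"] by fastforce
      then show "r = of_nat n" using n'(2) by simp
    qed
  qed
qed

lemma card_digits: "real (card (digits 1)) * nv prm = 1"
proof -
  have "card (digits 1) = l" by (simp add: digits_def card_image inj_on_def)
  then show ?thesis using l_gt_1 by (simp add: nv_prm)
qed

end

section \<open>The unramified quadratic extension of the l-adic numbers\<close>

locale padic_ext =
  K: padic_field l nv + ext: unramified_quadratic_ext nv nvE j
  for l and nv :: "'a::field_char_0 \<Rightarrow> real" and nvE :: "'b::field \<Rightarrow> real" and j :: "'a \<Rightarrow> 'b"
begin

sublocale K: discrete_field nv K.prm K.digits
  by (rule K.discrete_field_padic)

sublocale V: vector_space "\<lambda>c x. j c * x"
  by unfold_locales (simp_all add: ext.j_add ext.j_mult ext.j_one algebra_simps)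

lemma j_0: "j 0 = 0"
proof -
  have "j 0 + j 0 = j 0 + 0" using ext.j_add[of 0 0] by simp
  then show ?thesis by (rule add_left_imp_eq)
qed

lemma j_diff: "j (x - y) = j x - j y"
  using ext.j_add[of "x - y" y] by simp

lemma j_of_nat: "j (of_nat n) = of_nat n"
  by (induction n) (simp_all add: j_0 ext.j_add ext.j_one)

lemma dim_2: "V.dim UNIV = 2"
  by (rule ext.degree_2)

lemma basis_ex:
  obtains w where "w \<notin> range j" "\<And>x. \<exists>a b. x = j a + j b * w"
proof -
  have "range j \<noteq> UNIV"
  proof
    assume "range j = UNIV"
    then have "V.span {1} = UNIV" by (simp add: V.span_singleton)
    then have "V.dim UNIV = card {1::'b}" by (intro V.dim_eq_card) (simp_all add: V.span_UNIV)
    then show False using dim_2 by simp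
  qed
  then obtain w where w: "w \<notin> range j" by blast
  have "w \<notin> V.span {1}" using w by (simp add: V.span_singleton)
  then have ind: "V.independent {w, 1}" by (intro V.independent_insertI) (simp_all add: V.independent_empty)
  have "w \<noteq> 1" using w ext.j_one by (metis rangeI)
  obtain T where T: "V.independent T" "UNIV \<subseteq> V.span T" "card T = 2"
    using V.basis_exists[of UNIV] dim_2 by metis
  have "x \<in> V.span {w, 1}" for x
  proof (rule ccontr)
    assume x: "x \<notin> V.span {w, 1}"
    then have "V.independent {x, w, 1}" using ind by (rule V.independent_insertI)
    \<comment> \<open>Cardinality 2 makes \<open>T\<close> finite, so the exchange lemma bounds
      independent sets.\<close>
    then have "card {x, w, 1} \<le> card T"
      using T by (intro conjunct2[OF V.independent_span_bound]) (auto intro: card_ge_0_finite)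
    moreover have "x \<noteq> w" "x \<noteq> 1" using x V.span_base[of _ "{w, 1}"] by blast+
    ultimately show False using T(3) \<open>w \<noteq> 1\<close> by simp
  qed
  then have "\<exists>a b. x = j a + j b * w" for x
  proof -
    have "x \<in> V.span {w, 1}" by fact
    then obtain b where "x - j b * w \<in> V.span {1}" by (auto simp: V.span_breakdown_eq)
    then obtain a where "x - j b * w = j a" by (auto simp: V.span_singleton)
    then have "x = j a + j b * w" by (simp add: algebra_simps)
    then show ?thesis by blast
  qed
  then show thesis using w that by blast
qed

lemma nvE_power:
  assumes "x \<noteq> 0"
  obtains k :: int where "nvE x = (nv K.prm powi k)\<^sup>2"
proof -
  have "nvE x \<in> nvE ` (- {0})" using assms by auto
  then obtain a where a: "a \<noteq> 0" "nvE x = nvE (j a)"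
    unfolding ext.unramified by auto
  obtain k where "nv a = nv K.prm powi k" using K.value_group[OF a(1)] by blast
  then show thesis using that[of k] a by (simp add: ext.norm_j)
qed

text \<open>The distance from \<open>w\<close> to the base field is attained because the latter is complete and the
  values are discrete.\<close>

lemma best_approximation:
  assumes w: "w \<notin> range j"
  obtains a where "\<And>b. nvE (w - j a) \<le> nvE (w - j b)"
proof -
  let ?p = "nv K.prm"
  have nz: "w - j a \<noteq> 0" for a using w by auto
  \<comment> \<open>The exponents of the distances; a larger exponent means a better approximation.
    If they were unbounded, approximations would converge to an element of the base field equal to
    \<open>w\<close>.\<close>
  define S where "S = {k::int. \<exists>a. nvE (w - j a) = (?p powi k)\<^sup>2}"
  have S: "S \<noteq> {}" using nvE_power[OF nz[of 0]] unfolding S_def by blast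
  have mono: "(?p powi k)\<^sup>2 \<le> (?p powi k')\<^sup>2" if "k' \<le> k" for k k' :: int
    using that K.unif by (intro power_mono power_int_decreasing) auto
  have "\<exists>M. \<forall>k\<in>S. k \<le> M"
  proof (rule ccontr)
    assume unb: "\<nexists>M. \<forall>k\<in>S. k \<le> M"
    have "\<exists>a. nvE (w - j a) \<le> (?p ^ n)\<^sup>2" for n
    proof -
      obtain k where k: "k \<in> S" "k > int n" using unb by (metis not_le)
      then obtain a where "nvE (w - j a) = (?p powi k)\<^sup>2" by (auto simp: S_def)
      also have "\<dots> \<le> (?p powi int n)\<^sup>2" using k by (intro mono) simp
      finally show ?thesis by auto
    qed
    then obtain X where X: "\<And>n. nvE (w - j (X n)) \<le> (?p ^ n)\<^sup>2" by metis
    have decr: "(?p ^ m)\<^sup>2 \<le> (?p ^ n)\<^sup>2" if "n \<le> m" for m n :: nat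
      using mono[of "int n" "int m"] that by simp
    have cauchy: "nv (X m - X n) \<le> ?p ^ N" if "m \<ge> N" "n \<ge> N" for m n N
    proof -
      have "nvE (w - j (X n)) \<le> (?p ^ N)\<^sup>2" "nvE (w - j (X m)) \<le> (?p ^ N)\<^sup>2"
        using X[of n] X[of m] decr[OF that(1)] decr[OF that(2)] by linarith+
      then have "nvE ((w - j (X n)) - (w - j (X m))) \<le> (?p ^ N)\<^sup>2" by (rule ext.E.nv_diff_leI)
      then have "(nv (X m - X n))\<^sup>2 \<le> (?p ^ N)\<^sup>2" by (simp add: j_diff flip: ext.norm_j)
      then show ?thesis by (rule power2_le_imp_le) (use K.unif in simp)
    qed
    have "\<exists>x. (\<lambda>n. nv (X n - x)) \<longlonglongrightarrow> 0"
    proof (rule K.complete, intro allI impI)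
      fix e :: real assume "e > 0"
      then obtain N where N: "?p ^ N < e" using real_arch_pow_inv K.unif by blast
      show "\<exists>N. \<forall>m\<ge>N. \<forall>n\<ge>N. nv (X m - X n) < e"
        using cauchy[of N] N by (intro exI[of _ N]) (meson le_less_trans)
    qed
    then obtain a where a: "(\<lambda>n. nv (X n - a)) \<longlonglongrightarrow> 0" by blast
    have "(\<lambda>n. (nv (X n - a))\<^sup>2) \<longlonglongrightarrow> 0\<^sup>2" by (intro tendsto_power a)
    moreover have "(\<lambda>n. (?p ^ n)\<^sup>2) \<longlonglongrightarrow> 0\<^sup>2"
      using K.unif by (intro tendsto_power LIMSEQ_realpow_zero) auto
    ultimately have "(\<lambda>n. (?p ^ n)\<^sup>2 + (nv (X n - a))\<^sup>2) \<longlonglongrightarrow> 0"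
      using tendsto_add by fastforce
    moreover have "nvE (w - j a) \<le> (?p ^ n)\<^sup>2 + (nv (X n - a))\<^sup>2" for n
    proof -
      have "nvE ((w - j (X n)) + j (X n - a)) \<le> (?p ^ n)\<^sup>2 + (nv (X n - a))\<^sup>2"
        using X[of n] zero_le_power2[of "?p ^ n"] zero_le_power2[of "nv (X n - a)"]
        by (intro ext.E.nv_add_leI) (simp_all add: ext.norm_j add_increasing2)
      then show ?thesis by (simp add: j_diff)
    qed
    ultimately have "nvE (w - j a) \<le> 0"
      by (intro LIMSEQ_le_const[of _ 0 "nvE (w - j a)"]) blast+
    then show False using ext.E.nv_pos[OF nz[of a]] by simp
  qed
  then obtain M where M: "\<And>k. k \<in> S \<Longrightarrow> k \<le> M" by blast
  obtain k0 where k0: "k0 \<in> S" using S by blast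
  \<comment> \<open>\<open>S\<close> need not be finite; cutting it off below at \<open>k0\<close>
    leaves a finite nonempty set with the same maximum.\<close>
  define k where "k = Max (S \<inter> {k0..M})"
  have fin: "finite (S \<inter> {k0..M})" by simp
  have ne: "S \<inter> {k0..M} \<noteq> {}" using k0 M by auto
  have k: "k \<in> S" "\<And>k'. k' \<in> S \<Longrightarrow> k' \<le> k"
  proof -
    have kin: "k \<in> S \<inter> {k0..M}" unfolding k_def by (rule Max_in[OF fin ne])
    then show "k \<in> S" by simp
    show "k' \<le> k" if "k' \<in> S" for k'
    proof (cases "k0 \<le> k'")
      case True
      then show ?thesis unfolding k_def using that M by (intro Max_ge fin) auto
    next
      case False
      then show ?thesis using kin by auto
    qed
  qed
  obtain a where a: "nvE (w - j a) = (?p powi k)\<^sup>2" using k(1) by (auto simp: S_def)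
  have "nvE (w - j a) \<le> nvE (w - j b)" for b
  proof -
    obtain k' where k': "nvE (w - j b) = (?p powi k')\<^sup>2" using nvE_power[OF nz[of b]] .
    then have "k' \<in> S" by (auto simp: S_def)
    then show ?thesis unfolding a k' by (intro mono k(2))
  qed
  then show thesis by (rule that)
qed

text \<open>Subtract from a generator its best approximation and rescale to absolute value 1, which
  is possible because the value groups agree. No element of the base field is then at distance below
  1 from \<open>w\<close>, and this is orthogonality.\<close>

lemma quad_algebra_ex: "\<exists>w. quad_algebra nv K.prm K.digits nvE j w"
proof -
  obtain w0 where w0: "w0 \<notin> range j" "\<And>x. \<exists>a b. x = j a + j b * w0" using basis_ex by blast
  obtain a0 where a0: "\<And>b. nvE (w0 - j a0) \<le> nvE (w0 - j b)" using best_approximation[OF w0(1)] by blast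
  have nz: "w0 - j a0 \<noteq> 0" using w0(1) by auto
  obtain k where k: "nvE (w0 - j a0) = (nv K.prm powi k)\<^sup>2" using nvE_power[OF nz] .
  define t where "t = K.prm powi (- k)"
  have t: "t \<noteq> 0" using K.unif_nz by (simp add: t_def del: K.unif_nz)
  have "nv t = nv K.prm powi (- k)" by (simp add: t_def K.nv_powi)
  then have nvt: "(nv t)\<^sup>2 * (nv K.prm powi k)\<^sup>2 = 1"
    using K.unif by (simp add: power_int_minus flip: power_mult_distrib)
  define w where "w = j t * (w0 - j a0)"
  have w1: "nvE w = 1" using nvt by (simp add: w_def ext.E.nv_mult ext.norm_j k)
  have far: "1 \<le> nvE (j b + w)" for b
  proof -
    have "j b + w = j t * (w0 - j (a0 - b / t))"
    proof -
      have "j t * j (b / t) = j b" using t by (simp flip: ext.j_mult)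
      then show ?thesis by (simp add: w_def j_diff algebra_simps)
    qed
    then have "nvE (j b + w) = (nv t)\<^sup>2 * nvE (w0 - j (a0 - b / t))"
      by (simp add: ext.E.nv_mult ext.norm_j)
    also have "\<dots> \<ge> (nv t)\<^sup>2 * nvE (w0 - j a0)" by (intro mult_left_mono a0) simp
    finally show ?thesis using nvt by (simp add: k)
  qed
  have "quad_algebra nv K.prm K.digits nvE j w"
  proof unfold_locales
    show "nvE (j a + j b * w) = (max (nv a) (nv b))\<^sup>2" for a b
    proof (cases "b = 0")
      case True
      then show ?thesis using K.nv_nonneg[of a] by (simp add: j_0 ext.norm_j max_def)
    next
      case False
      then have b: "nv b > 0" by (rule K.nv_pos)
      have "j b * j (a / b) = j a" using False by (simp flip: ext.j_mult)
      then have eq: "j a + j b * w = j b * (j (a / b) + w)" by (simp add: algebra_simps)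
      have ab: "nvE (j (a / b)) = (nv a / nv b)\<^sup>2" by (simp add: ext.norm_j K.nv_divide)
      show ?thesis
      proof (cases "nv a \<le> nv b")
        case True
        then have "nv a / nv b \<le> 1" using b by simp
        then have "(nv a / nv b)\<^sup>2 \<le> 1" using b K.nv_nonneg[of a] by (intro power_le_one) simp_all
        then have "nvE (j (a / b) + w) \<le> 1" using w1 ab by (intro ext.E.nv_add_leI) simp_all
        then have "nvE (j (a / b) + w) = 1" using far[of "a / b"] by simp
        then show ?thesis using True unfolding eq by (simp add: ext.E.nv_mult ext.norm_j max_def)
      next
        case False
        then have "1 < nv a / nv b" using b by simp
        then have "1 < (nv a / nv b)\<^sup>2" by simp
        then have "nvE w < nvE (j (a / b))" using w1 ab by simp
        then have "nvE (j (a / b) + w) = nvE (j (a / b))" by (rule ext.E.nv_add_eq')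
        then show ?thesis
          using False b unfolding eq by (simp add: ext.E.nv_mult ab ext.norm_j max_def power_divide K.nv_divide)
      qed
    qed
    show "\<exists>a b. z = j a + j b * w" for z
    proof -
      obtain a b where z: "z = j a + j b * w0" using w0(2) by blast
      have "j (b / t) * j t = j b" using t by (simp flip: ext.j_mult)
      then have "j (b / t) * w = j b * w0 - j b * j a0" by (simp add: w_def algebra_simps flip: mult.assoc)
      then have "z = j (a + b * a0) + j (b / t) * w"
        by (simp add: z ext.j_add ext.j_mult)
      then show ?thesis by blast
    qed
  qed (simp_all add: ext.j_add ext.j_mult ext.j_one)
  then show ?thesis ..
qed

end

section \<open>Multiplicity one\<close>

context padic_field
begin

lemma unram_ps_padic:
  "unram_quasichar nv chi \<Longrightarrow> unram_quasichar nv psi \<Longrightarrow> unram_ps_normalised nv prm digits chi psi"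
  by (intro unram_ps_normalised.intro unram_ps.intro unram_ps_axioms.intro
      unram_ps_normalised_axioms.intro discrete_field_padic card_digits)

lemma test_family_padic:
  assumes "unram_quasichar nv chi" "unram_quasichar nv psi"
    and irr: "\<not> eq_char (\<lambda>x. chi x / psi x) (\<lambda>x. complex_of_real (inverse (nv x)))"
    and ne: "cmod (chi prm) \<noteq> cmod (psi prm)"
  obtains F c where "test_family nv prm digits chi psi F c"
    "cmod (c prm) = inverse (sqrt (nv prm)) * min (cmod (chi prm)) (cmod (psi prm))"
proof -
  interpret P: unram_ps_normalised nv prm digits chi psi by (rule unram_ps_padic[OF assms(1,2)])
  have "P.eta prm \<noteq> 1" using irr P.eta_unif_eq_1 by blast
  from P.test_family_exists[OF this ne] that show thesis by blast
qed

lemma multiplicity_one_split: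
  assumes chi: "unram_quasichar nv chi" "unram_quasichar nv psi"
    and chi1: "unram_quasichar nv chi1" "unram_quasichar nv psi1"
    and chi2: "unram_quasichar nv chi2" "unram_quasichar nv psi2"
    and irr: "\<not> eq_char (\<lambda>x. chi x / psi x) (\<lambda>x. complex_of_real (inverse (nv x)))"
    and ne: "cmod (chi prm) \<noteq> cmod (psi prm)"
    and central: "eq_char (\<lambda>x. chi x * psi x * (chi1 x * psi1 x * chi2 x * psi2 x)) (\<lambda>_. 1)"
    and tempered: "cmod (chi1 prm) = cmod (psi1 prm)" "cmod (chi2 prm) = cmod (psi2 prm)"
  shows "cdim_le (invariant_functionals translate_split
    (tensor (principal_series nv chi psi)
      (tensor (principal_series nv chi1 psi1) (principal_series nv chi2 psi2)))) 1"
proof -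
  interpret P1: unram_ps_normalised nv prm digits chi1 psi1 by (rule unram_ps_padic[OF chi1])
  interpret P2: unram_ps_normalised nv prm digits chi2 psi2 by (rule unram_ps_padic[OF chi2])
  obtain F c where test: "test_family nv prm digits chi psi F c" and
    c: "cmod (c prm) = inverse (sqrt (nv prm)) * min (cmod (chi prm)) (cmod (psi prm))"
    using test_family_padic[OF chi irr ne] by blast
  interpret T: test_family nv prm digits chi psi F c by (rule test)
  define M where "M = min (cmod (chi prm)) (cmod (psi prm))"
  define s where "s = sqrt (nv prm)"
  define A1 A2 where "A1 = cmod (chi1 prm)" and "A2 = cmod (chi2 prm)"
  have s: "0 < s" "s < 1" "nv prm = s * s" using P1.unif by (simp_all add: s_def)
  have pos: "A1 > 0" "A2 > 0" "cmod (chi prm) > 0" "cmod (psi prm) > 0"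
    using P1.chi_nz[OF P1.unif_nz] P2.chi_nz[OF P1.unif_nz] T.chi_nz[OF P1.unif_nz] T.psi_nz[OF P1.unif_nz]
    by (simp_all add: A1_def A2_def)
  have "chi prm * psi prm * (chi1 prm * psi1 prm * chi2 prm * psi2 prm) = 1"
    using central P1.unif_nz unfolding eq_char_def by blast
  then have "cmod (chi prm * psi prm * (chi1 prm * psi1 prm * chi2 prm * psi2 prm)) = 1" by simp
  \<comment> \<open>The equalities |\<alpha>_i| = |\<beta>_i| turn the central character into the
    square of A1 A2.\<close>
  then have "cmod (chi prm) * cmod (psi prm) * (A1 * A2)\<^sup>2 = 1"
    using tempered by (simp add: norm_mult A1_def A2_def power2_eq_square mult_ac)
  then have "M * (A1 * A2) < 1"
    unfolding M_def by (rule tempered_product_less_1) (use ne pos in simp_all)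
  then have less: "M * A1 * A2 < 1" by (simp add: mult.assoc)
  have card: "real (card (digits 1)) = inverse s * inverse s"
    using card_digits s by (simp add: field_simps)
  have norms: "cmod (c prm) = inverse s * M" "cmod (P1.omega prm) = s * A1" "cmod (P2.omega prm) = s * A2"
    "cmod (P1.omega prm * P1.eta prm) = inverse s * A1" "cmod (P2.omega prm * P2.eta prm) = inverse s * A2"
    using c P1.cmod_omega_eta[OF P1.unif_nz] P2.cmod_omega_eta[OF P1.unif_nz] tempered
    by (simp_all add: P1.cmod_omega P2.cmod_omega s_def M_def A1_def A2_def)
  \<comment> \<open>Here \<open>inverse s\<close> is the square root of q, so the modulus stays
    below q itself.\<close>
  have bound: "inverse s * (M * A1 * A2) < real (card (digits 1))"
  proof -
    have "1 < inverse s" using s by (simp add: field_simps)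
    then have "inverse s * (M * A1 * A2) < inverse s * inverse s"
      using less s by (intro mult_strict_left_mono) auto
    then show ?thesis unfolding card .
  qed
  have "cmod (c prm * P1.omega prm * (P2.omega prm * P2.eta prm)) = inverse s * (M * A1 * A2)"
    "cmod (c prm * (P1.omega prm * P1.eta prm) * P2.omega prm) = inverse s * (M * A1 * A2)"
    "cmod (c prm * P1.omega prm * P2.omega prm) = s * (M * A1 * A2)"
    unfolding norm_mult[of "c prm * _"] norm_mult[of "c prm"] norms using s by (simp_all add: field_simps)
  note cm = this
  have exponents: "c prm * P1.omega prm * (P2.omega prm * P2.eta prm) \<noteq> P1.q"
    "c prm * (P1.omega prm * P1.eta prm) * P2.omega prm \<noteq> P1.q"
    using cm(1,2) bound by (metis norm_of_nat order_less_irrefl)+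
  have "s * (M * A1 * A2) < 1 * 1"
    using s less pos by (intro mult_strict_mono) (auto simp: M_def)
  then have exponent3: "c prm * P1.omega prm * P2.omega prm \<noteq> 1"
    using cm(3) by (metis norm_one mult_1 order_less_irrefl)
  have translate: "(\<lambda>y. v (translate_split h y)) = (\<lambda>(x, y). v (x ** h, y ** h))"
    for v :: "('a^2^2) \<times> ('a^2^2) \<Rightarrow> complex" and h
    by (simp add: translate_split_def fun_eq_iff)
  show ?thesis
  \<comment> \<open>The test vector is the product of the unit balls in the two big cells; its mass
    is the one number that determines the homogeneous distribution.\<close>
  proof (rule T.invariant_functionals_cdim_le_1[OF tensor_subspace,
        where ?v0.0 = "\<lambda>(x, y). P1.big 0 1 x * P2.big 0 1 y"])
    show "(\<lambda>y. v (translate_split h y)) \<in> tensor P1.PS P2.PS" if "v \<in> tensor P1.PS P2.PS" "invertible h" for v h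
      unfolding translate using that by (intro tensor_translate P1.PS_translate P2.PS_translate)
    show "translate_split k (translate_split h y) = translate_split (h ** k) y" for k h :: "'a^2^2" and y
      by (simp add: translate_split_def case_prod_unfold matrix_mul_assoc)
    show "translate_split (mat 1 :: 'a^2^2) y = y" for y
      by (simp add: translate_split_def case_prod_unfold)
    show "(\<lambda>(x, y). P1.big 0 1 x * P2.big 0 1 y) \<in> tensor P1.PS P2.PS"
      by (intro tensor_mem P1.big_mem P2.big_mem) simp_all
    show "\<exists>e>0. \<forall>u. near_one e u \<longrightarrow> (\<forall>y. v (translate_split u y) = v y)" if "v \<in> tensor P1.PS P2.PS" for v
      using that
    proof (induction rule: tensor_induct)
      case base
      show ?case by (intro exI[of _ 1]) simp
    next
      case (step k f g t)
      obtain e where e: "0 < e" "\<And>u x. near_one e u \<Longrightarrow> f (x ** u) = f x" using P1.PS_smooth[OF step(1)] by metis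
      obtain e' where e': "0 < e'" "\<And>u x. near_one e' u \<Longrightarrow> g (x ** u) = g x" using P2.PS_smooth[OF step(2)] by metis
      obtain e'' where e'': "0 < e''" "\<And>u y. near_one e'' u \<Longrightarrow> t (translate_split u y) = t y" using step(4) by blast
      show ?case
      proof (intro exI[of _ "min e (min e' e'')"] conjI allI impI)
        fix u y assume u: "near_one (min e (min e' e'')) u"
        have "near_one e u" "near_one e' u" "near_one e'' u" using near_one_mono[OF u] by simp_all
        then show "(case translate_split u y of (x, y) \<Rightarrow> k * (f x * g y) + t (x, y)) =
            (case y of (x, y) \<Rightarrow> k * (f x * g y) + t (x, y))"
          using e(2) e'(2) e''(2)[of u y] by (simp add: translate_split_def case_prod_unfold)
      qed (use e e' e'' in simp)
    qed
    fix \<Lambda> v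
    assume lin: "clinear_on (tensor P1.PS P2.PS) \<Lambda>"
      and up: "\<And>v b. v \<in> tensor P1.PS P2.PS \<Longrightarrow> \<Lambda> (\<lambda>y. v (translate_split (mat2 1 b 0 1) y)) = \<Lambda> v"
      and diag: "\<And>v a. v \<in> tensor P1.PS P2.PS \<Longrightarrow> a \<noteq> 0 \<Longrightarrow>
        c a * \<Lambda> (\<lambda>y. v (translate_split (mat2 a 0 0 1) y)) = \<Lambda> v"
      and zero: "\<Lambda> (\<lambda>(x, y). P1.big 0 1 x * P2.big 0 1 y) = 0"
      and v: "v \<in> tensor P1.PS P2.PS"
    interpret split_orbits nv prm digits chi1 psi1 chi2 psi2 "\<lambda>f g. \<Lambda> (\<lambda>(x, y). f x * g y)" c
    proof unfold_locales
      show "clinear_on P1.PS (\<lambda>f. \<Lambda> (\<lambda>(x, y). f x * g y))" if "g \<in> P2.PS" for g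
        by (rule tensor_clinear_left[OF lin P1.PS_subspace that])
      show "clinear_on P2.PS (\<lambda>g. \<Lambda> (\<lambda>(x, y). f x * g y))" if "f \<in> P1.PS" for f
        by (rule tensor_clinear_right[OF lin P2.PS_subspace that])
      show "\<Lambda> (\<lambda>(x, y). f (x ** mat2 1 b 0 1) * g (y ** mat2 1 b 0 1)) = \<Lambda> (\<lambda>(x, y). f x * g y)"
        if "f \<in> P1.PS" "g \<in> P2.PS" for f g b
        using up[OF tensor_mem[OF that], of b] by (simp add: translate)
      show "c a * \<Lambda> (\<lambda>(x, y). f (x ** mat2 a 0 0 1) * g (y ** mat2 a 0 0 1)) = \<Lambda> (\<lambda>(x, y). f x * g y)"
        if "a \<noteq> 0" "f \<in> P1.PS" "g \<in> P2.PS" for f g a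
        using diag[OF tensor_mem[OF that(2,3)] that(1)] by (simp add: translate)
    qed (use T.c_nz T.c_unit exponents exponent3 zero in simp_all)
    show "\<Lambda> v = 0" by (rule tensor_functional_zero[OF lin B_zero v])
  qed
qed

end

context padic_ext
begin

lemma multiplicity_one_inert:
  assumes chi: "unram_quasichar nv chi" "unram_quasichar nv psi"
    and chiE: "unram_quasichar nvE chiE" "unram_quasichar nvE psiE"
    and irr: "\<not> eq_char (\<lambda>x. chi x / psi x) (\<lambda>x. complex_of_real (inverse (nv x)))"
    and ne: "cmod (chi K.prm) \<noteq> cmod (psi K.prm)"
    and central: "eq_char (\<lambda>x. chi x * psi x * (chiE (j x) * psiE (j x))) (\<lambda>_. 1)"
    and tempered: "cmod (chiE (of_nat l)) = cmod (psiE (of_nat l))"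
  shows "cdim_le (invariant_functionals (translate_inert j)
    (tensor (principal_series nv chi psi) (principal_series nvE chiE psiE))) 1"
proof -
  obtain w where w: "quad_algebra nv K.prm K.digits nvE j w" using quad_algebra_ex by blast
  interpret Q: quad_algebra nv K.prm K.digits nvE j w by (rule w)
  interpret PE: unram_ps nvE "j K.prm" "quad_algebra.RE K.digits j w" chiE psiE
    by (intro unram_ps.intro unram_ps_axioms.intro Q.discrete_field_E chiE)
  obtain F c where test: "test_family nv K.prm K.digits chi psi F c" and
    c: "cmod (c K.prm) = inverse (sqrt (nv K.prm)) * min (cmod (chi K.prm)) (cmod (psi K.prm))"
    using K.test_family_padic[OF chi irr ne] by blast
  interpret T: test_family nv K.prm K.digits chi psi F c by (rule test)
  define M where "M = min (cmod (chi K.prm)) (cmod (psi K.prm))"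
  define s where "s = sqrt (nv K.prm)"
  define A where "A = cmod (chiE (j K.prm))"
  have s: "0 < s" "s < 1" "nv K.prm = s * s" using K.unif by (simp_all add: s_def)
  have pos: "A > 0" "cmod (chi K.prm) > 0" "cmod (psi K.prm) > 0"
    using PE.chi_nz[OF PE.unif_nz] T.chi_nz[OF K.unif_nz] T.psi_nz[OF K.unif_nz] by (simp_all add: A_def)
  have "chi K.prm * psi K.prm * (chiE (j K.prm) * psiE (j K.prm)) = 1"
    using central K.unif_nz unfolding eq_char_def by blast
  then have "cmod (chi K.prm * psi K.prm * (chiE (j K.prm) * psiE (j K.prm))) = 1" by simp
  then have "cmod (chi K.prm) * cmod (psi K.prm) * A\<^sup>2 = 1"
    using tempered by (simp add: norm_mult A_def power2_eq_square j_of_nat mult_ac)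
  then have less: "M * A < 1"
    unfolding M_def by (rule tempered_product_less_1) (use ne pos in simp_all)
  \<comment> \<open>The normalised absolute value of l in the extension is |l|^2, so its square root
    is |l| = \<open>s * s\<close>.\<close>
  have "cmod (PE.omega (j K.prm)) = s * s * A"
    using s by (simp add: PE.cmod_omega A_def ext.norm_j)
  then have "cmod (c K.prm * PE.omega (j K.prm)) = s * (M * A)"
    using c s unfolding norm_mult by (simp add: s_def[symmetric] M_def[symmetric] field_simps)
  moreover have "s * (M * A) < 1 * 1"
    using s less pos by (intro mult_strict_mono) (auto simp: M_def)
  ultimately have exponent: "c K.prm * PE.omega (j K.prm) \<noteq> 1"
    by (metis norm_one mult_1 order_less_irrefl)
  define J where "J = (\<lambda>h :: 'a^2^2. (\<chi> i k. j (h $ i $ k)) :: 'b^2^2)"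
  have J_nth: "J h $ i $ k = j (h $ i $ k)" for h i k by (simp add: J_def)
  have translate: "translate_inert j h g = g ** J h" for h g by (simp add: translate_inert_def J_def)
  have J_mult: "J (h ** k) = J h ** J k" for h k
    by (simp add: mat2_eq_iff mult2_nth J_nth ext.j_add ext.j_mult)
  have J_mat2: "J (mat2 a b c d) = mat2 (j a) (j b) (j c) (j d)" for a b c d
    by (simp add: mat2_eq_iff J_nth)
  have J_1: "J (mat 1) = mat 1" by (simp add: mat2_eq_iff J_nth j_0 ext.j_one)
  have J_inv: "invertible (J h)" if h: "invertible h" for h
  proof -
    have "det (J h) = j (det h)" by (simp add: det_2 J_nth j_diff ext.j_mult)
    then show ?thesis using h Q.j_nz by (simp add: invertible_det_nz)
  qed
  show ?thesis
  proof (rule T.invariant_functionals_cdim_le_1[where S = PE.PS and ?v0.0 = "PE.big 0 1", OF PE.PS_subspace])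
    show "(\<lambda>y. v (translate_inert j h y)) \<in> PE.PS" if "v \<in> PE.PS" "invertible h" for v h
      unfolding translate using that by (intro PE.PS_translate J_inv)
    show "translate_inert j k (translate_inert j h y) = translate_inert j (h ** k) y" for k h y
      by (simp add: translate J_mult matrix_mul_assoc)
    show "translate_inert j (mat 1) y = y" for y by (simp add: translate J_1)
    show "PE.big 0 1 \<in> PE.PS" by (simp add: PE.big_mem)
    show "\<exists>e>0. \<forall>u. K.near_one e u \<longrightarrow> (\<forall>y. v (translate_inert j u y) = v y)" if v: "v \<in> PE.PS" for v
    proof -
      obtain e where e: "0 < e" "\<And>u x. ext.E.near_one e u \<Longrightarrow> v (x ** u) = v x" using PE.PS_smooth[OF v] by metis
      \<comment> \<open>Since \<open>nvE\<close> squares distances, the radius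
        \<open>min 1 e\<close> is chosen to give a square of at most \<open>1 * e\<close>.\<close>
      have "ext.E.near_one e (J u)" if u: "K.near_one (min 1 e) u" for u
        unfolding ext.E.near_one_def
      proof (intro conjI allI)
        show "invertible (J u)" using u by (intro J_inv) (simp add: K.near_one_def)
        fix i k
        have uik: "nv (u $ i $ k - mat 1 $ i $ k) \<le> min 1 e" using u by (simp add: K.near_one_def)
        have "J u $ i $ k - mat 1 $ i $ k = j (u $ i $ k - mat 1 $ i $ k)"
          unfolding j_diff J_nth[symmetric] J_1 ..
        then have "nvE (J u $ i $ k - mat 1 $ i $ k) = nv (u $ i $ k - mat 1 $ i $ k) * nv (u $ i $ k - mat 1 $ i $ k)"
          by (simp add: ext.norm_j power2_eq_square)
        also have "\<dots> \<le> 1 * e" using uik e(1) K.nv_nonneg by (intro mult_mono) auto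
        finally show "nvE (J u $ i $ k - mat 1 $ i $ k) \<le> e" by simp
      qed
      then show ?thesis using e by (intro exI[of _ "min 1 e"]) (simp add: translate)
    qed
    fix \<Lambda> v
    assume lin: "clinear_on PE.PS \<Lambda>"
      and up: "\<And>v b. v \<in> PE.PS \<Longrightarrow> \<Lambda> (\<lambda>y. v (translate_inert j (mat2 1 b 0 1) y)) = \<Lambda> v"
      and diag: "\<And>v a. v \<in> PE.PS \<Longrightarrow> a \<noteq> 0 \<Longrightarrow>
        c a * \<Lambda> (\<lambda>y. v (translate_inert j (mat2 a 0 0 1) y)) = \<Lambda> v"
      and zero: "\<Lambda> (PE.big 0 1) = 0"
      and v: "v \<in> PE.PS"
    interpret inert_orbits nv K.prm K.digits nvE j w chiE psiE \<Lambda> c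
    proof unfold_locales
      show "\<Lambda> (\<lambda>x. f (x ** mat2 1 (j b) 0 1)) = \<Lambda> f" if "f \<in> PE.PS" for f b
        using up[OF that, of b] by (simp add: translate J_mat2 j_0 ext.j_one)
      show "c a * \<Lambda> (\<lambda>x. f (x ** mat2 (j a) 0 0 1)) = \<Lambda> f" if "a \<noteq> 0" "f \<in> PE.PS" for f a
        using diag[OF that(2,1)] by (simp add: translate J_mat2 j_0 ext.j_one)
    qed (use lin T.c_nz T.c_unit exponent zero in simp_all)
    show "\<Lambda> v = 0" by (rule L_zero[OF v])
  qed
qed

end

theorem mainTheorem1:
  fixes F :: "real set" and l :: nat
    and nv :: "'k::field_char_0 \<Rightarrow> real"
    and chi psi :: "'k \<Rightarrow> complex"
  assumes "real_quadratic_field F"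
    and "prime l"
    and "unramified_in l F"
    and "padic_field l nv"
    and "unram_quasichar nv chi" and "unram_quasichar nv psi"
    and "\<not> eq_char (\<lambda>x. chi x / psi x) (\<lambda>x. complex_of_real (inverse (nv x)))"
    and "cmod (chi (of_nat l)) \<noteq> cmod (psi (of_nat l))"
  shows "(splits_in l F \<longrightarrow>
      (\<forall>chi1 psi1 chi2 psi2 :: 'k \<Rightarrow> complex.
         unram_quasichar nv chi1 \<and> unram_quasichar nv psi1 \<and>
         unram_quasichar nv chi2 \<and> unram_quasichar nv psi2 \<and>
         \<not> eq_char (\<lambda>x. chi1 x / psi1 x) (\<lambda>x. complex_of_real (nv x)) \<and>
         \<not> eq_char (\<lambda>x. chi1 x / psi1 x) (\<lambda>x. complex_of_real (inverse (nv x))) \<and>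
         \<not> eq_char (\<lambda>x. chi2 x / psi2 x) (\<lambda>x. complex_of_real (nv x)) \<and>
         \<not> eq_char (\<lambda>x. chi2 x / psi2 x) (\<lambda>x. complex_of_real (inverse (nv x))) \<and>
         eq_char (\<lambda>x. chi x * psi x * (chi1 x * psi1 x * chi2 x * psi2 x)) (\<lambda>_. 1) \<and>
         cmod (chi1 (of_nat l)) = cmod (psi1 (of_nat l)) \<and>
         cmod (chi2 (of_nat l)) = cmod (psi2 (of_nat l)) \<longrightarrow>
         cdim_le
           (invariant_functionals translate_split
             (tensor (principal_series nv chi psi)
               (tensor (principal_series nv chi1 psi1) (principal_series nv chi2 psi2)))) 1))
    \<and> (inert_in l F \<longrightarrow>
      (\<forall>(nvE :: 'e::field \<Rightarrow> real) (j :: 'k \<Rightarrow> 'e) (chiE :: 'e \<Rightarrow> complex) psiE.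
         unramified_quadratic_ext nv nvE j \<and>
         unram_quasichar nvE chiE \<and> unram_quasichar nvE psiE \<and>
         \<not> eq_char (\<lambda>x. chiE x / psiE x) (\<lambda>x. complex_of_real (nvE x)) \<and>
         \<not> eq_char (\<lambda>x. chiE x / psiE x) (\<lambda>x. complex_of_real (inverse (nvE x))) \<and>
         eq_char (\<lambda>x. chi x * psi x * (chiE (j x) * psiE (j x))) (\<lambda>_. 1) \<and>
         cmod (chiE (of_nat l)) = cmod (psiE (of_nat l)) \<longrightarrow>
         cdim_le
           (invariant_functionals (translate_inert j)
             (tensor (principal_series nv chi psi) (principal_series nvE chiE psiE))) 1))"
proof -
  interpret padic_field l nv by fact
  show ?thesis
  proof (intro conjI impI allI, goal_cases)
    case (1 chi1 psi1 chi2 psi2)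
    then show ?case using assms(5-8) by (intro multiplicity_one_split) simp_all
  next
    case (2 nvE j chiE psiE)
    then interpret ext: unramified_quadratic_ext nv nvE j by blast
    interpret padic_ext l nv nvE j ..
    show ?case using 2 assms(5-8) by (intro multiplicity_one_inert) simp_all
  qed
qed

end
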